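(* Let $n \in \{2,3\}$ and let $d$ be a locally DC function on an open set $G \subset \mathbb{R}^n$. Suppose that $d$ has no stationary point. Then there exists a set $N \subset \mathbb{R}$ with $\mathcal{H}^{(n-1)/2}(N)=0$ such that, for every $r \in d(G)\setminus N$, the set $d^{-1}(r)$ is an $(n-1)$-dimensional DC surface in $\mathbb{R}^n$. If $d$ is even locally semiconcave, then one can also assert that (for every $r\in d(G)\setminus N$) $d^{-1}(r)$ is an $(n-1)$-dimensional semiconcave surface in $\mathbb{R}^n$ and the set $\{x\in G:\ d(x)\ge r\}$ has locally positive reach. Moreover, $N$ can be chosen so that $N=d(C)$, where $C$ is a closed set in $G$ (i.e. relatively closed). Namely, one can put $N:=\mathrm{cv}(d)=d(\mathrm{Crit}(d))$.
   Context: $\mathcal{H}^s$ denotes $s$-dimensional Hausdorff measure. DC functions: a real function on a nonempty convex set $C$ in a real normed linear space is DC if it is a difference of two continuous convex functions on $C$. A mapping $F:C\to Y$ into a finite-dimensional normed space $Y$ is DC if $y^*\circ F$ is DC for every linear functional $y^*\in Y^*$. A function or mapping on an open set $G$ is locally DC if every point of $G$ has an open convex neighbourhood in $G$ on which it is DC. (Locally DC functions are locally Lipschitz.) Stationary point: a point $x$ at which the Fréchet derivative $d'(x)$ exists and equals $0$. Semiconcavity: on an open convex subset $C$ of a real inner product space $H$, $u:C\to\mathbb{R}$ is semiconcave if for some constant $c$ the function $x\mapsto u(x)-(c/2)\|x\|^2$ is concave on $C$. A function on an open set $G\subset H$ is locally semiconcave if for each $x\in G$ there is $\delta>0$ such that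 it is semiconcave on $B(x,\delta)$. Critical points: for a locally Lipschitz $f$ on an open subset $G$ of a normed linear space $X$, the Clarke derivative is $f^0(a,v)=\limsup_{z\to a,\,t\to0+}\frac{f(z+tv)-f(z)}{t}$ and the Clarke subdifferential is $\partial^Cf(a)=\{x^*\in X^*:\langle x^*,v\rangle\le f^0(a,v)\ \forall v\in X\}$. The set of critical points is $\mathrm{Crit}(f)=\{a\in G:0\in\partial^Cf(a)\}$ and the set of critical values is $\mathrm{cv}(f)=f(\mathrm{Crit}(f))$. Surfaces: let $H$ be an $n$-dimensional real inner product space and $1\le k<n$. A nonempty set $M\subset H$ is a $k$-dimensional DC surface in $H$ if for each $x\in M$ there exist a $k$-dimensional linear subspace $Q\subset H$, an open neighbourhood $W$ of $x$, a set $D\subset Q$ open in $Q$ and a locally DC mapping $h:D\to Q^\perp$ such that $M\cap W=\{u+h(u):u\in D\}$. A nonempty set $M\subset H$ is an $(n-1)$-dimensional semiconcave surface in $H$ if for each $x\in M$ there exist an $(n-1)$-dimensional linear subspace $Q\subset H$, an open neighbourhood $W$ of $x$, a set $D\subset Q$ open in $Q$, a vector $0\ne v\in Q^\perp$ and a locally semiconcave function $s:D\to\mathbb{R}$ such that $M\cap W=\{u+s(u)v:u\in D\}$. Reach: for a nonempty subset $A$ of a metric space $X$ and $p\in A$, $\mathrm{reach}(A,p)$ is the supremum of all $\varepsilon>0$ such that every $q\in X$ with $\mathrm{dist}(p,q)<\varepsilon$ has a unique nearest point in $A$ (supremum of the empty set being $0$). $A$ has locally positive reach if $\mathrm{reach}(A,p)>0$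 for all $p\in A$. Here the ambient metric space is $\mathbb{R}^n$. *)

theory Defs
  imports "HOL-Analysis.Analysis"
begin

text \<open>
  A function with a set as its domain is a total function; its values outside that set never matter.
  Where the ambient space may be a linear subspace (the tangent space of a surface), it is passed
  as the first argument \<open>X\<close>.
\<close>

subsection \<open>Hausdorff measure\<close>

text \<open>
  The measure is not normalised by the volume of a ball. The case distinction implements
  the convention that the zeroth power of the diameter is 1 for every nonempty set (in HOL, \<open>0 powr 0 = 0\<close>).
\<close>

definition diam_pow :: "real \<Rightarrow> 'a::metric_space set \<Rightarrow> ennreal" where
  "diam_pow s U =
     (if U = {} then 0 else if s = 0 then 1 else ennreal (diameter U powr s))"

definition hausdorff_premeasure :: "real \<Rightarrow> real \<Rightarrow> 'a::metric_space set \<Rightarrow> ennreal" where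
  "hausdorff_premeasure s \<delta> A =
     (INF U \<in> {U :: nat \<Rightarrow> 'a set.
                 A \<subseteq> (\<Union>i. U i) \<and> (\<forall>i. bounded (U i) \<and> diameter (U i) \<le> \<delta>)}.
        (\<Sum>i. diam_pow s (U i)))"

definition hausdorff_measure :: "real \<Rightarrow> 'a::metric_space set \<Rightarrow> ennreal" where
  "hausdorff_measure s A = (SUP \<delta>\<in>{0<..}. hausdorff_premeasure s \<delta> A)"

subsection \<open>DC functions and mappings\<close>

definition dc_on :: "'a::real_normed_vector set \<Rightarrow> ('a \<Rightarrow> real) \<Rightarrow> bool" where
  "dc_on C f \<longleftrightarrow> C \<noteq> {} \<and> convex C \<and>
     (\<exists>g h. continuous_on C g \<and> convex_on C g \<and> continuous_on C h \<and> convex_on C h \<and>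
            (\<forall>x\<in>C. f x = g x - h x))"

definition locally_dc_on :: "'a::real_normed_vector set \<Rightarrow> 'a set \<Rightarrow> ('a \<Rightarrow> real) \<Rightarrow> bool" where
  "locally_dc_on X G f \<longleftrightarrow>
     (\<forall>x\<in>G. \<exists>U. openin (top_of_set X) U \<and> convex U \<and> x \<in> U \<and> U \<subseteq> G \<and> dc_on U f)"

definition linear_functional_on :: "'b::real_vector set \<Rightarrow> ('b \<Rightarrow> real) \<Rightarrow> bool" where
  "linear_functional_on Y \<phi> \<longleftrightarrow>
     (\<forall>x\<in>Y. \<forall>y\<in>Y. \<phi> (x + y) = \<phi> x + \<phi> y) \<and> (\<forall>c. \<forall>x\<in>Y. \<phi> (c *\<^sub>R x) = c * \<phi> x)"

text \<open>Here \<open>Y\<close> is a linear subspace of a finite-dimensional space.\<close>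

definition dc_map_on ::
    "'a::real_normed_vector set \<Rightarrow> 'b::euclidean_space set \<Rightarrow> ('a \<Rightarrow> 'b) \<Rightarrow> bool" where
  "dc_map_on C Y F \<longleftrightarrow> F ` C \<subseteq> Y \<and> (\<forall>\<phi>. linear_functional_on Y \<phi> \<longrightarrow> dc_on C (\<lambda>x. \<phi> (F x)))"

definition locally_dc_map_on ::
    "'a::real_normed_vector set \<Rightarrow> 'a set \<Rightarrow> 'b::euclidean_space set \<Rightarrow> ('a \<Rightarrow> 'b) \<Rightarrow> bool" where
  "locally_dc_map_on X G Y F \<longleftrightarrow>
     (\<forall>x\<in>G. \<exists>U. openin (top_of_set X) U \<and> convex U \<and> x \<in> U \<and> U \<subseteq> G \<and> dc_map_on U Y F)"

subsection \<open>Semiconcave functions\<close>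

definition semiconcave_on :: "'a::real_inner set \<Rightarrow> ('a \<Rightarrow> real) \<Rightarrow> bool" where
  "semiconcave_on C u \<longleftrightarrow> (\<exists>c. concave_on C (\<lambda>x. u x - (c / 2) * (norm x)\<^sup>2))"

definition locally_semiconcave_on :: "'a::real_inner set \<Rightarrow> 'a set \<Rightarrow> ('a \<Rightarrow> real) \<Rightarrow> bool" where
  "locally_semiconcave_on X G u \<longleftrightarrow>
     (\<forall>x\<in>G. \<exists>\<delta>>0. ball x \<delta> \<inter> X \<subseteq> G \<and> semiconcave_on (ball x \<delta> \<inter> X) u)"

subsection \<open>Stationary and critical points\<close>

definition stationary_point :: "('a::real_normed_vector \<Rightarrow> real) \<Rightarrow> 'a \<Rightarrow> bool" where
  "stationary_point f x \<longleftrightarrow> (f has_derivative (\<lambda>v. 0)) (at x)"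

definition clarke_deriv :: "('a::real_normed_vector \<Rightarrow> real) \<Rightarrow> 'a \<Rightarrow> 'a \<Rightarrow> ereal" where
  "clarke_deriv f a v =
     Limsup (nhds a \<times>\<^sub>F at_right 0) (\<lambda>(z, t). ereal ((f (z + t *\<^sub>R v) - f z) / t))"

definition clarke_subdifferential ::
    "('a::real_normed_vector \<Rightarrow> real) \<Rightarrow> 'a \<Rightarrow> ('a \<Rightarrow>\<^sub>L real) set" where
  "clarke_subdifferential f a =
     {\<phi>. \<forall>v. ereal (blinfun_apply \<phi> v) \<le> clarke_deriv f a v}"

definition Crit :: "'a::real_normed_vector set \<Rightarrow> ('a \<Rightarrow> real) \<Rightarrow> 'a set" where
  "Crit G f = {a\<in>G. 0 \<in> clarke_subdifferential f a}"

definition cv :: "'a::real_normed_vector set \<Rightarrow> ('a \<Rightarrow> real) \<Rightarrow> real set" where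
  "cv G f = f ` Crit G f"

subsection \<open>Surfaces\<close>

definition dc_surface :: "nat \<Rightarrow> 'a::euclidean_space set \<Rightarrow> bool" where
  "dc_surface k M \<longleftrightarrow> 1 \<le> k \<and> k < DIM('a) \<and> M \<noteq> {} \<and>
     (\<forall>x\<in>M. \<exists>Q W D h.
        subspace Q \<and> dim Q = k \<and> open W \<and> x \<in> W \<and> openin (top_of_set Q) D \<and>
        locally_dc_map_on Q D (orthogonal_comp Q) h \<and>
        M \<inter> W = {u + h u |u. u \<in> D})"

text \<open>The dimension of a semiconcave surface is one less than that of the space.\<close>

definition semiconcave_surface :: "'a::euclidean_space set \<Rightarrow> bool" where
  "semiconcave_surface M \<longleftrightarrow> M \<noteq> {} \<and>
     (\<forall>x\<in>M. \<exists>Q W D v s.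
        subspace Q \<and> dim Q = DIM('a) - 1 \<and> open W \<and> x \<in> W \<and> openin (top_of_set Q) D \<and>
        v \<noteq> 0 \<and> v \<in> orthogonal_comp Q \<and> locally_semiconcave_on Q D s \<and>
        M \<inter> W = {u + s u *\<^sub>R v |u. u \<in> D})"

subsection \<open>Reach\<close>

text \<open>In \<^typ>\<open>ennreal\<close> the supremum of the empty set is 0.\<close>

definition reach :: "'a::metric_space set \<Rightarrow> 'a \<Rightarrow> ennreal" where
  "reach A p = Sup {ennreal \<epsilon> |\<epsilon>. \<epsilon> > 0 \<and>
     (\<forall>q. dist p q < \<epsilon> \<longrightarrow> (\<exists>!a. a \<in> A \<and> (\<forall>b\<in>A. dist q a \<le> dist q b)))}"

definition locally_positive_reach :: "'a::metric_space set \<Rightarrow> bool" where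
  "locally_positive_reach A \<longleftrightarrow> A \<noteq> {} \<and> (\<forall>p\<in>A. reach A p > 0)"

end

theory Submission
  imports Defs
begin

text \<open>
  Locally write \<open>d = g - h\<close> with \<open>g\<close> and \<open>h\<close> convex. Everything rests on subgradients of \<open>g\<close> and \<open>h\<close>.

  \<^bold>\<open>Size of the critical values.\<close> If no common vector is a subgradient of both \<open>g\<close> and \<open>h\<close> at \<open>a\<close>,
  a hyperplane separating the two subdifferentials yields a direction along which \<open>d\<close> decreases at a
  uniform rate near \<open>a\<close>, so \<open>a\<close> is not critical (\<open>subdiff_Int_at_Crit\<close>). Hence a critical point \<open>a\<close>
  carries a common subgradient \<open>x\<close>, and since \<open>a\<close> is not stationary one of the two subdifferentials, say
  that of \<open>g\<close>, contains another vector \<open>z\<close>. For a second such point \<open>b\<close> with common subgradient \<open>y\<close>, both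
  \<open>g b - g a\<close> and \<open>h b - h a\<close> lie between \<open>x \<bullet> (b - a)\<close> and \<open>y \<bullet> (b - a)\<close>, so
  \<open>\<bar>d a - d b\<bar> \<le> (y - x) \<bullet> (b - a)\<close>. Choose \<open>w\<close> on the open segment from \<open>x\<close> to \<open>z\<close> such that some coordinate
  of \<open>p = a + w\<close> is rational. By monotonicity of the subdifferential, as in Minty's parametrisation, the
  right-hand side is bounded by a multiple of the squared distance of the points \<open>p\<close> belonging to
  \<open>a\<close> and \<open>b\<close> (\<open>minty_estimate\<close>). So the critical values form a countable union of images, under quadratically
  contracting maps, of subsets of hyperplanes parallel to the
  coordinate hyperplanes. Such an image has vanishing
  measure of dimension \<open>(n - 1) / 2\<close>: a covering by cubes shows that it is finite on bounded pieces, and where the subset is dense on a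
  small scale, points of a cube can be joined by many short steps, whose squares add up to very little
  (\<open>hausdorff_null_quadratic_bounded\<close>).

  \<^bold>\<open>Level sets.\<close> At a point which is not critical there is a unit vector \<open>v\<close> along which \<open>d\<close> decreases
  at a uniform rate, so the level set is locally the graph, over the hyperplane orthogonal to \<open>v\<close>, of a
  Lipschitz function \<open>\<phi>\<close> (\<open>level_set_graph\<close>). To see that \<open>\<phi>\<close> is DC, choose at each point of the graph subgradients
  \<open>G\<close> of \<open>g\<close> and \<open>H\<close> of \<open>h\<close> with \<open>G \<bullet> v + \<alpha> \<le> H \<bullet> v\<close>, and sort the points into finitely many cells
  on which \<open>G \<bullet> v\<close> and \<open>H \<bullet> v\<close> are nearly constant. On a cell, two combinations of \<open>h\<close> along the graph
  and \<open>\<phi>\<close> admit bounded subgradients and therefore extend to convex functions, and \<open>\<phi>\<close> is a multiple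
  of their difference (\<open>dc_extension_on_narrow_cell\<close>). So \<open>\<phi>\<close> is a continuous selection from
  finitely many DC functions, and such a selection is DC (\<open>dc_on_continuous_selection\<close>).

  If \<open>d\<close> is semiconcave, then at a point of a chord of the graph \<open>d\<close> falls below the level by at most a multiple
  of the squared length of the chord, and dividing by the rate of decrease bounds the
  height of the chord over the graph, which is semiconcavity of \<open>\<phi>\<close>. Likewise, if a point had two
  nearest points in a superlevel set, their midpoint, moved slightly against \<open>v\<close>, would be a point of the set that is nearer
  (\<open>reach_pos_superlevel\<close>).
\<close>

section \<open>Subgradients of convex functions\<close>

definition subdiff :: "'a::real_inner set \<Rightarrow> ('a \<Rightarrow> real) \<Rightarrow> 'a \<Rightarrow> 'a set" where
  "subdiff U g a = {x. \<forall>b\<in>U. g a + x \<bullet> (b - a) \<le> g b}"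

lemma subdiffD: "x \<in> subdiff U g a \<Longrightarrow> b \<in> U \<Longrightarrow> g a + x \<bullet> (b - a) \<le> g b"
  by (auto simp: subdiff_def)

lemma convex_subdiff: "convex (subdiff U g a)"
proof -
  have "subdiff U g a = (\<Inter>b\<in>U. {x. (b - a) \<bullet> x \<le> g b - g a})"
    by (auto simp: subdiff_def inner_commute algebra_simps)
  then show ?thesis
    by (simp add: convex_INT convex_halfspace_le)
qed

lemma closed_subdiff: "closed (subdiff U g a)"
proof -
  have "subdiff U g a = (\<Inter>b\<in>U. {x. (b - a) \<bullet> x \<le> g b - g a})"
    by (auto simp: subdiff_def inner_commute algebra_simps)
  then show ?thesis
    by (simp add: closed_INT closed_halfspace_le)
qed

text \<open>
  The point \<open>(a, g a)\<close> does not lie in the strict epigraph, so a hyperplane separates the two. The hyperplane is not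
  vertical because \<open>a\<close> is interior to \<open>U\<close>, and its slope is a subgradient.
\<close>
lemma subdiff_nonempty:
  fixes g :: "'a::euclidean_space \<Rightarrow> real"
  assumes "open U" "convex_on U g" "a \<in> U"
  shows "subdiff U g a \<noteq> {}"
proof -
  define T where "T = {(b, t). b \<in> U \<and> g b < t}"
  have "convex U" using assms(2) by (rule convex_on_imp_convex)
  have cT: "convex T"
    unfolding convex_def
  proof clarsimp
    fix x s y t and u v :: real
    assume *: "(x, s) \<in> T" "(y, t) \<in> T" "0 \<le> u" "0 \<le> v" "u + v = 1"
    then have "g (u *\<^sub>R x + v *\<^sub>R y) \<le> u * g x + v * g y"
      using assms(2) by (auto simp: convex_on_def T_def)
    also have "\<dots> < u * s + v * t"
    proof (cases "u = 0")
      case True then show ?thesis using * by (auto simp: T_def)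
    next
      case False
      then have "u * g x < u * s" "v * g y \<le> v * t" using * by (auto simp: T_def mult_left_mono)
      then show ?thesis by linarith
    qed
    finally show "(u *\<^sub>R x + v *\<^sub>R y, u * s + v * t) \<in> T"
      using * \<open>convex U\<close> by (auto simp: T_def convex_def)
  qed
  have "(a, g a + 1) \<in> T" using assms(3) by (auto simp: T_def)
  then have "\<exists>p c. p \<noteq> 0 \<and> (\<forall>x\<in>{(a, g a)}. p \<bullet> x \<le> c) \<and> (\<forall>x\<in>T. p \<bullet> x \<ge> c)"
    using \<open>(a, g a + 1) \<in> T\<close> by (intro separating_hyperplane_sets cT) (auto simp: T_def intro: gt_ex)
  then obtain P c where P: "P \<noteq> 0" "P \<bullet> (a, g a) \<le> c" "\<And>x. x \<in> T \<Longrightarrow> P \<bullet> x \<ge> c"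
    by blast
  obtain p q where pq: "P = (p, q)" by (cases P)
  have le: "p \<bullet> a + q * g a \<le> p \<bullet> b + q * t" if "b \<in> U" "g b < t" for b t
    using P(2) P(3)[of "(b, t)"] that by (auto simp: pq T_def inner_prod_def)
  have "q \<ge> 0" using le[of a "g a + 1"] assms(3) by (simp add: algebra_simps)
  moreover have "q \<noteq> 0"
  proof
    assume "q = 0"
    obtain e where e: "e > 0" "ball a e \<subseteq> U" using assms(1,3) openE by blast
    have "p \<noteq> 0" using P(1) \<open>q = 0\<close> pq by (auto simp: zero_prod_def)
    define b where "b = a - (e / 2 / norm p) *\<^sub>R p"
    have "norm ((e / 2 / norm p) *\<^sub>R p) = e / 2" using \<open>p \<noteq> 0\<close> e by simp
    then have "b \<in> U" using e by (auto simp: b_def dist_norm)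
    from le[OF this, of "g b + 1"] have "(e / 2 / norm p) * (p \<bullet> p) \<le> 0"
      using \<open>q = 0\<close> by (simp add: b_def inner_diff_right)
    moreover have "(e / 2 / norm p) * (p \<bullet> p) > 0" using \<open>p \<noteq> 0\<close> e by simp
    ultimately show False by linarith
  qed
  ultimately have q: "q > 0" by simp
  have "g a + ((-1/q) *\<^sub>R p) \<bullet> (b - a) \<le> g b" if "b \<in> U" for b
  proof (rule field_le_epsilon)
    fix e :: real assume "e > 0"
    from le[OF that, of "g b + e"] \<open>e > 0\<close>
    have "q * (g a + ((-1/q) *\<^sub>R p) \<bullet> (b - a)) \<le> q * (g b + e)"
      using q by (simp add: algebra_simps inner_diff_right)
    then show "g a + ((-1/q) *\<^sub>R p) \<bullet> (b - a) \<le> g b + e" using q by simp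
  qed
  then show ?thesis unfolding subdiff_def by blast
qed

lemma subdiff_locally_bounded:
  fixes g :: "'a::euclidean_space \<Rightarrow> real"
  assumes "open U" "convex_on U g" "a \<in> U"
  obtains \<rho> L where "\<rho> > 0" "L > 0" "ball a \<rho> \<subseteq> U"
    "\<And>z x. z \<in> ball a \<rho> \<Longrightarrow> x \<in> subdiff U g z \<Longrightarrow> norm x \<le> L"
proof -
  obtain e where e: "e > 0" "cball a e \<subseteq> U" using assms(1,3) open_contains_cball by blast
  have "compact (g ` cball a e)"
    using convex_on_continuous[OF assms(1,2)] e(2)
    by (intro compact_continuous_image) (auto intro: continuous_on_subset)
  then obtain M where M: "M > 0" "\<And>z. z \<in> cball a e \<Longrightarrow> \<bar>g z\<bar> \<le> M"
    using compact_imp_bounded bounded_pos by (metis imageI real_norm_def)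
  show thesis
  proof
    show "e / 2 > 0" "4 * M / e > 0" "ball a (e / 2) \<subseteq> U" using e M by auto
    fix z x assume z: "z \<in> ball a (e / 2)" and x: "x \<in> subdiff U g z"
    show "norm x \<le> 4 * M / e"
    proof (cases "x = 0")
      case False
      define b where "b = z + (e / 2 / norm x) *\<^sub>R x"
      have "norm (b - z) = e / 2" using False e by (simp add: b_def)
      then have b: "b \<in> cball a e" using z dist_triangle[of a b z]
        by (auto simp: dist_norm norm_minus_commute)
      have "g z + x \<bullet> (b - z) \<le> g b" using x b e by (intro subdiffD) auto
      moreover have "x \<bullet> (b - z) = e / 2 * norm x"
        using False by (simp add: b_def power2_norm_eq_inner[symmetric] power2_eq_square)
      moreover have "\<bar>g z\<bar> \<le> M" "\<bar>g b\<bar> \<le> M" using M(2) b z e(1) by auto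
      ultimately have "e / 2 * norm x \<le> 2 * M" by linarith
      then show ?thesis using e by (simp add: field_simps)
    qed (use e M in auto)
  qed
qed

lemma bounded_subdiff_imp_lipschitz:
  fixes g :: "'a::euclidean_space \<Rightarrow> real"
  assumes "\<And>z. z \<in> B \<Longrightarrow> subdiff U g z \<noteq> {}" "B \<subseteq> U"
    and "\<And>z x. z \<in> B \<Longrightarrow> x \<in> subdiff U g z \<Longrightarrow> norm x \<le> L"
    and "y \<in> B" "z \<in> B"
  shows "\<bar>g y - g z\<bar> \<le> L * norm (y - z)"
proof -
  have "g y - g z \<le> L * norm (y - z)" if yz: "y \<in> B" "z \<in> B" for y z
  proof -
    obtain x where x: "x \<in> subdiff U g y" using assms(1) yz by blast
    then have "g y + x \<bullet> (z - y) \<le> g z" using assms(2) yz by (blast intro: subdiffD)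
    moreover have "\<bar>x \<bullet> (z - y)\<bar> \<le> norm x * norm (z - y)" by (rule Cauchy_Schwarz_ineq2)
    moreover have "norm x * norm (z - y) \<le> L * norm (z - y)"
      using assms(3) x yz by (intro mult_right_mono) auto
    ultimately show ?thesis by (simp add: norm_minus_commute)
  qed
  from this[of y z] this[of z y] assms(4,5) show ?thesis by (simp add: norm_minus_commute)
qed

lemma subdiff_limit:
  fixes g :: "'a::euclidean_space \<Rightarrow> real"
  assumes "open U" "convex_on U g" "a \<in> U"
    and "z \<longlonglongrightarrow> a" "x \<longlonglongrightarrow> l" "\<And>n. x n \<in> subdiff U g (z n)"
  shows "l \<in> subdiff U g a"
proof -
  have "isCont g a"
    using convex_on_continuous[OF assms(1,2)] assms(1,3) continuous_on_eq_continuous_at by blast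
  then have gz: "(\<lambda>n. g (z n)) \<longlonglongrightarrow> g a" using assms(4) isCont_tendsto_compose by blast
  have "g a + l \<bullet> (b - a) \<le> g b" if "b \<in> U" for b
  proof (rule LIMSEQ_le_const2)
    show "(\<lambda>n. g (z n) + x n \<bullet> (b - z n)) \<longlonglongrightarrow> g a + l \<bullet> (b - a)"
      by (intro tendsto_intros gz assms)
    show "\<exists>N. \<forall>n\<ge>N. g (z n) + x n \<bullet> (b - z n) \<le> g b"
      using assms(6) that by (auto simp: subdiff_def)
  qed
  then show ?thesis by (auto simp: subdiff_def)
qed

text \<open>
  Upper semicontinuity of the subdifferential: otherwise bounded subgradients outside \<open>V\<close>, taken at points tending to \<open>a\<close>,
  would accumulate at a subgradient at \<open>a\<close> outside \<open>V\<close>.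
\<close>
lemma subdiff_usc:
  fixes g :: "'a::euclidean_space \<Rightarrow> real"
  assumes "open U" "convex_on U g" "a \<in> U" "open V" "subdiff U g a \<subseteq> V"
  obtains \<delta> where "\<delta> > 0" "ball a \<delta> \<subseteq> U" "\<And>z. z \<in> ball a \<delta> \<Longrightarrow> subdiff U g z \<subseteq> V"
proof -
  obtain \<rho> L where \<rho>: "\<rho> > 0" "L > 0" "ball a \<rho> \<subseteq> U"
    and L: "\<And>z x. z \<in> ball a \<rho> \<Longrightarrow> x \<in> subdiff U g z \<Longrightarrow> norm x \<le> L"
    using subdiff_locally_bounded[OF assms(1-3)] by blast
  have "\<exists>\<delta>>0. \<delta> \<le> \<rho> \<and> (\<forall>z\<in>ball a \<delta>. subdiff U g z \<subseteq> V)"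
  proof (rule ccontr)
    assume *: "\<not> ?thesis"
    have "\<exists>z x. z \<in> ball a (min \<rho> (inverse (real (Suc n)))) \<and> x \<in> subdiff U g z \<and> x \<notin> V" for n
    proof -
      have "0 < min \<rho> (inverse (real (Suc n)))" using \<rho> by simp
      with * show ?thesis by (meson min.cobounded1 subsetI)
    qed
    then obtain z x where zx: "\<And>n. z n \<in> ball a (min \<rho> (inverse (real (Suc n))))"
      "\<And>n. x n \<in> subdiff U g (z n)" "\<And>n. x n \<notin> V"
      by metis
    have "norm (z n - a) \<le> inverse (real (Suc n))" for n
      using zx(1)[of n] by (simp add: dist_norm norm_minus_commute)
    then have "(\<lambda>n. z n - a) \<longlonglongrightarrow> 0"
      by (intro Lim_null_comparison[OF _ LIMSEQ_inverse_real_of_nat]) auto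
    then have za: "z \<longlonglongrightarrow> a" by (simp add: LIM_zero_iff)
    have "\<forall>n. x n \<in> cball 0 L" using L zx by force
    then obtain l r where r: "strict_mono r" "(x \<circ> r) \<longlonglongrightarrow> l"
      using compact_cball[of "0::'a" L] unfolding compact_def by metis
    have "l \<in> subdiff U g a"
    proof (rule subdiff_limit[OF assms(1-3) _ r(2)])
      show "(z \<circ> r) \<longlonglongrightarrow> a" using za r(1) by (rule LIMSEQ_subseq_LIMSEQ)
    qed (simp add: zx(2))
    moreover have "l \<in> - V"
      by (rule closed_sequentially[OF _ _ r(2)]) (use assms(4) zx(3) in \<open>simp_all add: closed_Compl\<close>)
    ultimately show False using assms(5) by blast
  qed
  then obtain \<delta> where "\<delta> > 0" "\<delta> \<le> \<rho>" "\<forall>z\<in>ball a \<delta>. subdiff U g z \<subseteq> V" by blast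
  moreover have "ball a \<delta> \<subseteq> U" using subset_ball[OF \<open>\<delta> \<le> \<rho>\<close>] \<rho>(3) by blast
  ultimately show thesis using that by blast
qed

text \<open>
  Near \<open>a\<close> all subgradients are close to \<open>x\<close>, and the increment of \<open>g\<close> is squeezed between those given by
  the subgradient at \<open>a\<close> and a subgradient at the other point.
\<close>
lemma has_derivative_subdiff_singleton:
  fixes g :: "'a::euclidean_space \<Rightarrow> real"
  assumes "open U" "convex_on U g" "a \<in> U" "subdiff U g a = {x}"
  shows "(g has_derivative (\<lambda>v. x \<bullet> v)) (at a)"
  unfolding has_derivative_at_alt
proof (intro conjI allI impI)
  show "bounded_linear ((\<bullet>) x)" by (rule bounded_linear_inner_right)
  fix e :: real assume "e > 0"
  have "subdiff U g a \<subseteq> ball x e" using assms(4) \<open>e > 0\<close> by simp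
  then obtain \<delta> where \<delta>: "\<delta> > 0" "ball a \<delta> \<subseteq> U"
    "\<And>z. z \<in> ball a \<delta> \<Longrightarrow> subdiff U g z \<subseteq> ball x e"
    using subdiff_usc[OF assms(1-3) open_ball] by metis
  have "norm (g y - g a - x \<bullet> (y - a)) \<le> e * norm (y - a)" if "norm (y - a) < \<delta>" for y
  proof -
    have y: "y \<in> ball a \<delta>" using that by (simp add: dist_norm norm_minus_commute)
    then obtain w where w: "w \<in> subdiff U g y" using subdiff_nonempty[OF assms(1,2)] \<delta>(2) by blast
    have "g y + w \<bullet> (a - y) \<le> g a" using w assms(3) by (rule subdiffD)
    moreover have "g a + x \<bullet> (y - a) \<le> g y" using assms(4) y \<delta>(2) by (intro subdiffD) auto
    moreover have "w \<bullet> (y - a) - x \<bullet> (y - a) \<le> norm (w - x) * norm (y - a)"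
      using norm_cauchy_schwarz[of "w - x" "y - a"] by (simp add: inner_diff_left)
    moreover have "norm (w - x) * norm (y - a) \<le> e * norm (y - a)"
      using w \<delta>(3)[OF y] by (intro mult_right_mono) (auto simp: dist_norm norm_minus_commute)
    ultimately show ?thesis by (simp add: inner_diff_right)
  qed
  then show "\<exists>d>0. \<forall>y. norm (y - a) < d \<longrightarrow> norm (g y - g a - x \<bullet> (y - a)) \<le> e * norm (y - a)"
    using \<delta>(1) by blast
qed

section \<open>Critical points and descent directions\<close>

text \<open>
  This is negativity of the Clarke derivative \<open>clarke_deriv f a v\<close>, in the form in which it is used: the same
  rate \<open>\<alpha>\<close> serves for all base points near \<open>a\<close>.
\<close>
definition descent_direction :: "('a::real_normed_vector \<Rightarrow> real) \<Rightarrow> 'a \<Rightarrow> 'a \<Rightarrow> bool" where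
  "descent_direction f a v \<longleftrightarrow>
     (\<exists>\<alpha>>0. \<exists>\<delta>>0. \<forall>z\<in>ball a \<delta>. \<forall>t. 0 < t \<and> t < \<delta> \<longrightarrow> f (z + t *\<^sub>R v) \<le> f z - \<alpha> * t)"

lemma descent_directionI:
  assumes "\<alpha> > 0" "\<delta> > 0"
    and "\<And>z t. z \<in> ball a \<delta> \<Longrightarrow> 0 < t \<Longrightarrow> t < \<delta> \<Longrightarrow> f (z + t *\<^sub>R v) \<le> f z - \<alpha> * t"
  shows "descent_direction f a v"
  using assms unfolding descent_direction_def by blast

lemma clarke_deriv_neg_iff: "clarke_deriv f a v < 0 \<longleftrightarrow> descent_direction f a v"
proof
  assume "clarke_deriv f a v < 0"
  then obtain c where c: "clarke_deriv f a v < ereal c" "c < 0"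
    using ereal_dense2[of "clarke_deriv f a v" 0] by (auto simp: zero_ereal_def)
  then have "eventually (\<lambda>(z, t). (f (z + t *\<^sub>R v) - f z) / t < c) (nhds a \<times>\<^sub>F at_right 0)"
    unfolding clarke_deriv_def using Limsup_lessD by (fastforce elim: eventually_mono)
  then obtain P Q where PQ: "eventually P (nhds a)" "eventually Q (at_right 0)"
    "\<And>z t. P z \<Longrightarrow> Q t \<Longrightarrow> (f (z + t *\<^sub>R v) - f z) / t < c"
    unfolding eventually_prod_filter by auto
  obtain e where e: "e > 0" "\<And>z. dist z a < e \<Longrightarrow> P z"
    using PQ(1) unfolding eventually_nhds_metric by blast
  obtain b where b: "b > 0" "\<And>t. 0 < t \<Longrightarrow> t < b \<Longrightarrow> Q t"
    using PQ(2) unfolding eventually_at_right_field by auto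
  show "descent_direction f a v"
  proof (rule descent_directionI[of "- c" "min e b"])
    fix z t assume "z \<in> ball a (min e b)" "0 < t" "t < min e b"
    then have "(f (z + t *\<^sub>R v) - f z) / t < c" "t > 0"
      using e b PQ(3) by (auto simp: dist_commute)
    then show "f (z + t *\<^sub>R v) \<le> f z - - c * t" by (simp add: field_simps)
  qed (use c e b in auto)
next
  assume "descent_direction f a v"
  then obtain \<alpha> \<delta> where *: "\<alpha> > 0" "\<delta> > 0"
    "\<And>z t. z \<in> ball a \<delta> \<Longrightarrow> 0 < t \<Longrightarrow> t < \<delta> \<Longrightarrow> f (z + t *\<^sub>R v) \<le> f z - \<alpha> * t"
    unfolding descent_direction_def by blast
  have "eventually (\<lambda>(z, t). ereal ((f (z + t *\<^sub>R v) - f z) / t) \<le> ereal (- \<alpha>)) (nhds a \<times>\<^sub>F at_right 0)"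
    unfolding eventually_prod_filter
  proof (intro exI conjI)
    show "eventually (\<lambda>z. z \<in> ball a \<delta>) (nhds a)"
      using * by (intro eventually_nhds_in_open) auto
    show "eventually (\<lambda>t. t \<in> {0<..<\<delta>}) (at_right 0)"
      using * by (intro eventually_at_right_real) auto
    show "\<forall>x y. x \<in> ball a \<delta> \<longrightarrow> y \<in> {0<..<\<delta>} \<longrightarrow>
        (case (x, y) of (z, t) \<Rightarrow> ereal ((f (z + t *\<^sub>R v) - f z) / t) \<le> ereal (- \<alpha>))"
      using *(3) by (auto simp: field_simps)
  qed
  then have "clarke_deriv f a v \<le> ereal (- \<alpha>)"
    unfolding clarke_deriv_def by (intro Limsup_bounded) (auto elim: eventually_mono)
  also have "\<dots> < 0" using * by simp
  finally show "clarke_deriv f a v < 0" .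
qed

lemma Crit_iff: "a \<in> Crit G f \<longleftrightarrow> a \<in> G \<and> (\<forall>v. \<not> descent_direction f a v)"
  by (auto simp: Crit_def clarke_subdifferential_def clarke_deriv_neg_iff[symmetric] zero_ereal_def[symmetric] not_less)

lemma descent_direction_open:
  assumes "descent_direction f a v"
  shows "\<exists>e>0. \<forall>b\<in>ball a e. descent_direction f b v"
proof -
  obtain \<alpha> \<delta> where *: "\<alpha> > 0" "\<delta> > 0"
    "\<And>z t. z \<in> ball a \<delta> \<Longrightarrow> 0 < t \<Longrightarrow> t < \<delta> \<Longrightarrow> f (z + t *\<^sub>R v) \<le> f z - \<alpha> * t"
    using assms unfolding descent_direction_def by blast
  have "descent_direction f b v" if "b \<in> ball a (\<delta> / 2)" for b
  proof (rule descent_directionI[of \<alpha> "\<delta> / 2"])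
    fix z t assume zt: "z \<in> ball b (\<delta> / 2)" "0 < t" "t < \<delta> / 2"
    have "z \<in> ball a \<delta>" using that zt(1) dist_triangle[of a z b] by auto
    then show "f (z + t *\<^sub>R v) \<le> f z - \<alpha> * t" using * zt by auto
  qed (use * in auto)
  then show ?thesis using *(2) by (meson half_gt_zero)
qed

lemma closedin_Crit:
  assumes "open G"
  shows "closedin (top_of_set G) (Crit G f)"
proof -
  have "open (G - Crit G f)"
    unfolding open_contains_ball
  proof
    fix a assume "a \<in> G - Crit G f"
    then obtain v where "a \<in> G" "descent_direction f a v" by (auto simp: Crit_iff)
    then obtain e where "e > 0" "\<forall>b\<in>ball a e. descent_direction f b v"
      using descent_direction_open by blast
    moreover obtain e' where "e' > 0" "ball a e' \<subseteq> G" using \<open>a \<in> G\<close> assms openE by blast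
    ultimately show "\<exists>e>0. ball a e \<subseteq> G - Crit G f"
      by (intro exI[of _ "min e e'"]) (auto simp: Crit_iff, meson mem_ball)
  qed
  then have "openin (top_of_set G) (G - Crit G f)" using assms by (simp add: openin_open_eq)
  moreover have "Crit G f \<subseteq> G" by (auto simp: Crit_def)
  ultimately show ?thesis by (simp add: closedin_def)
qed

text \<open>
  If the subdifferentials were disjoint, a vector \<open>v\<close> would strictly separate them, and by upper semicontinuity still
  separate the subgradients at all nearby points. Bounding the increment of \<open>g\<close> by a subgradient at the end
  point, and that of \<open>h\<close> by one at the starting point, makes \<open>v\<close> a descent direction of \<open>d\<close>.
\<close>
lemma subdiff_Int_at_Crit:
  fixes d :: "'a::euclidean_space \<Rightarrow> real"
  assumes "open U" "convex_on U g" "convex_on U h" "\<And>x. x \<in> U \<Longrightarrow> d x = g x - h x"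
    and "a \<in> U" "\<And>v. \<not> descent_direction d a v"
  shows "subdiff U g a \<inter> subdiff U h a \<noteq> {}"
proof
  assume empty: "subdiff U g a \<inter> subdiff U h a = {}"
  obtain \<rho> L where \<rho>: "\<rho> > 0" "L > 0" "ball a \<rho> \<subseteq> U"
    and L: "\<And>z x. z \<in> ball a \<rho> \<Longrightarrow> x \<in> subdiff U g z \<Longrightarrow> norm x \<le> L"
    using subdiff_locally_bounded[OF assms(1,2,5)] by blast
  have "bounded (subdiff U g a)" using L[of a] \<rho>(1) by (auto simp: bounded_iff)
  then have comp: "compact (subdiff U g a)" using closed_subdiff compact_eq_bounded_closed by blast
  have ne: "subdiff U g a \<noteq> {}" using subdiff_nonempty assms by blast
  obtain v b where v: "\<forall>x\<in>subdiff U g a. v \<bullet> x < b" "\<forall>x\<in>subdiff U h a. v \<bullet> x > b"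
    using separating_hyperplane_compact_closed[OF convex_subdiff comp ne convex_subdiff closed_subdiff empty]
    by blast
  obtain s where s: "s \<in> subdiff U g a" "\<And>x. x \<in> subdiff U g a \<Longrightarrow> v \<bullet> x \<le> v \<bullet> s"
    using continuous_attains_sup[OF comp ne continuous_on_inner[OF continuous_on_const continuous_on_id]]
    by metis
  \<comment> \<open>Any value strictly between the maximum of \<open>v\<close> on the compact subdifferential of \<open>g\<close> and \<open>b\<close> leaves
    the gap \<open>b - m\<close> that becomes the rate of descent.\<close>
  define m where "m = (v \<bullet> s + b) / 2"
  have m: "v \<bullet> s < m" "m < b" using v s by (auto simp: m_def field_simps)
  have sg: "subdiff U g a \<subseteq> {x. v \<bullet> x < m}" using s(2) m(1) by force
  have sh: "subdiff U h a \<subseteq> {x. v \<bullet> x > b}" using v(2) by blast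
  obtain \<delta>1 where \<delta>1: "\<delta>1 > 0" "ball a \<delta>1 \<subseteq> U" "\<And>z. z \<in> ball a \<delta>1 \<Longrightarrow> subdiff U g z \<subseteq> {x. v \<bullet> x < m}"
    using subdiff_usc[OF assms(1,2,5) open_halfspace_lt[of v m] sg] by blast
  obtain \<delta>2 where \<delta>2: "\<delta>2 > 0" "ball a \<delta>2 \<subseteq> U" "\<And>z. z \<in> ball a \<delta>2 \<Longrightarrow> subdiff U h z \<subseteq> {x. v \<bullet> x > b}"
    using subdiff_usc[OF assms(1,3,5) open_halfspace_gt[of b v] sh] by blast
  define \<delta> where "\<delta> = min (min \<delta>1 \<delta>2) 1 / (2 * (norm v + 1))"
  have \<delta>: "\<delta> > 0" using \<delta>1 \<delta>2 by (auto simp: \<delta>_def intro!: divide_pos_pos add_nonneg_pos)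
  have \<delta>3: "\<delta> * (norm v + 1) = min (min \<delta>1 \<delta>2) 1 / 2"
    by (simp add: \<delta>_def field_simps add_nonneg_eq_0_iff)
  have "descent_direction d a v"
  proof (rule descent_directionI[of "b - m" \<delta>])
    fix z t assume zt: "z \<in> ball a \<delta>" "0 < t" "t < \<delta>"
    have "norm (a - z) + t * norm v \<le> \<delta> + \<delta> * norm v"
      using zt by (intro add_mono mult_right_mono) (auto simp: dist_norm)
    also have "\<dots> < min \<delta>1 \<delta>2" using \<delta>3 \<delta>1 \<delta>2 by (auto simp: algebra_simps)
    finally have lt: "norm (a - z) + t * norm v < min \<delta>1 \<delta>2" .
    have tv: "0 \<le> t * norm v" using zt by simp
    have z: "z \<in> ball a \<delta>1" "z \<in> ball a \<delta>2"
      using lt tv unfolding mem_ball dist_norm by linarith+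
    have "norm (a - (z + t *\<^sub>R v)) \<le> norm (a - z) + t * norm v"
      using norm_triangle_ineq4[of "a - z" "t *\<^sub>R v"] zt by (simp add: algebra_simps)
    then have y: "z + t *\<^sub>R v \<in> ball a \<delta>1" using lt unfolding mem_ball dist_norm by linarith
    obtain x where x: "x \<in> subdiff U g (z + t *\<^sub>R v)"
      using subdiff_nonempty[OF assms(1,2)] y \<delta>1(2) by blast
    obtain w where w: "w \<in> subdiff U h z" using subdiff_nonempty[OF assms(1,3)] z \<delta>1(2) by blast
    have "g (z + t *\<^sub>R v) + x \<bullet> (z - (z + t *\<^sub>R v)) \<le> g z"
      using x z \<delta>1 by (intro subdiffD) auto
    moreover have "h z + w \<bullet> ((z + t *\<^sub>R v) - z) \<le> h (z + t *\<^sub>R v)"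
      using w y \<delta>1 by (intro subdiffD) auto
    moreover have "t * (v \<bullet> x) \<le> t * m" "t * b \<le> t * (v \<bullet> w)"
      using x y \<delta>1(3) w z \<delta>2(3) zt by (auto intro!: mult_left_mono less_imp_le)
    moreover have "d z = g z - h z" "d (z + t *\<^sub>R v) = g (z + t *\<^sub>R v) - h (z + t *\<^sub>R v)"
      using z y \<delta>1(2) assms(4) by auto
    ultimately show "d (z + t *\<^sub>R v) \<le> d z - (b - m) * t"
      by (simp add: inner_commute algebra_simps)
  qed (use \<delta> m in auto)
  with assms(6) show False by blast
qed

lemma nonstationary_subdiff:
  fixes d :: "'a::euclidean_space \<Rightarrow> real"
  assumes "open U" "convex_on U g" "convex_on U h" "\<And>x. x \<in> U \<Longrightarrow> d x = g x - h x"
    and "a \<in> U" "\<not> stationary_point d a" "x \<in> subdiff U g a" "x \<in> subdiff U h a"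
  shows "subdiff U g a \<noteq> {x} \<or> subdiff U h a \<noteq> {x}"
proof (rule ccontr)
  assume "\<not> ?thesis"
  then have *: "subdiff U g a = {x}" "subdiff U h a = {x}" by simp_all
  have "(g has_derivative (\<lambda>v. x \<bullet> v)) (at a)" "(h has_derivative (\<lambda>v. x \<bullet> v)) (at a)"
    by (rule has_derivative_subdiff_singleton[OF assms(1,2,5) *(1)] has_derivative_subdiff_singleton[OF assms(1,3,5) *(2)])+
  then have "((\<lambda>x. g x - h x) has_derivative (\<lambda>v. x \<bullet> v - x \<bullet> v)) (at a)"
    by (rule has_derivative_diff)
  then have "(d has_derivative (\<lambda>v. 0)) (at a)"
    using assms(1,4,5) by (intro has_derivative_transform_within_open[of "\<lambda>x. g x - h x" _ a UNIV U d]) auto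
  with assms(6) show False by (simp add: stationary_point_def)
qed

section \<open>Null sets of Hausdorff measure\<close>
lemma hausdorff_measure_eq_0I:
  assumes "\<And>\<delta> \<epsilon>. \<delta> > 0 \<Longrightarrow> \<epsilon> > 0 \<Longrightarrow> \<exists>U::nat \<Rightarrow> 'a::metric_space set. A \<subseteq> (\<Union>i. U i) \<and>
     (\<forall>i. bounded (U i) \<and> diameter (U i) \<le> \<delta>) \<and> (\<Sum>i. diam_pow s (U i)) \<le> ennreal \<epsilon>"
  shows "hausdorff_measure s A = 0"
proof -
  have "hausdorff_premeasure s \<delta> A \<le> 0" if "\<delta> > 0" for \<delta>
  proof (rule ennreal_le_epsilon)
    fix e :: real assume "e > 0"
    from assms[OF that this] obtain U :: "nat \<Rightarrow> 'a set" where "A \<subseteq> (\<Union>i. U i)"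
     "\<forall>i. bounded (U i) \<and> diameter (U i) \<le> \<delta>" "(\<Sum>i. diam_pow s (U i)) \<le> ennreal e" by blast
    then have "hausdorff_premeasure s \<delta> A \<le> ennreal e"
      unfolding hausdorff_premeasure_def by (intro INF_lower2[of U]) auto
    then show "hausdorff_premeasure s \<delta> A \<le> 0 + ennreal e" by simp
  qed
  then show ?thesis by (auto simp: hausdorff_measure_def)
qed

lemma hausdorff_measure_eq_0D:
  assumes "hausdorff_measure s A = 0" "\<delta> > 0" "\<epsilon> > 0"
  shows "\<exists>U::nat \<Rightarrow> 'a::metric_space set. A \<subseteq> (\<Union>i. U i) \<and>
     (\<forall>i. bounded (U i) \<and> diameter (U i) \<le> \<delta>) \<and> (\<Sum>i. diam_pow s (U i)) \<le> ennreal \<epsilon>"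
proof -
  have "hausdorff_premeasure s \<delta> A \<le> hausdorff_measure s A"
    unfolding hausdorff_measure_def using assms by (intro SUP_upper) auto
  then have "hausdorff_premeasure s \<delta> A < ennreal \<epsilon>" using assms by simp
  then show ?thesis unfolding hausdorff_premeasure_def INF_less_iff by (auto intro: less_imp_le)
qed

lemma hausdorff_measure_UN_eq_0:
  fixes A :: "'i \<Rightarrow> 'a::metric_space set"
  assumes "countable I" "\<And>i. i \<in> I \<Longrightarrow> hausdorff_measure s (A i) = 0"
  shows "hausdorff_measure s (\<Union>i\<in>I. A i) = 0"
proof (rule hausdorff_measure_eq_0I)
  fix \<delta> \<epsilon> :: real assume *: "\<delta> > 0" "\<epsilon> > 0"
  show "\<exists>U. (\<Union>i\<in>I. A i) \<subseteq> (\<Union>i. U i) \<and>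
     (\<forall>i::nat. bounded (U i) \<and> diameter (U i) \<le> \<delta>) \<and> (\<Sum>i. diam_pow s (U i)) \<le> ennreal \<epsilon>"
  proof (cases "I = {}")
    case True
    then show ?thesis using * by (intro exI[of _ "\<lambda>_. {}"]) (auto simp: diam_pow_def diameter_def)
  next
    case False
    define e where "e = (\<lambda>n. \<epsilon> * (1/2) ^ Suc n)"
    have "\<exists>U. A (from_nat_into I n) \<subseteq> (\<Union>i. U i) \<and>
        (\<forall>i::nat. bounded (U i) \<and> diameter (U i) \<le> \<delta>) \<and> (\<Sum>i. diam_pow s (U i)) \<le> ennreal (e n)" for n
      using assms(2) from_nat_into[OF False] * by (intro hausdorff_measure_eq_0D) (auto simp: e_def)
    then obtain U where U: "\<And>n. A (from_nat_into I n) \<subseteq> (\<Union>i. U n i)"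
        "\<And>n i::nat. bounded (U n i) \<and> diameter (U n i) \<le> \<delta>" "\<And>n. (\<Sum>i. diam_pow s (U n i)) \<le> ennreal (e n)"
      by metis
    define V where "V = (\<lambda>(n, i). U n i) \<circ> prod_decode"
    have "(\<Sum>i. diam_pow s (V i)) = (\<Sum>n. \<Sum>i. diam_pow s (U n i))"
      unfolding V_def comp_def
      by (rule suminf_ennreal_2dimen[of _ "\<lambda>p. diam_pow s (case p of (n, i) \<Rightarrow> U n i)"]) simp
    also have "\<dots> \<le> (\<Sum>n. ennreal (e n))" by (intro suminf_le U(3)) auto
    also have "\<dots> = ennreal \<epsilon>"
    proof (rule suminf_ennreal_eq)
      show "e sums \<epsilon>" using sums_mult[OF power_half_series, of \<epsilon>] unfolding e_def mult_1_right .
    qed (use * in \<open>auto simp: e_def\<close>)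
    finally have "(\<Sum>i. diam_pow s (V i)) \<le> ennreal \<epsilon>" .
    moreover have "(\<Union>i\<in>I. A i) \<subseteq> (\<Union>i. V i)"
    proof
      fix x assume "x \<in> (\<Union>i\<in>I. A i)"
      then obtain n where "x \<in> A (from_nat_into I n)" by (metis UN_E assms(1) from_nat_into_to_nat_on)
      then obtain i where "x \<in> U n i" using U(1) by blast
      then have "x \<in> V (prod_encode (n, i))" by (simp add: V_def)
      then show "x \<in> (\<Union>i. V i)" by blast
    qed
    moreover have "bounded (V i) \<and> diameter (V i) \<le> \<delta>" for i
      using U(2) by (auto simp: V_def split: prod.split)
    ultimately show ?thesis by blast
  qed
qed

lemma hausdorff_measure_mono_0:
  assumes "hausdorff_measure s B = 0" "A \<subseteq> B"
  shows "hausdorff_measure s (A :: 'a::metric_space set) = 0"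
proof (rule hausdorff_measure_eq_0I)
  fix \<delta> \<epsilon> :: real assume "\<delta> > 0" "\<epsilon> > 0"
  from hausdorff_measure_eq_0D[OF assms(1) this] obtain U :: "nat \<Rightarrow> 'a set" where
    "B \<subseteq> (\<Union>i. U i)" "\<forall>i. bounded (U i) \<and> diameter (U i) \<le> \<delta>" "(\<Sum>i. diam_pow s (U i)) \<le> ennreal \<epsilon>"
    by blast
  then show "\<exists>U. A \<subseteq> (\<Union>i. U i) \<and>
     (\<forall>i::nat. bounded (U i) \<and> diameter (U i) \<le> \<delta>) \<and> (\<Sum>i. diam_pow s (U i)) \<le> ennreal \<epsilon>"
    using order_trans[OF assms(2)] by blast
qed

text \<open>
  The restriction on the mesh takes care of itself: for \<open>s > 0\<close> a small sum of the powers \<open>D i powr s\<close> forces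
  every single \<open>D i\<close> to be small.
\<close>
lemma hausdorff_measure_eq_0_finite_coverI:
  fixes A :: "real set"
  assumes "s > 0"
    and "\<And>\<epsilon>. \<epsilon> > 0 \<Longrightarrow> \<exists>I V D. finite (I::'i set) \<and> A \<subseteq> (\<Union>i\<in>I. V i) \<and>
      (\<forall>i\<in>I. 0 \<le> D i \<and> (\<forall>x\<in>V i. \<forall>y\<in>V i. \<bar>x - y\<bar> \<le> D i)) \<and> (\<Sum>i\<in>I. D i powr s) \<le> \<epsilon>"
  shows "hausdorff_measure s A = 0"
proof (rule hausdorff_measure_eq_0I)
  fix \<delta> \<epsilon> :: real assume *: "\<delta> > 0" "\<epsilon> > 0"
  have "min \<epsilon> (\<delta> powr s) > 0" using * by simp
  from assms(2)[OF this] obtain I :: "'i set" and V D where IVD: "finite I \<and> A \<subseteq> (\<Union>i\<in>I. V i) \<and>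
      (\<forall>i\<in>I. 0 \<le> D i \<and> (\<forall>x\<in>V i. \<forall>y\<in>V i. \<bar>x - y\<bar> \<le> D i)) \<and> (\<Sum>i\<in>I. D i powr s) \<le> min \<epsilon> (\<delta> powr s)"
    by blast
  then have I: "finite I" "A \<subseteq> (\<Union>i\<in>I. V i)"
    and D: "\<And>i. i \<in> I \<Longrightarrow> 0 \<le> D i" "\<And>i x y. i \<in> I \<Longrightarrow> x \<in> V i \<Longrightarrow> y \<in> V i \<Longrightarrow> \<bar>x - y\<bar> \<le> D i"
    and sum: "(\<Sum>i\<in>I. D i powr s) \<le> min \<epsilon> (\<delta> powr s)"
    by blast+
  obtain f where f: "bij_betw f {..<card I} I"
    using ex_bij_betw_nat_finite[OF I(1)] by (auto simp: atLeast0LessThan)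
  define U where "U n = (if n < card I then V (f n) else {})" for n
  have fI: "f n \<in> I" if "n < card I" for n using f that by (auto simp: bij_betw_def)
  have Dle: "D i \<le> \<delta>" if "i \<in> I" for i
  proof (rule ccontr)
    assume "\<not> D i \<le> \<delta>"
    then have "\<delta> powr s < D i powr s" using * assms(1) by (intro powr_less_mono2) auto
    also have "\<dots> \<le> (\<Sum>i\<in>I. D i powr s)" using that I(1) by (intro member_le_sum) auto
    finally show False using sum by simp
  qed
  have bdd: "bounded (V i)" if "i \<in> I" for i
    unfolding bounded_two_points using D(2)[OF that] by (auto simp: dist_real_def)
  have diam: "diameter (V i) \<le> D i" if "i \<in> I" for i
    using D[OF that] by (intro diameter_le) auto
  have diam0: "0 \<le> diameter (V i)" if "i \<in> I" for i
    using bdd[OF that] by (rule diameter_ge_0)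
  have "(\<Sum>n. diam_pow s (U n)) = (\<Sum>n<card I. diam_pow s (U n))"
    by (intro suminf_finite) (auto simp: U_def diam_pow_def)
  also have "\<dots> \<le> (\<Sum>n<card I. ennreal (D (f n) powr s))"
  proof (rule sum_mono)
    fix n assume "n \<in> {..<card I}"
    then show "diam_pow s (U n) \<le> ennreal (D (f n) powr s)"
      using diam[OF fI] diam0[OF fI] assms(1) by (auto simp: U_def diam_pow_def intro!: ennreal_leI powr_mono2)
  qed
  also have "\<dots> = ennreal (\<Sum>n<card I. D (f n) powr s)" by (intro sum_ennreal) auto
  also have "(\<Sum>n<card I. D (f n) powr s) = (\<Sum>i\<in>I. D i powr s)"
    by (rule sum.reindex_bij_betw[OF f])
  also have "ennreal \<dots> \<le> ennreal \<epsilon>" using sum by (intro ennreal_leI) auto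
  finally have "(\<Sum>n. diam_pow s (U n)) \<le> ennreal \<epsilon>" .
  moreover have "A \<subseteq> (\<Union>i. U i)"
  proof
    fix x assume "x \<in> A"
    then obtain i where "i \<in> I" "x \<in> V i" using I by auto
    then obtain n where "n < card I" "f n = i" using bij_betw_imp_surj_on[OF f] by (metis imageE lessThan_iff)
    with \<open>x \<in> V i\<close> show "x \<in> (\<Union>i. U i)" by (auto simp: U_def)
  qed
  moreover have "bounded (U i) \<and> diameter (U i) \<le> \<delta>" for i
  proof (cases "i < card I")
    case True
    then show ?thesis using bdd[OF fI] order_trans[OF diam[OF fI] Dle[OF fI]] by (simp add: U_def)
  next
    case False
    then show ?thesis using * by (simp add: U_def diameter_def)
  qed
  ultimately show "\<exists>U. A \<subseteq> (\<Union>i. U i) \<and>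
     (\<forall>i::nat. bounded (U i) \<and> diameter (U i) \<le> \<delta>) \<and> (\<Sum>i. diam_pow s (U i)) \<le> ennreal \<epsilon>"
    by blast
qed

section \<open>Images under quadratically contracting maps\<close>

text \<open>
  The cells of side length \<open>1 / b ^ m\<close> are represented by their integer coordinates, so that the cell of the next
  coarser level is found by integer division by \<open>b\<close>.
\<close>
definition cell :: "nat \<Rightarrow> nat \<Rightarrow> real ^ 'n \<Rightarrow> 'n \<Rightarrow> int" where
  "cell b m x = (\<lambda>i. \<lfloor>real b ^ m * x $ i\<rfloor>)"

text \<open>
  Since only points of the hyperplane \<open>x $ i0 = const\<close> occur, the coordinate with index \<open>i0\<close> is prescribed. This is
  why at most \<open>b ^ (n - 1)\<close> subcells, not \<open>b ^ n\<close>, are counted.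
\<close>
definition subcells :: "nat \<Rightarrow> 'n \<Rightarrow> int \<Rightarrow> ('n \<Rightarrow> int) \<Rightarrow> ('n \<Rightarrow> int) set" where
  "subcells b i0 q c = {c'. (\<forall>i. c' i div int b = c i) \<and> c' i0 = q}"

lemma cell_Suc_div: "b > 0 \<Longrightarrow> cell b (Suc m) x i div int b = cell b m x i"
  using floor_divide_real_eq_div[of "int b" "real b ^ Suc m * x $ i"]
  by (simp add: cell_def)

lemma subcells_subset:
  assumes "b > 0"
  shows "subcells b i0 q c \<subseteq> (\<Pi>\<^sub>E i\<in>UNIV. if i = i0 then {q} else {int b * c i ..< int b * c i + int b})"
proof
  fix c' assume c': "c' \<in> subcells b i0 q c"
  have "c' i \<in> {int b * c i ..< int b * c i + int b}" for i
  proof -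
    have "c' i = int b * c i + c' i mod int b"
      using c' by (metis (mono_tags, lifting) mem_Collect_eq mult_div_mod_eq subcells_def)
    moreover have "0 \<le> c' i mod int b" "c' i mod int b < int b" using assms by auto
    ultimately show ?thesis unfolding atLeastLessThan_iff by linarith
  qed
  then show "c' \<in> (\<Pi>\<^sub>E i\<in>UNIV. if i = i0 then {q} else {int b * c i ..< int b * c i + int b})"
    using c' by (auto simp: subcells_def)
qed

lemma subcells_finite_card:
  fixes c :: "'n::finite \<Rightarrow> int"
  assumes "b > 0"
  shows "finite (subcells b i0 q c)" "card (subcells b i0 q c) \<le> b ^ (CARD('n) - 1)"
proof -
  let ?P = "\<Pi>\<^sub>E i\<in>UNIV. if i = i0 then {q} else {int b * c i ..< int b * c i + int b}"
  have fin: "finite ?P" by (rule finite_PiE) simp_all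
  show "finite (subcells b i0 q c)" by (rule finite_subset[OF subcells_subset[OF assms] fin])
  have "card (subcells b i0 q c) \<le> card ?P" using fin subcells_subset[OF assms] by (rule card_mono)
  also have "\<dots> = (\<Prod>i\<in>UNIV. if i = i0 then 1 else b)" by (auto simp: card_PiE intro!: prod.cong)
  also have "\<dots> = b ^ (CARD('n) - 1)"
  proof -
    have "(\<Prod>i\<in>UNIV. if i = i0 then 1 else b) = (\<Prod>i\<in>UNIV - {i0}. if i = i0 then 1 else b)"
      by (rule prod.mono_neutral_right) auto
    also have "\<dots> = (\<Prod>i\<in>UNIV - {i0}. b)" by (intro prod.cong) auto
    finally show ?thesis by simp
  qed
  finally show "card (subcells b i0 q c) \<le> b ^ (CARD('n) - 1)" .
qed

lemma finite_cells:
  assumes "bounded P"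
  shows "finite (cell b m ` (P :: (real ^ 'n) set))"
proof -
  obtain K where K: "\<And>x. x \<in> P \<Longrightarrow> norm x \<le> K" using assms by (auto simp: bounded_iff)
  have "cell b m ` P \<subseteq> (\<Pi>\<^sub>E i\<in>UNIV. {\<lfloor>- (real b ^ m * K)\<rfloor>..\<lfloor>real b ^ m * K\<rfloor>})"
  proof
    fix c assume "c \<in> cell b m ` P"
    then obtain x where "x \<in> P" and c: "c = cell b m x" by blast
    have "\<lfloor>- (real b ^ m * K)\<rfloor> \<le> c i \<and> c i \<le> \<lfloor>real b ^ m * K\<rfloor>" for i
    proof -
      have "\<bar>x $ i\<bar> \<le> K" using K[OF \<open>x \<in> P\<close>] component_le_norm_cart[of x i] by linarith
      then have "\<bar>real b ^ m * x $ i\<bar> \<le> real b ^ m * K" by (simp add: abs_mult mult_left_mono)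
      then have "- (real b ^ m * K) \<le> real b ^ m * x $ i" "real b ^ m * x $ i \<le> real b ^ m * K"
        unfolding abs_le_iff by linarith+
      then show ?thesis
        unfolding c cell_def by (intro conjI floor_mono) simp_all
    qed
    then show "c \<in> (\<Pi>\<^sub>E i\<in>UNIV. {\<lfloor>- (real b ^ m * K)\<rfloor>..\<lfloor>real b ^ m * K\<rfloor>})"
      by (intro PiE_I) auto
  qed
  then show ?thesis by (rule finite_subset) (auto intro!: finite_PiE)
qed

lemma norm_le_card_mult:
  fixes x y :: "real ^ 'n"
  assumes "\<And>i. \<bar>x $ i - y $ i\<bar> \<le> e"
  shows "norm (x - y) \<le> real CARD('n) * e"
proof -
  have "norm (x - y) \<le> (\<Sum>i\<in>UNIV. \<bar>(x - y) $ i\<bar>)" by (rule norm_le_l1_cart)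
  also have "\<dots> \<le> (\<Sum>i\<in>(UNIV::'n set). e)" using assms by (intro sum_mono) auto
  finally show ?thesis by simp
qed

lemma cell_eq_component_le:
  assumes "b > 0" "cell b m x = cell b m y"
  shows "\<bar>x $ i - y $ i\<bar> \<le> 1 / real b ^ m"
proof -
  have "\<lfloor>real b ^ m * x $ i\<rfloor> = \<lfloor>real b ^ m * y $ i\<rfloor>"
    using assms(2) by (auto simp: cell_def fun_eq_iff)
  then have "\<bar>real b ^ m * x $ i - real b ^ m * y $ i\<bar> \<le> 1" by linarith
  then have "real b ^ m * \<bar>x $ i - y $ i\<bar> \<le> 1"
    by (simp add: right_diff_distrib[symmetric] abs_mult)
  then show ?thesis using assms(1) by (simp add: field_simps)
qed

lemma cell_segment:
  assumes "cell b m x = c" "cell b m y = c" "0 \<le> t" "t \<le> 1"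
  shows "cell b m (x + t *\<^sub>R (y - x)) = c"
proof
  fix i
  let ?X = "real b ^ m * x $ i" and ?Y = "real b ^ m * y $ i"
  have "\<lfloor>?X\<rfloor> = c i" "\<lfloor>?Y\<rfloor> = c i" using fun_cong[OF assms(1), of i] fun_cong[OF assms(2), of i] by (simp_all add: cell_def)
  then have "of_int (c i) \<le> ?X" "of_int (c i) \<le> ?Y" "?X < of_int (c i) + 1" "?Y < of_int (c i) + 1"
    by linarith+
  then have "of_int (c i) \<le> (1 - t) * ?X + t * ?Y" "(1 - t) * ?X + t * ?Y < of_int (c i) + 1"
    using assms(3,4) convex_bound_lt[of ?X "of_int (c i) + 1" ?Y "1 - t" t]
      convex_bound_le[of "- ?X" "- of_int (c i)" "- ?Y" "1 - t" t] by auto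
  then have "\<lfloor>(1 - t) * ?X + t * ?Y\<rfloor> = c i" by linarith
  then show "cell b m (x + t *\<^sub>R (y - x)) i = c i" by (simp add: cell_def algebra_simps)
qed

text \<open>
  Divide the segment between the two points into \<open>b\<close> equal parts. Every division point lies in a subcell that is
  met, so it can be replaced by a nearby point of the set. This gives \<open>b\<close> steps of
  length comparable to \<open>1 / (b * b ^ m)\<close>, hence a bound \<open>b * (1 / (b * b ^ m))\<^sup>2\<close>, which gains the
  factor \<open>1 / b\<close> over the trivial bound \<open>(1 / b ^ m)\<^sup>2\<close>.
\<close>
lemma full_cell_oscillation:
  fixes \<pi> :: "'a \<Rightarrow> real ^ 'n"
  assumes b: "b > 0" and C: "C \<ge> 0"
    and quad: "\<And>x y. x \<in> E \<Longrightarrow> y \<in> E \<Longrightarrow> \<bar>f x - f y\<bar> \<le> C * (norm (\<pi> x - \<pi> y))\<^sup>2"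
    and slice: "\<And>x. x \<in> E \<Longrightarrow> \<pi> x $ i0 = q"
    and full: "subcells b i0 \<lfloor>real b ^ Suc m * q\<rfloor> c \<subseteq> cell b (Suc m) ` \<pi> ` E"
    and xy: "x \<in> E" "y \<in> E" "cell b m (\<pi> x) = c" "cell b m (\<pi> y) = c"
  shows "\<bar>f x - f y\<bar> \<le> 9 * C * (real CARD('n))\<^sup>2 * (1 / real b) * (1 / real b ^ m)\<^sup>2"
proof -
  define p where "p j = \<pi> x + (real j / real b) *\<^sub>R (\<pi> y - \<pi> x)" for j
  have p0: "p 0 = \<pi> x" and pb: "p b = \<pi> y" using b by (auto simp: p_def)
  have "\<exists>a\<in>E. cell b (Suc m) (\<pi> a) = cell b (Suc m) (p j)" if "j \<le> b" for j
  proof -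
    have "cell b m (p j) = c"
      unfolding p_def using that b xy by (intro cell_segment) auto
    moreover have "p j $ i0 = q" using slice xy by (simp add: p_def)
    ultimately have "cell b (Suc m) (p j) \<in> subcells b i0 \<lfloor>real b ^ Suc m * q\<rfloor> c"
      using cell_Suc_div[OF b] by (auto simp: subcells_def) (simp add: cell_def)
    with full show ?thesis by force
  qed
  then obtain a0 where a0: "\<And>j. j \<le> b \<Longrightarrow> a0 j \<in> E \<and> cell b (Suc m) (\<pi> (a0 j)) = cell b (Suc m) (p j)"
    by metis
  define a where "a j = (if j = 0 then x else if j = b then y else a0 j)" for j
  have a: "a j \<in> E" "cell b (Suc m) (\<pi> (a j)) = cell b (Suc m) (p j)" if "j \<le> b" for j
    using a0[OF that] xy p0 pb by (auto simp: a_def)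
  have step: "\<bar>f (a (Suc j)) - f (a j)\<bar> \<le> 9 * C * (real CARD('n))\<^sup>2 * (1 / real b)\<^sup>2 * (1 / real b ^ m)\<^sup>2"
    if "j < b" for j
  proof -
    have "\<bar>\<pi> (a (Suc j)) $ i - \<pi> (a j) $ i\<bar> \<le> 3 / real b ^ Suc m" for i
    proof -
      have "\<bar>\<pi> (a (Suc j)) $ i - p (Suc j) $ i\<bar> \<le> 1 / real b ^ Suc m"
        using a that by (intro cell_eq_component_le b) auto
      moreover have "\<bar>\<pi> (a j) $ i - p j $ i\<bar> \<le> 1 / real b ^ Suc m"
        using a that by (intro cell_eq_component_le b) auto
      moreover have "\<bar>p (Suc j) $ i - p j $ i\<bar> \<le> 1 / real b ^ Suc m"
      proof -
        have "p (Suc j) $ i - p j $ i = (1 / real b) * (\<pi> y $ i - \<pi> x $ i)"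
          by (simp add: p_def add_divide_distrib algebra_simps)
        then have "\<bar>p (Suc j) $ i - p j $ i\<bar> = (1 / real b) * \<bar>\<pi> y $ i - \<pi> x $ i\<bar>"
          by (simp add: abs_mult)
        also have "\<dots> \<le> (1 / real b) * (1 / real b ^ m)"
          using xy by (intro mult_left_mono cell_eq_component_le b) auto
        finally show ?thesis by simp
      qed
      ultimately show ?thesis by (simp add: field_simps)
    qed
    then have "norm (\<pi> (a (Suc j)) - \<pi> (a j)) \<le> real CARD('n) * (3 / real b ^ Suc m)"
      by (rule norm_le_card_mult)
    then have "(norm (\<pi> (a (Suc j)) - \<pi> (a j)))\<^sup>2 \<le> (real CARD('n) * (3 / real b ^ Suc m))\<^sup>2"
      by (intro power_mono) auto
    then have "C * (norm (\<pi> (a (Suc j)) - \<pi> (a j)))\<^sup>2 \<le> C * (real CARD('n) * (3 / real b ^ Suc m))\<^sup>2"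
      using C by (rule mult_left_mono)
    also have "\<dots> = 9 * C * (real CARD('n))\<^sup>2 * (1 / real b)\<^sup>2 * (1 / real b ^ m)\<^sup>2"
      by (simp add: power_mult_distrib power_divide field_simps power2_eq_square)
    finally show ?thesis using quad[of "a (Suc j)" "a j"] a that by force
  qed
  have "\<bar>f y - f x\<bar> = \<bar>\<Sum>j<b. f (a (Suc j)) - f (a j)\<bar>"
    using sum_lessThan_telescope[of "\<lambda>j. f (a j)" b] b by (simp add: a_def)
  also have "\<dots> \<le> (\<Sum>j<b. \<bar>f (a (Suc j)) - f (a j)\<bar>)" by (rule sum_abs)
  also have "\<dots> \<le> (\<Sum>j<b. 9 * C * (real CARD('n))\<^sup>2 * (1 / real b)\<^sup>2 * (1 / real b ^ m)\<^sup>2)"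
    using step by (intro sum_mono) auto
  also have "\<dots> = 9 * C * (real CARD('n))\<^sup>2 * (1 / real b) * (1 / real b ^ m)\<^sup>2"
    using b by (simp add: power2_eq_square field_simps)
  finally show ?thesis by (simp add: abs_minus_commute)
qed

text \<open>
  A cell is deficient if one of its subcells is not met. Relative to the maximal possible number of cells, the number of cells that are met
  decreases from level to level, by at least a fixed multiple of the proportion of deficient cells.
  Since this decreasing sequence converges, that proportion tends to \<open>0\<close>. This replaces the
  density theorem for Lebesgue measure.
\<close>
lemma deficient_cells_negligible:
  fixes P :: "(real ^ 'n) set"
  assumes b: "b > 0" and P: "bounded P" and slice: "\<And>x. x \<in> P \<Longrightarrow> x $ i0 = q"
  defines "K \<equiv> real (b ^ (CARD('n) - 1))"
  defines "N \<equiv> \<lambda>m. cell b m ` P"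
  defines "F \<equiv> \<lambda>m. {c \<in> N m. \<not> subcells b i0 \<lfloor>real b ^ Suc m * q\<rfloor> c \<subseteq> N (Suc m)}"
  shows "real (card (N m)) \<le> real (card (N 0)) * K ^ m"
    and "(\<lambda>m. real (card (F m)) / K ^ m) \<longlonglongrightarrow> 0"
proof -
  have K: "K > 0" using b by (simp add: K_def)
  have finN: "finite (N m)" for m unfolding N_def by (intro finite_cells P)
  have finF: "finite (F m)" for m using finN by (simp add: F_def)
  have rec: "real (card (N (Suc m))) \<le> K * real (card (N m)) - real (card (F m))" for m
  proof -
    define S where "S c = subcells b i0 \<lfloor>real b ^ Suc m * q\<rfloor> c" for c :: "'n \<Rightarrow> int"
    have S: "finite (S c)" "real (card (S c)) \<le> K" for c
      using subcells_finite_card[OF b, of i0 _ c] unfolding S_def K_def of_nat_le_iff by blast+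
    have "N (Suc m) \<subseteq> (\<Union>c\<in>N m. N (Suc m) \<inter> S c)"
    proof
      fix c' assume c': "c' \<in> N (Suc m)"
      then obtain x where x: "x \<in> P" "c' = cell b (Suc m) x" by (auto simp: N_def)
      then have "c' \<in> S (cell b m x)"
        using slice cell_Suc_div[OF b] by (auto simp: S_def subcells_def) (simp add: cell_def)
      then show "c' \<in> (\<Union>c\<in>N m. N (Suc m) \<inter> S c)" using c' x by (auto simp: N_def)
    qed
    then have "card (N (Suc m)) \<le> card (\<Union>c\<in>N m. N (Suc m) \<inter> S c)"
      using finN S by (intro card_mono) auto
    also have "\<dots> \<le> (\<Sum>c\<in>N m. card (N (Suc m) \<inter> S c))" by (rule card_UN_le[OF finN])
    finally have "real (card (N (Suc m))) \<le> (\<Sum>c\<in>N m. real (card (N (Suc m) \<inter> S c)))"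
      by (metis of_nat_le_iff of_nat_sum)
    also have "\<dots> \<le> (\<Sum>c\<in>N m. K - (if c \<in> F m then 1 else 0))"
    proof (rule sum_mono)
      fix c assume "c \<in> N m"
      show "real (card (N (Suc m) \<inter> S c)) \<le> K - (if c \<in> F m then 1 else 0)"
      proof (cases "c \<in> F m")
        case True
        then have "N (Suc m) \<inter> S c \<subset> S c" by (auto simp: F_def S_def)
        then have "card (N (Suc m) \<inter> S c) < card (S c)" using S(1) by (rule psubset_card_mono[rotated])
        then have "real (card (N (Suc m) \<inter> S c)) + 1 \<le> real (card (S c))" by linarith
        then show ?thesis using S(2)[of c] True by simp
      next
        case False
        have "card (N (Suc m) \<inter> S c) \<le> card (S c)" using S(1) by (intro card_mono) auto
        then show ?thesis using S(2)[of c] False by simp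
      qed
    qed
    also have "\<dots> = K * real (card (N m)) - real (card (N m \<inter> F m))"
      using finN by (simp add: sum_subtractf sum.If_cases)
    also have "N m \<inter> F m = F m" by (auto simp: F_def)
    finally show ?thesis .
  qed
  show "real (card (N m)) \<le> real (card (N 0)) * K ^ m"
  proof (induction m)
    case (Suc m)
    have "real (card (N (Suc m))) \<le> K * real (card (N m))" using rec[of m] by simp
    also have "\<dots> \<le> K * (real (card (N 0)) * K ^ m)" using Suc K by (intro mult_left_mono) auto
    finally show ?case by (simp add: algebra_simps)
  qed simp
  define r where "r m = real (card (N m)) / K ^ m" for m
  have F_le: "real (card (F m)) / K ^ m \<le> K * (r m - r (Suc m))" for m
  proof -
    have "K * (r m - r (Suc m)) = (K * real (card (N m)) - real (card (N (Suc m)))) / K ^ m"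
      using K by (simp add: r_def field_simps)
    moreover have "real (card (F m)) / K ^ m \<le> (K * real (card (N m)) - real (card (N (Suc m)))) / K ^ m"
      using rec[of m] K by (intro divide_right_mono) auto
    ultimately show ?thesis by simp
  qed
  have "decseq r"
  proof (rule decseq_SucI)
    fix m
    have "0 \<le> K * (r m - r (Suc m))" using F_le[of m] K by (meson divide_nonneg_nonneg of_nat_0_le_iff order_trans zero_le_power less_imp_le)
    then show "r (Suc m) \<le> r m" using K by (simp add: zero_le_mult_iff)
  qed
  moreover have "\<And>m. 0 \<le> r m" using K by (simp add: r_def)
  ultimately obtain l where l: "r \<longlonglongrightarrow> l" using decseq_convergent by metis
  then have "(\<lambda>m. K * (r m - r (Suc m))) \<longlonglongrightarrow> K * (l - l)"
    by (intro tendsto_intros LIMSEQ_Suc)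
  then have lim: "(\<lambda>m. K * (r m - r (Suc m))) \<longlonglongrightarrow> 0" by simp
  show "(\<lambda>m. real (card (F m)) / K ^ m) \<longlonglongrightarrow> 0"
    by (rule tendsto_sandwich[OF _ _ tendsto_const lim]) (use K F_le in simp_all)
qed

lemma square_powr_half:
  assumes "x > 0"
  shows "(x\<^sup>2) powr (real k / 2) = x ^ k"
proof -
  have "(x\<^sup>2) powr (real k / 2) = (x powr 2) powr (real k / 2)" using assms by simp
  also have "\<dots> = x powr real k" unfolding powr_powr by simp
  finally show ?thesis using assms by (simp add: powr_realpow)
qed

text \<open>
  The images of the cells of a fixed level \<open>m\<close> cover. The cells which are not deficient contribute at most a constant times
  \<open>(1 / b) powr s\<close>, by the gain in \<open>full_cell_oscillation\<close>, for every \<open>m\<close>. So \<open>b\<close> is chosen first, and then \<open>m\<close> so large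
  that the deficient cells, for which only the trivial bound is available, are too few to matter.
\<close>
lemma hausdorff_null_quadratic_bounded:
  fixes \<pi> :: "'a \<Rightarrow> real ^ 'n" and f :: "'a \<Rightarrow> real"
  assumes n: "CARD('n) \<ge> 2" and bdd: "bounded (\<pi> ` E)"
    and quad: "\<And>x y. x \<in> E \<Longrightarrow> y \<in> E \<Longrightarrow> \<bar>f x - f y\<bar> \<le> C * (norm (\<pi> x - \<pi> y))\<^sup>2"
    and slice: "\<And>x. x \<in> E \<Longrightarrow> \<pi> x $ i0 = q"
    and C: "C > 0"
  shows "hausdorff_measure ((real CARD('n) - 1) / 2) (f ` E) = 0"
proof -
  define s where "s = (real CARD('n) - 1) / 2"
  have s: "s > 0" using n by (simp add: s_def)
  define B where "B = 9 * C * (real CARD('n))\<^sup>2"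
  have B: "B > 0" using C by (simp add: B_def)
  have pow: "(1 / real b ^ m)\<^sup>2 powr s = 1 / real (b ^ (CARD('n) - 1)) ^ m" if "b > 0" for b m
    using square_powr_half[of "1 / real b ^ m" "CARD('n) - 1"] that n
    by (simp add: s_def of_nat_diff power_one_over power_mult[symmetric] mult.commute)
  have "hausdorff_measure s (f ` E) = 0"
  proof (rule hausdorff_measure_eq_0_finite_coverI[OF s])
    fix \<epsilon> :: real assume \<epsilon>: "\<epsilon> > 0"
    define N0 where "N0 = real (card (cell 1 0 ` \<pi> ` E))"
    have cell0: "cell b 0 = cell 1 0" for b by (auto simp: cell_def fun_eq_iff)
    have "(\<lambda>b. (1 / real (Suc b)) powr s) \<longlonglongrightarrow> 0 powr s"
      by (rule tendsto_powr'[OF LIMSEQ_Suc[OF lim_1_over_n] tendsto_const]) (use s in simp)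
    then have "(\<lambda>b. N0 * (B powr s * (1 / real (Suc b)) powr s)) \<longlonglongrightarrow> N0 * (B powr s * 0 powr s)"
      by (intro tendsto_mult tendsto_const)
    then have "eventually (\<lambda>b. N0 * (B powr s * (1 / real (Suc b)) powr s) < \<epsilon> / 2) sequentially"
      using \<epsilon> s by (intro order_tendstoD(2)) auto
    then obtain b' where b': "N0 * (B powr s * (1 / real (Suc b')) powr s) < \<epsilon> / 2"
      by (auto simp: eventually_sequentially)
    define b where "b = Suc b'"
    have b: "b > 0" and b_small: "N0 * (B powr s * (1 / real b) powr s) < \<epsilon> / 2"
      using b' by (auto simp: b_def)
    define K where "K = real (b ^ (CARD('n) - 1))"
    have K: "K > 0" using b by (simp add: K_def)
    define N where "N m = cell b m ` \<pi> ` E" for m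
    define F where "F m = {c \<in> N m. \<not> subcells b i0 \<lfloor>real b ^ Suc m * q\<rfloor> c \<subseteq> N (Suc m)}" for m
    have slice': "\<And>x. x \<in> \<pi> ` E \<Longrightarrow> x $ i0 = q" using slice by auto
    have N_le: "real (card (N m)) \<le> N0 * K ^ m" for m
      using deficient_cells_negligible(1)[OF b bdd slice', of m] by (simp only: N_def K_def N0_def cell0[of b])
    have "(\<lambda>m. real (card (F m)) / K ^ m) \<longlonglongrightarrow> 0"
      using deficient_cells_negligible(2)[OF b bdd slice'] by (simp only: N_def K_def F_def)
    then have "(\<lambda>m. real (card (F m)) / K ^ m * B powr s) \<longlonglongrightarrow> 0 * B powr s"
      by (intro tendsto_mult tendsto_const)
    then have "eventually (\<lambda>m. real (card (F m)) / K ^ m * B powr s < \<epsilon> / 2) sequentially"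
      using \<epsilon> by (intro order_tendstoD(2)) auto
    then obtain m where m: "real (card (F m)) / K ^ m * B powr s < \<epsilon> / 2"
      by (auto simp: eventually_sequentially)
    define V where "V c = f ` {x \<in> E. cell b m (\<pi> x) = c}" for c
    define D where "D c = (if c \<in> F m then B * (1 / real b ^ m)\<^sup>2 else B * (1 / real b) * (1 / real b ^ m)\<^sup>2)" for c
    have finN: "finite (N m)" unfolding N_def by (intro finite_cells bdd)
    have D: "\<bar>x - y\<bar> \<le> D c" if c: "c \<in> N m" and xy: "x \<in> V c" "y \<in> V c" for c x y
    proof -
      obtain x' y' where x': "x' \<in> E" "cell b m (\<pi> x') = c" "x = f x'"
        and y': "y' \<in> E" "cell b m (\<pi> y') = c" "y = f y'" using xy by (auto simp: V_def)
      show ?thesis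
      proof (cases "c \<in> F m")
        case False
        then have "subcells b i0 \<lfloor>real b ^ Suc m * q\<rfloor> c \<subseteq> cell b (Suc m) ` \<pi> ` E"
          using c by (auto simp: F_def N_def)
        then have "\<bar>f x' - f y'\<bar> \<le> B * (1 / real b) * (1 / real b ^ m)\<^sup>2"
          unfolding B_def
          by (intro full_cell_oscillation[OF b _ quad slice _ x'(1) y'(1) x'(2) y'(2)] less_imp_le[OF C])
        then show ?thesis unfolding x'(3) y'(3) D_def using False by simp
      next
        case True
        have "cell b m (\<pi> x') = cell b m (\<pi> y')" using x'(2) y'(2) by simp
        from cell_eq_component_le[OF b this] have "norm (\<pi> x' - \<pi> y') \<le> real CARD('n) * (1 / real b ^ m)"
          by (rule norm_le_card_mult)
        then have "(norm (\<pi> x' - \<pi> y'))\<^sup>2 \<le> (real CARD('n) * (1 / real b ^ m))\<^sup>2"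
          by (intro power_mono) auto
        then have "C * (norm (\<pi> x' - \<pi> y'))\<^sup>2 \<le> C * (real CARD('n) * (1 / real b ^ m))\<^sup>2"
          using C by (intro mult_left_mono) auto
        also have "\<dots> = (B / 9) * (1 / real b ^ m)\<^sup>2" by (simp add: B_def power_mult_distrib power_divide)
        also have "\<dots> \<le> B * (1 / real b ^ m)\<^sup>2" using B by (intro mult_right_mono) auto
        finally show ?thesis unfolding x'(3) y'(3) D_def using quad[OF x'(1) y'(1)] True by simp
      qed
    qed
    have "(\<Sum>c\<in>N m. D c powr s) \<le> (\<Sum>c\<in>N m. (if c \<in> F m then B powr s / K ^ m else 0) + B powr s * (1 / real b) powr s / K ^ m)"
    proof (rule sum_mono)
      fix c
      have *: "(1 / real b ^ m)\<^sup>2 powr s = 1 / K ^ m" using pow[OF b] by (simp add: K_def)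
      show "D c powr s \<le> (if c \<in> F m then B powr s / K ^ m else 0) + B powr s * (1 / real b) powr s / K ^ m"
      proof (cases "c \<in> F m")
        case True
        then have "D c powr s = B powr s / K ^ m"
          using B by (simp only: D_def if_True powr_mult * times_divide_eq_right mult_1_right)
        then show ?thesis using True K by simp
      next
        case False
        then have "D c powr s = B powr s * (1 / real b) powr s * (1 / K ^ m)"
          using B by (simp only: D_def if_False powr_mult *)
        then show ?thesis using False by simp
      qed
    qed
    also have "\<dots> = (\<Sum>c\<in>N m. (if c \<in> F m then B powr s / K ^ m else 0))
        + real (card (N m)) * (B powr s * (1 / real b) powr s / K ^ m)"
      by (simp add: sum.distrib)
    also have "(\<Sum>c\<in>N m. (if c \<in> F m then B powr s / K ^ m else 0)) = real (card (F m)) / K ^ m * B powr s"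
    proof -
      have "N m \<inter> F m = F m" by (auto simp: F_def)
      then show ?thesis using finN by (simp add: sum.If_cases)
    qed
    also have "real (card (N m)) * (B powr s * (1 / real b) powr s / K ^ m)
        \<le> (N0 * K ^ m) * (B powr s * (1 / real b) powr s / K ^ m)"
      using K by (intro mult_right_mono N_le) auto
    also have "\<dots> = N0 * (B powr s * (1 / real b) powr s)" using K by simp
    finally have "(\<Sum>c\<in>N m. D c powr s) \<le> \<epsilon>" using m b_small by linarith
    moreover have "f ` E \<subseteq> (\<Union>c\<in>N m. V c)" by (auto simp: N_def V_def)
    moreover have "0 \<le> D c" for c using B by (simp add: D_def)
    ultimately show "\<exists>I V D. finite (I::('n \<Rightarrow> int) set) \<and> f ` E \<subseteq> (\<Union>i\<in>I. V i) \<and>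
      (\<forall>i\<in>I. 0 \<le> D i \<and> (\<forall>x\<in>V i. \<forall>y\<in>V i. \<bar>x - y\<bar> \<le> D i)) \<and> (\<Sum>i\<in>I. D i powr s) \<le> \<epsilon>"
      using finN D by (intro exI[of _ "N m"] exI[of _ V] exI[of _ D] conjI ballI) simp_all
  qed
  then show ?thesis by (simp add: s_def)
qed

section \<open>Critical values of DC functions\<close>

text \<open>
  Put \<open>A = g b - g a\<close>. The numbers \<open>A - x \<bullet> (b - a)\<close> and \<open>A - z \<bullet> (b - a)\<close> are nonnegative, and their
  mean with the weights \<open>1 - t\<close> and \<open>t\<close> is \<open>A - w \<bullet> (b - a)\<close>. So the first of them is at most
  \<open>m\<close> times this mean, and the same holds at \<open>b\<close>. Adding, \<open>(y - x) \<bullet> (b - a)\<close> is at most \<open>m\<close> times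
  \<open>(v - w) \<bullet> (b - a)\<close>, and by monotonicity the latter is dominated by the square on the right.
\<close>
lemma minty_estimate:
  fixes a b :: "'a::real_inner"
  assumes ab: "a \<in> U" "b \<in> U"
    and x: "x \<in> subdiff U g a" "x \<in> subdiff U h a" and z: "z \<in> subdiff U g a"
    and y: "y \<in> subdiff U g b" "y \<in> subdiff U h b" and u: "u \<in> subdiff U g b"
    and t: "0 \<le> t" "1 \<le> (1 - t) * m" and s: "0 \<le> s" "1 \<le> (1 - s) * m" and m: "m > 0"
  defines "w \<equiv> (1 - t) *\<^sub>R x + t *\<^sub>R z" and "v \<equiv> (1 - s) *\<^sub>R y + s *\<^sub>R u"
  shows "\<bar>(g a - h a) - (g b - h b)\<bar> \<le> m * (norm ((a + w) - (b + v)))\<^sup>2"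
proof -
  define A where "A = g b - g a"
  have swap: "c \<bullet> (a - b) = - (c \<bullet> (b - a))" for c by (simp add: inner_diff_right)
  have gx: "x \<bullet> (b - a) \<le> A" "z \<bullet> (b - a) \<le> A" "A \<le> y \<bullet> (b - a)" "A \<le> u \<bullet> (b - a)"
    using subdiffD[OF x(1) ab(2)] subdiffD[OF z ab(2)] subdiffD[OF y(1) ab(1)] subdiffD[OF u ab(1)]
    unfolding swap A_def by linarith+
  have hx: "x \<bullet> (b - a) \<le> h b - h a" "h b - h a \<le> y \<bullet> (b - a)"
    using subdiffD[OF x(2) ab(2)] subdiffD[OF y(2) ab(1)] unfolding swap by linarith+
  have "A - w \<bullet> (b - a) = (1 - t) * (A - x \<bullet> (b - a)) + t * (A - z \<bullet> (b - a))"
    by (simp add: w_def inner_add_left algebra_simps)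
  then have 1: "(1 - t) * (A - x \<bullet> (b - a)) \<le> A - w \<bullet> (b - a)" using t gx by simp
  have "A - x \<bullet> (b - a) \<le> ((1 - t) * m) * (A - x \<bullet> (b - a))"
    using t gx mult_right_mono[of 1 "(1 - t) * m" "A - x \<bullet> (b - a)"] by simp
  also have "\<dots> \<le> m * (A - w \<bullet> (b - a))" using mult_left_mono[OF 1, of m] m by (simp add: mult_ac)
  finally have 2: "A - x \<bullet> (b - a) \<le> m * (A - w \<bullet> (b - a))" .
  have "v \<bullet> (b - a) - A = (1 - s) * (y \<bullet> (b - a) - A) + s * (u \<bullet> (b - a) - A)"
    by (simp add: v_def inner_add_left algebra_simps)
  then have 3: "(1 - s) * (y \<bullet> (b - a) - A) \<le> v \<bullet> (b - a) - A" using s gx by simp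
  have "y \<bullet> (b - a) - A \<le> ((1 - s) * m) * (y \<bullet> (b - a) - A)"
    using s gx mult_right_mono[of 1 "(1 - s) * m" "y \<bullet> (b - a) - A"] by simp
  also have "\<dots> \<le> m * (v \<bullet> (b - a) - A)" using mult_left_mono[OF 3, of m] m by (simp add: mult_ac)
  finally have "y \<bullet> (b - a) - x \<bullet> (b - a) \<le> m * ((v - w) \<bullet> (b - a))"
    using 2 by (simp add: inner_diff_left algebra_simps)
  moreover have "(v - w) \<bullet> (b - a) \<le> (norm ((a + w) - (b + v)))\<^sup>2"
  proof -
    have "(norm ((a + w) - (b + v)))\<^sup>2 = (norm (b - a))\<^sup>2 + 2 * ((v - w) \<bullet> (b - a)) + (norm (v - w))\<^sup>2"
      unfolding power2_norm_eq_inner by (simp add: inner_commute algebra_simps)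
    moreover have "0 \<le> (norm (b - a + (v - w)))\<^sup>2 + (norm (b - a))\<^sup>2 + (norm (v - w))\<^sup>2" by simp
    then have "0 \<le> (norm (b - a))\<^sup>2 + ((v - w) \<bullet> (b - a)) + (norm (v - w))\<^sup>2"
      unfolding power2_norm_eq_inner by (simp add: inner_commute algebra_simps)
    ultimately show ?thesis by linarith
  qed
  then have "m * ((v - w) \<bullet> (b - a)) \<le> m * (norm ((a + w) - (b + v)))\<^sup>2" using m by simp
  ultimately show ?thesis using gx hx unfolding A_def by linarith
qed

lemma rational_between_convex_combination:
  assumes "p \<noteq> (r::real)"
  shows "\<exists>q t. 0 < t \<and> t < 1 \<and> (1 - t) * p + t * r = real_of_rat q"
proof -
  obtain q where q: "p < real_of_rat q \<and> real_of_rat q < r \<or> r < real_of_rat q \<and> real_of_rat q < p"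
    using of_rat_dense[of p r] of_rat_dense[of r p] assms by (metis linorder_neqE_linordered_idom)
  define t where "t = (real_of_rat q - p) / (r - p)"
  have "0 < t" "t < 1" using q by (auto simp: t_def divide_simps)
  moreover have "t * (r - p) = real_of_rat q - p" using assms by (simp add: t_def)
  then have "(1 - t) * p + t * r = real_of_rat q" by (simp add: algebra_simps)
  ultimately show ?thesis by blast
qed

text \<open>
  The points are sorted into countably many classes, according to a coordinate in which the two
  subgradients differ, a rational value that \<open>a + w\<close> takes in this coordinate for a suitable \<open>w\<close> on the open segment
  between them, and a natural number bounding \<open>1 / (1 - t)\<close> and the norm of \<open>a + w\<close>. On each
  class, \<open>minty_estimate\<close> controls \<open>f\<close> by points of one hyperplane.
\<close>
lemma singular_critical_values_null:
  fixes g h f :: "real ^ 'n \<Rightarrow> real"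
  assumes n: "CARD('n) \<ge> 2" and E: "E \<subseteq> U"
    and sing: "\<And>a. a \<in> E \<Longrightarrow> \<exists>x z. x \<in> subdiff U g a \<and> x \<in> subdiff U h a \<and> z \<in> subdiff U g a \<and> z \<noteq> x"
    and f: "\<And>a b. a \<in> U \<Longrightarrow> b \<in> U \<Longrightarrow> \<bar>f a - f b\<bar> = \<bar>(g a - h a) - (g b - h b)\<bar>"
  shows "hausdorff_measure ((real CARD('n) - 1) / 2) (f ` E) = 0"
proof -
  define w where "w t x z = (1 - t) *\<^sub>R x + t *\<^sub>R z" for t :: real and x z :: "real ^ 'n"
  define good where "good i q m a x z t \<longleftrightarrow> x \<in> subdiff U g a \<and> x \<in> subdiff U h a \<and> z \<in> subdiff U g a
      \<and> 0 \<le> t \<and> 1 \<le> (1 - t) * real m \<and> (a + w t x z) $ i = real_of_rat q \<and> norm (a + w t x z) \<le> real m"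
    for i q m a x z t
  define S where "S = (\<lambda>(i, q, m). {a \<in> E. \<exists>x z t. good i q m a x z t})"
  have "E \<subseteq> (\<Union>k\<in>UNIV. S k)"
  proof
    fix a assume a: "a \<in> E"
    then obtain x z where xz: "x \<in> subdiff U g a" "x \<in> subdiff U h a" "z \<in> subdiff U g a" "z \<noteq> x"
      using sing by blast
    then obtain i where i: "x $ i \<noteq> z $ i" unfolding vec_eq_iff by metis
    obtain q t where t: "0 < t" "t < 1" "(1 - t) * (a $ i + x $ i) + t * (a $ i + z $ i) = real_of_rat q"
      using rational_between_convex_combination[of "a $ i + x $ i" "a $ i + z $ i"] i by auto
    then have ti: "(a + w t x z) $ i = real_of_rat q" by (simp add: w_def algebra_simps)
    obtain m :: nat where m: "max (1 / (1 - t)) (norm (a + w t x z)) \<le> real m" using real_arch_simple by blast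
    then have "1 \<le> (1 - t) * real m" using t by (simp add: field_simps)
    then have "good i q m a x z t" using xz t ti m by (auto simp: good_def)
    then have "a \<in> S (i, q, m)" using a unfolding S_def by auto
    then show "a \<in> (\<Union>k\<in>UNIV. S k)" by blast
  qed
  then have "f ` E \<subseteq> f ` (\<Union>k\<in>UNIV. S k)" by (rule image_mono)
  then have "f ` E \<subseteq> (\<Union>k\<in>UNIV. f ` S k)" unfolding image_UN .
  moreover have "hausdorff_measure ((real CARD('n) - 1) / 2) (\<Union>k\<in>UNIV. f ` S k) = 0"
  proof (rule hausdorff_measure_UN_eq_0)
    fix k :: "'n \<times> rat \<times> nat"
    obtain i q m where k: "k = (i, q, m)" by (cases k)
    have "\<forall>a\<in>S k. \<exists>x z t. good i q m a x z t" by (auto simp: S_def k)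
    then obtain X Z T where XZT: "\<And>a. a \<in> S k \<Longrightarrow> good i q m a (X a) (Z a) (T a)" by metis
    define \<pi> where "\<pi> a = a + w (T a) (X a) (Z a)" for a
    have \<pi>: "\<pi> a $ i = real_of_rat q" "norm (\<pi> a) \<le> real m" if "a \<in> S k" for a
      using XZT[OF that] by (auto simp: good_def \<pi>_def)
    show "hausdorff_measure ((real CARD('n) - 1) / 2) (f ` S k) = 0"
    proof (rule hausdorff_null_quadratic_bounded[OF n])
      show "bounded (\<pi> ` S k)" using \<pi>(2) by (auto simp: bounded_iff)
      show "real (Suc m) > 0" by simp
      fix a b assume ab: "a \<in> S k" "b \<in> S k"
      have "m > 0" using XZT[OF ab(1)] by (cases "m = 0") (auto simp: good_def)
      have U: "a \<in> U" "b \<in> U" using ab E by (auto simp: S_def k)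
      have "\<bar>(g a - h a) - (g b - h b)\<bar> \<le> real m * (norm (\<pi> a - \<pi> b))\<^sup>2"
        using XZT[OF ab(1)] XZT[OF ab(2)] \<open>m > 0\<close> unfolding \<pi>_def w_def good_def
        by (intro minty_estimate[OF U]) auto
      also have "\<dots> \<le> real (Suc m) * (norm (\<pi> a - \<pi> b))\<^sup>2" by (intro mult_right_mono) auto
      finally show "\<bar>f a - f b\<bar> \<le> real (Suc m) * (norm (\<pi> a - \<pi> b))\<^sup>2" using f[OF U] by simp
    qed (use \<pi>(1) in auto)
  qed auto
  ultimately show ?thesis by (rule hausdorff_measure_mono_0[rotated])
qed

lemma critical_values_null:
  fixes d :: "real ^ 'n \<Rightarrow> real"
  assumes n: "CARD('n) \<ge> 2" and dc: "locally_dc_on UNIV G d"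
    and nonstat: "\<And>x. x \<in> G \<Longrightarrow> \<not> stationary_point d x"
  shows "hausdorff_measure ((real CARD('n) - 1) / 2) (cv G d) = 0"
proof -
  define F where "F = {U. open U \<and> U \<subseteq> G \<and> dc_on U d}"
  obtain F' where F': "F' \<subseteq> F" "countable F'" "\<Union>F' = \<Union>F" using Lindelof[of F] by (auto simp: F_def)
  have "\<Union>F = G" using dc by (fastforce simp: F_def locally_dc_on_def)
  then have "Crit G d \<subseteq> \<Union>F'" using F'(3) by (auto simp: Crit_def)
  then have "cv G d \<subseteq> (\<Union>U\<in>F'. d ` (Crit G d \<inter> U))" unfolding cv_def by blast
  moreover have "hausdorff_measure ((real CARD('n) - 1) / 2) (\<Union>U\<in>F'. d ` (Crit G d \<inter> U)) = 0"
  proof (rule hausdorff_measure_UN_eq_0[OF F'(2)])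
    fix U assume "U \<in> F'"
    then have U: "open U" "U \<subseteq> G" "dc_on U d" using F'(1) by (auto simp: F_def)
    then obtain g h where gh: "convex_on U g" "convex_on U h" "\<And>x. x \<in> U \<Longrightarrow> d x = g x - h x"
      unfolding dc_on_def by blast
    \<comment> \<open>The roles of \<open>g\<close> and \<open>h\<close> are symmetric, as only \<open>\<bar>d a - d b\<bar>\<close> enters.\<close>
    define E1 where "E1 = {a \<in> U. \<exists>x z. x \<in> subdiff U g a \<and> x \<in> subdiff U h a \<and> z \<in> subdiff U g a \<and> z \<noteq> x}"
    define E2 where "E2 = {a \<in> U. \<exists>x z. x \<in> subdiff U h a \<and> x \<in> subdiff U g a \<and> z \<in> subdiff U h a \<and> z \<noteq> x}"
    have "Crit G d \<inter> U \<subseteq> E1 \<union> E2"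
    proof
      fix a assume a: "a \<in> Crit G d \<inter> U"
      then have "subdiff U g a \<inter> subdiff U h a \<noteq> {}"
        by (intro subdiff_Int_at_Crit[OF U(1) gh]) (auto simp: Crit_iff)
      then obtain x where x: "x \<in> subdiff U g a" "x \<in> subdiff U h a" by blast
      then have "subdiff U g a \<noteq> {x} \<or> subdiff U h a \<noteq> {x}"
        using a U nonstat by (intro nonstationary_subdiff[OF U(1) gh]) auto
      then show "a \<in> E1 \<union> E2" using a x by (auto simp: E1_def E2_def)
    qed
    then have "d ` (Crit G d \<inter> U) \<subseteq> (\<Union>b\<in>UNIV. if b then d ` E1 else d ` E2)" by auto
    moreover have "hausdorff_measure ((real CARD('n) - 1) / 2) (\<Union>b\<in>UNIV. if b then d ` E1 else d ` E2) = 0"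
    proof (rule hausdorff_measure_UN_eq_0)
      have "hausdorff_measure ((real CARD('n) - 1) / 2) (d ` E1) = 0"
        by (rule singular_critical_values_null[OF n, of E1 U g h]) (auto simp: E1_def gh)
      moreover have "hausdorff_measure ((real CARD('n) - 1) / 2) (d ` E2) = 0"
        by (rule singular_critical_values_null[OF n, of E2 U h g]) (auto simp: E2_def gh)
      ultimately show "hausdorff_measure ((real CARD('n) - 1) / 2) (if b then d ` E1 else d ` E2) = 0" for b
        by simp
    qed auto
    ultimately show "hausdorff_measure ((real CARD('n) - 1) / 2) (d ` (Crit G d \<inter> U)) = 0"
      by (rule hausdorff_measure_mono_0[rotated])
  qed
  ultimately show ?thesis by (rule hausdorff_measure_mono_0[rotated])
qed

section \<open>Continuous selections of DC functions\<close>
lemma convex_on_max: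
  assumes "convex_on S f" "convex_on S g"
  shows "convex_on S (\<lambda>x. max (f x) (g x) :: real)"
proof (rule convex_onI)
  fix t x y assume *: "(0::real) < t" "t < 1" "x \<in> S" "y \<in> S"
  have "f ((1 - t) *\<^sub>R x + t *\<^sub>R y) \<le> (1 - t) * f x + t * f y"
    "g ((1 - t) *\<^sub>R x + t *\<^sub>R y) \<le> (1 - t) * g x + t * g y"
    using * assms by (auto intro: convex_onD)
  moreover have "(1 - t) * f x \<le> (1 - t) * max (f x) (g x)" "t * f y \<le> t * max (f y) (g y)"
    "(1 - t) * g x \<le> (1 - t) * max (f x) (g x)" "t * g y \<le> t * max (f y) (g y)"
    using * by (auto intro: mult_left_mono)
  ultimately show "max (f ((1 - t) *\<^sub>R x + t *\<^sub>R y)) (g ((1 - t) *\<^sub>R x + t *\<^sub>R y))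
      \<le> (1 - t) * max (f x) (g x) + t * max (f y) (g y)"
    by linarith
qed (use assms convex_on_imp_convex in blast)

lemma convex_on_sum_fun:
  assumes "finite J" "convex S" "\<And>j. j \<in> J \<Longrightarrow> convex_on S (f j)"
  shows "convex_on S (\<lambda>x. \<Sum>j\<in>J. f j x)"
  using assms(1,3)
proof (induction J rule: finite_induct)
  case empty
  then show ?case using assms(2) by (simp add: convex_on_const)
next
  case (insert j J)
  then have "convex_on S (\<lambda>x. f j x + (\<Sum>j\<in>J. f j x))" by (intro convex_on_add) auto
  then show ?case using insert by simp
qed

lemma convex_on_midpoint:
  assumes "convex_on D f" "t + w \<in> D" "t - w \<in> D"
  shows "2 * f t \<le> f (t + w) + f (t - w)"
proof -
  have "f ((1 - 1/2) *\<^sub>R (t + w) + (1/2) *\<^sub>R (t - w)) \<le> (1 - 1/2) * f (t + w) + (1/2) * f (t - w)"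
    using assms by (intro convex_onD) auto
  moreover have "(1 - 1/2::real) *\<^sub>R (t + w) + (1/2) *\<^sub>R (t - w) = t"
    by (simp add: scaleR_add_right scaleR_diff_right scaleR_left.add[symmetric])
  ultimately show ?thesis by simp
qed

text \<open>
  If convexity failed on a segment, then \<open>F\<close> minus the affine interpolation of its end values would have a positive
  maximum there. At the leftmost point where the maximum is attained the midpoint inequality fails at all small
  scales.
\<close>
lemma convex_on_local_midpointI:
  fixes F :: "'a::real_normed_vector \<Rightarrow> real"
  assumes D: "convex D" and cont: "continuous_on D F"
    and mid: "\<And>t w. t \<in> D \<Longrightarrow> \<exists>e>0. \<forall>s. 0 < s \<and> s < e \<and> t + s *\<^sub>R w \<in> D \<and> t - s *\<^sub>R w \<in> D \<longrightarrow>
        2 * F t \<le> F (t + s *\<^sub>R w) + F (t - s *\<^sub>R w)"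
  shows "convex_on D F"
proof (rule convex_onI[OF _ D], rule ccontr)
  fix \<tau> x y assume \<tau>: "0 < \<tau>" "\<tau> < 1" and xy: "x \<in> D" "y \<in> D"
    and gt: "\<not> F ((1 - \<tau>) *\<^sub>R x + \<tau> *\<^sub>R y) \<le> (1 - \<tau>) * F x + \<tau> * F y"
  define \<psi> where "\<psi> s = F ((1 - s) *\<^sub>R x + s *\<^sub>R y) - ((1 - s) * F x + s * F y)" for s
  have inD: "(1 - s) *\<^sub>R x + s *\<^sub>R y \<in> D" if "s \<in> {0..1}" for s
    using that xy D by (auto simp: convex_alt)
  have cont\<psi>: "continuous_on {0..1} \<psi>"
    unfolding \<psi>_def
    by (intro continuous_intros continuous_on_compose2[OF cont]) (use inD in blast)
  obtain s1 where s1: "s1 \<in> {0..1}" "\<And>s. s \<in> {0..1} \<Longrightarrow> \<psi> s \<le> \<psi> s1"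
    using continuous_attains_sup[OF _ _ cont\<psi>] by auto
  have "\<psi> \<tau> > 0" using gt by (simp add: \<psi>_def)
  then have pos: "\<psi> s1 > 0" using s1(2)[of \<tau>] \<tau> by simp
  define S where "S = {s \<in> {0..1}. \<psi> s = \<psi> s1}"
  have "closed S"
    unfolding S_def by (rule continuous_closed_preimage_constant[OF cont\<psi> closed_atLeastAtMost])
  moreover have "bounded S" by (rule bounded_subset[OF bounded_closed_interval[of 0 1]]) (auto simp: S_def)
  ultimately have comp: "compact S" by (simp add: compact_eq_bounded_closed)
  have "S \<noteq> {}" using s1(1) by (auto simp: S_def)
  then obtain s0 where s0: "s0 \<in> S" "\<And>s. s \<in> S \<Longrightarrow> s0 \<le> s"
    using continuous_attains_inf[OF comp _ continuous_on_id] by auto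
  have "\<psi> 0 = 0" "\<psi> 1 = 0" by (simp_all add: \<psi>_def)
  with pos s0(1) have s01: "0 < s0" "s0 < 1" by (auto simp: S_def less_le)
  define t where "t = (1 - s0) *\<^sub>R x + s0 *\<^sub>R y"
  have shift: "t + s *\<^sub>R (y - x) = (1 - (s0 + s)) *\<^sub>R x + (s0 + s) *\<^sub>R y" for s
    by (simp add: t_def algebra_simps)
  have shift': "t - s *\<^sub>R (y - x) = (1 - (s0 - s)) *\<^sub>R x + (s0 - s) *\<^sub>R y" for s
    by (simp add: t_def algebra_simps)
  have "t \<in> D" using inD[of s0] s01 by (simp add: t_def)
  from mid[OF this, of "y - x"] obtain e where e: "e > 0"
    "\<And>s. 0 < s \<Longrightarrow> s < e \<Longrightarrow> t + s *\<^sub>R (y - x) \<in> D \<Longrightarrow> t - s *\<^sub>R (y - x) \<in> D \<Longrightarrow>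
        2 * F t \<le> F (t + s *\<^sub>R (y - x)) + F (t - s *\<^sub>R (y - x))" by blast
  define s where "s = min e (min s0 (1 - s0)) / 2"
  have "0 < s" "s < e" "s \<le> s0 / 2" "s \<le> (1 - s0) / 2" using e(1) s01 by (auto simp: s_def)
  then have s: "0 < s" "s < e" "s0 + s \<in> {0..1}" "s0 - s \<in> {0..1}" using s01 by auto
  have "2 * F t \<le> F (t + s *\<^sub>R (y - x)) + F (t - s *\<^sub>R (y - x))"
    using s inD[of "s0 + s"] inD[of "s0 - s"] unfolding shift[symmetric] shift'[symmetric] by (intro e(2))
  then have "2 * \<psi> s0 \<le> \<psi> (s0 + s) + \<psi> (s0 - s)"
    unfolding \<psi>_def shift shift' t_def[symmetric] by (simp add: algebra_simps)
  moreover have "\<psi> (s0 + s) \<le> \<psi> s1" using s1(2) s(3) by blast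
  moreover have "\<psi> (s0 - s) < \<psi> s1"
    using s1(2)[OF s(4)] s0(2)[of "s0 - s"] s(1,4) by (fastforce simp: S_def less_le)
  moreover have "\<psi> s0 = \<psi> s1" using s0(1) by (simp add: S_def)
  ultimately show False by linarith
qed

text \<open>
  Let \<open>c\<close> be convex such that \<open>c + F j\<close> and \<open>c - F j\<close> are convex for all \<open>j\<close>, and let \<open>C\<close> be the sum of \<open>c\<close> and of all
  \<open>2 * c + \<bar>F k - F l\<bar>\<close>, which are convex too. Then \<open>f + C\<close> passes the local midpoint test: close to \<open>t\<close> only those
  \<open>F j\<close> are selected that agree with \<open>f\<close> at \<open>t\<close>. If \<open>F i\<close> is selected on one side and \<open>F j\<close> on the other,
  the second difference of \<open>f\<close> is that of \<open>(F i + F j) / 2\<close> up to an error coming from \<open>F i - F j\<close>, a function vanishing at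
  \<open>t\<close>. The term with \<open>\<bar>F i - F j\<bar>\<close> absorbs this error.
\<close>
lemma dc_on_continuous_selection:
  fixes f :: "'a::real_normed_vector \<Rightarrow> real"
  assumes D: "convex D" "D \<noteq> {}" and J: "finite J" and f: "continuous_on D f"
    and dc: "\<And>j. j \<in> J \<Longrightarrow> dc_on D (F j)" and sel: "\<And>x. x \<in> D \<Longrightarrow> \<exists>j\<in>J. f x = F j x"
  shows "dc_on D f"
proof -
  have "\<forall>j\<in>J. \<exists>a b. continuous_on D a \<and> convex_on D a \<and> continuous_on D b \<and> convex_on D b \<and>
      (\<forall>x\<in>D. F j x = a x - b x)"
    using dc unfolding dc_on_def by blast
  then obtain a b where ab: "\<And>j. j \<in> J \<Longrightarrow> continuous_on D (a j)" "\<And>j. j \<in> J \<Longrightarrow> convex_on D (a j)"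
    "\<And>j. j \<in> J \<Longrightarrow> continuous_on D (b j)" "\<And>j. j \<in> J \<Longrightarrow> convex_on D (b j)"
    "\<And>j x. j \<in> J \<Longrightarrow> x \<in> D \<Longrightarrow> F j x = a j x - b j x"
    by metis
  define c where "c x = (\<Sum>j\<in>J. a j x + b j x)" for x
  have c: "convex_on D c" unfolding c_def using ab D by (intro convex_on_sum_fun[OF J] convex_on_add) auto
  have c_cont: "continuous_on D c" unfolding c_def using ab by (intro continuous_intros) auto
  have ctrl: "convex_on D (\<lambda>x. c x + F j x)" "convex_on D (\<lambda>x. c x - F j x)" if j: "j \<in> J" for j
  proof -
    define R where "R x = (\<Sum>i\<in>J - {j}. a i x + b i x)" for x
    have R: "convex_on D R" unfolding R_def using ab D J by (intro convex_on_sum_fun convex_on_add) auto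
    have c_eq: "c x = (a j x + b j x) + R x" for x
      unfolding c_def R_def using J j by (simp add: sum.remove)
    have "convex_on D (\<lambda>x. (a j x + a j x) + R x)" "convex_on D (\<lambda>x. (b j x + b j x) + R x)"
      using R ab j by (auto intro!: convex_on_add)
    then show "convex_on D (\<lambda>x. c x + F j x)" "convex_on D (\<lambda>x. c x - F j x)"
      unfolding convex_on_def c_eq using ab(5)[OF j] by (auto simp: convex_def)
  qed
  define T where "T k l x = 2 * c x + \<bar>F k x - F l x\<bar>" for k l x
  have T: "convex_on D (T k l)" if "k \<in> J" "l \<in> J" for k l
  proof -
    have "convex_on D (\<lambda>x. max ((c x + F k x) + (c x - F l x)) ((c x + F l x) + (c x - F k x)))"
      by (rule convex_on_max[OF convex_on_add[OF ctrl(1)[OF that(1)] ctrl(2)[OF that(2)]]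
            convex_on_add[OF ctrl(1)[OF that(2)] ctrl(2)[OF that(1)]]])
    moreover have "(\<lambda>x. max ((c x + F k x) + (c x - F l x)) ((c x + F l x) + (c x - F k x))) = T k l"
      by (auto simp: T_def)
    ultimately show ?thesis by simp
  qed
  have F_cont: "continuous_on D (F j)" if "j \<in> J" for j
  proof -
    have "continuous_on D (\<lambda>x. a j x - b j x)" using ab that by (intro continuous_intros) auto
    then show ?thesis using ab(5)[OF that] by (simp cong: continuous_on_cong)
  qed
  have T_cont: "continuous_on D (T k l)" if "k \<in> J" "l \<in> J" for k l
    unfolding T_def using c_cont F_cont that by (intro continuous_intros) auto
  define C where "C x = c x + (\<Sum>k\<in>J. \<Sum>l\<in>J. T k l x)" for x
  have C: "convex_on D C"
    unfolding C_def using T c D by (intro convex_on_add convex_on_sum_fun[OF J]) auto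
  have C_cont: "continuous_on D C"
    unfolding C_def using T_cont c_cont by (intro continuous_intros) auto
  have "convex_on D (\<lambda>x. f x + C x)"
  proof (rule convex_on_local_midpointI[OF D(1)])
    show "continuous_on D (\<lambda>x. f x + C x)" using f C_cont by (intro continuous_intros)
    fix t w assume t: "t \<in> D"
    have "\<forall>\<^sub>F x in at t within D. \<forall>j\<in>J. F j t \<noteq> f t \<longrightarrow> F j x \<noteq> f x"
      unfolding eventually_ball_finite_distrib[OF J]
    proof
      fix j assume j: "j \<in> J"
      show "\<forall>\<^sub>F x in at t within D. F j t \<noteq> f t \<longrightarrow> F j x \<noteq> f x"
      proof (cases "F j t = f t")
        case False
        have "((\<lambda>x. F j x - f x) \<longlongrightarrow> F j t - f t) (at t within D)"
          using F_cont[OF j] f t by (intro tendsto_diff) (auto simp: continuous_on_def)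
        then have "\<forall>\<^sub>F x in at t within D. F j x - f x \<noteq> 0"
          using False by (intro tendsto_imp_eventually_ne) auto
        then show ?thesis by (rule eventually_mono) simp
      qed simp
    qed
    then obtain \<delta> where \<delta>: "\<delta> > 0"
      "\<And>x j. x \<in> D \<Longrightarrow> dist x t < \<delta> \<Longrightarrow> j \<in> J \<Longrightarrow> F j x = f x \<Longrightarrow> F j t = f t"
      unfolding eventually_at by (metis dist_self)
    show "\<exists>e>0. \<forall>s. 0 < s \<and> s < e \<and> t + s *\<^sub>R w \<in> D \<and> t - s *\<^sub>R w \<in> D \<longrightarrow>
        2 * (f t + C t) \<le> f (t + s *\<^sub>R w) + C (t + s *\<^sub>R w) + (f (t - s *\<^sub>R w) + C (t - s *\<^sub>R w))"
    proof (intro exI[of _ "\<delta> / (norm w + 1)"] conjI allI impI)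
      show "0 < \<delta> / (norm w + 1)" using \<delta>(1) by (intro divide_pos_pos add_nonneg_pos) auto
      fix s assume s: "0 < s \<and> s < \<delta> / (norm w + 1) \<and> t + s *\<^sub>R w \<in> D \<and> t - s *\<^sub>R w \<in> D"
      define p m where "p = t + s *\<^sub>R w" and "m = t - s *\<^sub>R w"
      have pm: "p \<in> D" "m \<in> D" using s by (auto simp: p_def m_def)
      have "s * norm w \<le> s * (norm w + 1)" using s by simp
      also have "\<dots> < \<delta>" using s by (simp add: pos_less_divide_eq add_nonneg_pos)
      finally have "dist p t < \<delta>" "dist m t < \<delta>" using s by (auto simp: p_def m_def dist_norm)
      moreover obtain i j where ij: "i \<in> J" "f p = F i p" "j \<in> J" "f m = F j m"
        using sel pm by metis
      ultimately have t_eq: "F i t = f t" "F j t = f t" using \<delta>(2) pm by metis+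
      have mid: "2 * K t \<le> K p + K m" if "convex_on D K" for K
        using convex_on_midpoint[OF that] pm by (auto simp: p_def m_def)
      have pair: "0 \<le> T k l p + T k l m - 2 * T k l t" if "k \<in> J" "l \<in> J" for k l
        using mid[OF T[OF that]] by simp
      have "T i j p + T i j m - 2 * T i j t \<le> (\<Sum>l\<in>J. T i l p + T i l m - 2 * T i l t)"
        using ij pair J by (intro member_le_sum) auto
      also have "\<dots> \<le> (\<Sum>k\<in>J. \<Sum>l\<in>J. T k l p + T k l m - 2 * T k l t)"
        using ij pair J by (intro member_le_sum[of i J "\<lambda>k. \<Sum>l\<in>J. T k l p + T k l m - 2 * T k l t"] sum_nonneg) auto
      also have "\<dots> = (C p - c p) + (C m - c m) - 2 * (C t - c t)"
        by (simp add: C_def sum.distrib sum_subtractf sum_distrib_left)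
      finally have "T i j p + T i j m - 2 * T i j t \<le> (C p - c p) + (C m - c m) - 2 * (C t - c t)" .
      moreover have "2 * (c t + F i t) \<le> c p + F i p + (c m + F i m)" "2 * (c t + F j t) \<le> c p + F j p + (c m + F j m)"
        using mid[OF ctrl(1)] ij by auto
      moreover have "2 * c t \<le> c p + c m" using mid[OF c] .
      ultimately have "2 * (f t + C t) \<le> f p + C p + (f m + C m)"
        using ij t_eq unfolding T_def by (auto simp: abs_if split: if_splits)
      then show "2 * (f t + C t) \<le> f (t + s *\<^sub>R w) + C (t + s *\<^sub>R w) + (f (t - s *\<^sub>R w) + C (t - s *\<^sub>R w))"
        by (simp add: p_def m_def)
    qed
  qed
  moreover have "continuous_on D (\<lambda>x. f x + C x)" using f C_cont by (intro continuous_intros)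
  ultimately show ?thesis
    unfolding dc_on_def using D C C_cont by (intro conjI exI[of _ "\<lambda>x. f x + C x"] exI[of _ C]) auto
qed

section \<open>Level sets as graphs of DC functions\<close>
lemma convex_extension_of_subgradients:
  fixes f :: "'a::euclidean_space \<Rightarrow> real"
  assumes S: "S \<noteq> {}" and A: "\<And>u w. u \<in> S \<Longrightarrow> w \<in> S \<Longrightarrow> f w + A w \<bullet> (u - w) \<le> f u"
    and K: "\<And>w. w \<in> S \<Longrightarrow> norm (A w) \<le> K"
  obtains F where "convex_on UNIV F" "continuous_on UNIV F" "\<And>u. u \<in> S \<Longrightarrow> F u = f u"
proof -
  define F where "F u = (SUP w\<in>S. f w + A w \<bullet> (u - w))" for u
  obtain u0 where u0: "u0 \<in> S" using S by blast
  have bdd: "bdd_above ((\<lambda>w. f w + A w \<bullet> (u - w)) ` S)" for u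
  proof (rule bdd_aboveI2)
    fix w assume w: "w \<in> S"
    have "f w + A w \<bullet> (u - w) = (f w + A w \<bullet> (u0 - w)) + A w \<bullet> (u - u0)"
      by (simp add: inner_diff_right)
    also have "\<dots> \<le> f u0 + norm (A w) * norm (u - u0)"
      using A[OF u0 w] norm_cauchy_schwarz[of "A w" "u - u0"] by linarith
    also have "\<dots> \<le> f u0 + K * norm (u - u0)" using K[OF w] by (simp add: mult_right_mono)
    finally show "f w + A w \<bullet> (u - w) \<le> f u0 + K * norm (u - u0)" .
  qed
  have conv: "convex_on UNIV F"
  proof (rule convex_onI)
    fix t x y assume t: "(0::real) < t" "t < 1"
    show "F ((1 - t) *\<^sub>R x + t *\<^sub>R y) \<le> (1 - t) * F x + t * F y"
      unfolding F_def[of "(1 - t) *\<^sub>R x + t *\<^sub>R y"]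
    proof (rule cSUP_least[OF S])
      fix w assume w: "w \<in> S"
      have "f w + A w \<bullet> ((1 - t) *\<^sub>R x + t *\<^sub>R y - w)
          = (1 - t) * (f w + A w \<bullet> (x - w)) + t * (f w + A w \<bullet> (y - w))"
        by (simp add: inner_diff_right inner_add_right algebra_simps)
      also have "\<dots> \<le> (1 - t) * F x + t * F y"
        unfolding F_def using t w bdd by (intro add_mono mult_left_mono cSUP_upper) auto
      finally show "f w + A w \<bullet> ((1 - t) *\<^sub>R x + t *\<^sub>R y - w) \<le> (1 - t) * F x + t * F y" .
    qed
  qed simp
  have "F u = f u" if u: "u \<in> S" for u
  proof (rule antisym)
    show "F u \<le> f u" unfolding F_def using A u S by (intro cSUP_least) auto
    show "f u \<le> F u" unfolding F_def using cSUP_upper[OF u bdd[of u]] by simp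
  qed
  then show thesis using that conv convex_on_continuous[OF open_UNIV conv] by blast
qed

text \<open>
  Here \<open>\<gamma>\<close> and \<open>\<eta>\<close> are \<open>g\<close> and \<open>h\<close> along the graph of \<open>\<phi>\<close>. If \<open>G w \<bullet> v\<close> and \<open>H w \<bullet> v\<close> were constant, the functions
  \<open>\<gamma> - c * \<phi>\<close> and \<open>\<eta> - (c + \<kappa>) * \<phi>\<close> would have the subgradients \<open>G w\<close> and \<open>H w\<close>, and their difference is
  \<open>\<kappa> * \<phi> + r\<close>. The variation of the slopes produces errors of the order of \<open>\<phi> u - \<phi> w\<close>, which is again a multiple of
  the difference of the two functions. So the errors can be compensated exactly by mixing the two inequalities: with
  \<open>\<rho> = \<eta> - (c + \<kappa>) * \<phi>\<close>, each \<open>\<rho> + \<mu> * \<kappa> * \<phi>\<close> with \<open>0 \<le> \<mu> \<le> 2 / 3\<close> has a convex combination of \<open>G w\<close> and \<open>H w\<close> as a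
  subgradient. The value \<open>\<mu> = 0\<close> is admitted because \<open>H w \<bullet> v\<close> is measured from its lower bound, whereas \<open>\<mu>\<close> close to \<open>1\<close>
  could call for a weight above \<open>1\<close>. The two values \<open>0\<close> and \<open>2 / 3\<close> recover \<open>\<phi>\<close>.
\<close>
lemma dc_extension_on_narrow_cell:
  fixes \<phi> \<gamma> \<eta> :: "'a::euclidean_space \<Rightarrow> real"
  assumes S: "S \<noteq> {}"
    and g: "\<And>u w. u \<in> S \<Longrightarrow> w \<in> S \<Longrightarrow> \<gamma> w + G w \<bullet> (u - w) + (G w \<bullet> v) * (\<phi> u - \<phi> w) \<le> \<gamma> u"
    and h: "\<And>u w. u \<in> S \<Longrightarrow> w \<in> S \<Longrightarrow> \<eta> w + H w \<bullet> (u - w) + (H w \<bullet> v) * (\<phi> u - \<phi> w) \<le> \<eta> u"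
    and r: "\<And>u. u \<in> S \<Longrightarrow> \<gamma> u = \<eta> u + r"
    and Gv: "\<And>w. w \<in> S \<Longrightarrow> c \<le> G w \<bullet> v \<and> G w \<bullet> v \<le> c + \<epsilon>"
    and Hv: "\<And>w. w \<in> S \<Longrightarrow> c + \<kappa> \<le> H w \<bullet> v \<and> H w \<bullet> v \<le> c + \<kappa> + \<epsilon>"
    and \<kappa>: "\<epsilon> > 0" "3 * \<epsilon> \<le> \<kappa>"
    and L: "\<And>w. w \<in> S \<Longrightarrow> norm (G w) \<le> L" "\<And>w. w \<in> S \<Longrightarrow> norm (H w) \<le> L"
  obtains f where "dc_on UNIV f" "\<And>u. u \<in> S \<Longrightarrow> \<phi> u = f u"
proof -
  define \<rho> where "\<rho> u = \<eta> u - (c + \<kappa>) * \<phi> u" for u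
  have ext: "\<exists>F. convex_on UNIV F \<and> continuous_on UNIV F \<and> (\<forall>u\<in>S. F u = \<rho> u + \<mu> * \<kappa> * \<phi> u)"
    if \<mu>: "0 \<le> \<mu>" "\<mu> \<le> 2 / 3" for \<mu>
  proof -
    define \<theta> \<beta> where "\<theta> w = G w \<bullet> v - c" and "\<beta> w = H w \<bullet> v - (c + \<kappa>)" for w
    \<comment> \<open>The weight for which the coefficient of \<open>\<phi> u - \<phi> w\<close> in the combined subgradient inequality
      becomes exactly \<open>\<mu> * \<kappa>\<close>; it is at most \<open>1\<close> because \<open>3 * \<epsilon> \<le> \<kappa>\<close>.\<close>
    define l where "l w = (\<mu> * \<kappa> + \<beta> w) / (\<kappa> - \<theta> w + \<beta> w)" for w
    have \<theta>: "0 \<le> \<theta> w" "\<theta> w \<le> \<epsilon>" "0 \<le> \<beta> w" if "w \<in> S" for w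
      using Gv[OF that] Hv[OF that] by (auto simp: \<theta>_def \<beta>_def)
    have den: "\<kappa> - \<theta> w + \<beta> w > 0" if "w \<in> S" for w using \<theta>[OF that] \<kappa> by linarith
    have l: "0 \<le> l w" "l w \<le> 1" "l w * (\<kappa> - \<theta> w + \<beta> w) = \<mu> * \<kappa> + \<beta> w" if w: "w \<in> S" for w
    proof -
      have "\<mu> * \<kappa> \<le> 2 / 3 * \<kappa>" using \<mu> \<kappa> by (intro mult_right_mono) auto
      then have "\<mu> * \<kappa> + \<beta> w \<le> \<kappa> - \<theta> w + \<beta> w" using \<theta>[OF w] \<kappa> by linarith
      then show "l w \<le> 1" using den[OF w] by (simp add: l_def)
      show "0 \<le> l w" using den[OF w] \<theta>[OF w] \<mu> \<kappa> by (simp add: l_def)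
      show "l w * (\<kappa> - \<theta> w + \<beta> w) = \<mu> * \<kappa> + \<beta> w" using den[OF w] by (simp add: l_def)
    qed
    obtain F where "convex_on UNIV F" "continuous_on UNIV F" "\<And>u. u \<in> S \<Longrightarrow> F u = \<rho> u + \<mu> * \<kappa> * \<phi> u"
    proof (rule convex_extension_of_subgradients[OF S])
      fix w assume w: "w \<in> S"
      have "norm (l w *\<^sub>R G w + (1 - l w) *\<^sub>R H w) \<le> l w * norm (G w) + (1 - l w) * norm (H w)"
        using norm_triangle_ineq[of "l w *\<^sub>R G w" "(1 - l w) *\<^sub>R H w"] l[OF w] by simp
      also have "\<dots> \<le> l w * L + (1 - l w) * L"
        using l[OF w] L w by (intro add_mono mult_left_mono) auto
      finally show "norm (l w *\<^sub>R G w + (1 - l w) *\<^sub>R H w) \<le> L" by (simp add: algebra_simps)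
      fix u assume u: "u \<in> S"
      define \<Delta> where "\<Delta> = \<phi> u - \<phi> w"
      define X where "X = \<rho> u - \<rho> w"
      have "\<gamma> u - \<gamma> w = \<eta> u - \<eta> w" using r u w by simp
      then have "G w \<bullet> (u - w) \<le> X + (c + \<kappa>) * \<Delta> - (G w \<bullet> v) * \<Delta>"
        using g[OF u w] by (simp add: X_def \<rho>_def \<Delta>_def algebra_simps)
      then have 1: "G w \<bullet> (u - w) \<le> X + (\<kappa> - \<theta> w) * \<Delta>" by (simp add: \<theta>_def algebra_simps)
      have "H w \<bullet> (u - w) \<le> X + (c + \<kappa>) * \<Delta> - (H w \<bullet> v) * \<Delta>"
        using h[OF u w] by (simp add: X_def \<rho>_def \<Delta>_def algebra_simps)
      then have 2: "H w \<bullet> (u - w) \<le> X - \<beta> w * \<Delta>" by (simp add: \<beta>_def algebra_simps)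
      have "(l w *\<^sub>R G w + (1 - l w) *\<^sub>R H w) \<bullet> (u - w)
          = l w * (G w \<bullet> (u - w)) + (1 - l w) * (H w \<bullet> (u - w))"
        by (simp add: inner_add_left)
      also have "\<dots> \<le> l w * (X + (\<kappa> - \<theta> w) * \<Delta>) + (1 - l w) * (X - \<beta> w * \<Delta>)"
        using 1 2 l[OF w] by (intro add_mono mult_left_mono) auto
      also have "\<dots> = X + (l w * (\<kappa> - \<theta> w + \<beta> w) - \<beta> w) * \<Delta>" by (simp add: algebra_simps)
      also have "\<dots> = X + \<mu> * \<kappa> * \<Delta>" using l(3)[OF w] by simp
      finally show "\<rho> w + \<mu> * \<kappa> * \<phi> w + (l w *\<^sub>R G w + (1 - l w) *\<^sub>R H w) \<bullet> (u - w) \<le> \<rho> u + \<mu> * \<kappa> * \<phi> u"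
        by (simp add: X_def \<Delta>_def algebra_simps)
    next
      fix F assume "convex_on UNIV F" "continuous_on UNIV F" "\<And>u. u \<in> S \<Longrightarrow> F u = \<rho> u + \<mu> * \<kappa> * \<phi> u"
      then show thesis by (rule that)
    qed
    then show ?thesis by blast
  qed
  obtain A where A: "convex_on UNIV A" "continuous_on UNIV A" "\<And>u. u \<in> S \<Longrightarrow> A u = \<rho> u + 2 / 3 * \<kappa> * \<phi> u"
    using ext[of "2/3"] by auto
  obtain B where B: "convex_on UNIV B" "continuous_on UNIV B" "\<And>u. u \<in> S \<Longrightarrow> B u = \<rho> u"
    using ext[of 0] by auto
  define k where "k = 3 / (2 * \<kappa>)"
  have k: "k > 0" using \<kappa> by (simp add: k_def)
  have "dc_on UNIV (\<lambda>u. k * A u - k * B u)"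
    unfolding dc_on_def
    using A B k by (intro conjI exI[of _ "\<lambda>u. k * A u"] exI[of _ "\<lambda>u. k * B u"])
      (auto intro!: continuous_intros convex_on_cmul)
  moreover have "\<phi> u = k * A u - k * B u" if "u \<in> S" for u
    using \<kappa> by (simp add: A(3)[OF that] B(3)[OF that] k_def field_simps)
  ultimately show thesis using that by blast
qed

text \<open>
  For small \<open>t > 0\<close> every subgradient \<open>H\<close> of \<open>h\<close> at \<open>z + t v\<close> satisfies the inequality, since \<open>G\<close> bounds the increment of \<open>g\<close>
  from below and \<open>H\<close> that of \<open>h\<close> from above. Upper semicontinuity lets \<open>t\<close> tend to \<open>0\<close>.
\<close>
lemma subdiff_pair_of_descent:
  fixes d :: "'a::euclidean_space \<Rightarrow> real"
  assumes U: "open U" and g: "convex_on U g" and h: "convex_on U h"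
    and d: "\<And>x. x \<in> U \<Longrightarrow> d x = g x - h x" and z: "z \<in> U" and G: "G \<in> subdiff U g z"
    and \<delta>: "\<delta> > 0" "\<And>t. 0 < t \<Longrightarrow> t < \<delta> \<Longrightarrow> d (z + t *\<^sub>R v) \<le> d z - \<alpha> * t"
  shows "\<exists>H\<in>subdiff U h z. G \<bullet> v + \<alpha> \<le> H \<bullet> v"
proof (rule ccontr)
  assume "\<not> ?thesis"
  then have sub: "subdiff U h z \<subseteq> {H. v \<bullet> H < G \<bullet> v + \<alpha>}" by (auto simp: inner_commute)
  obtain e where e: "e > 0" "ball z e \<subseteq> U" "\<And>y. y \<in> ball z e \<Longrightarrow> subdiff U h y \<subseteq> {H. v \<bullet> H < G \<bullet> v + \<alpha>}"
    using subdiff_usc[OF U h z open_halfspace_lt sub] by blast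
  define t where "t = min (\<delta> / 2) (e / (2 * (norm v + 1)))"
  have t: "0 < t" "t < \<delta>" using \<delta>(1) e(1) by (auto simp: t_def intro!: divide_pos_pos add_nonneg_pos)
  have "t * norm v \<le> t * (norm v + 1)" using t by simp
  also have "\<dots> \<le> e / (2 * (norm v + 1)) * (norm v + 1)" by (intro mult_right_mono) (auto simp: t_def)
  also have "\<dots> = e / 2" by (simp add: field_simps add_nonneg_eq_0_iff)
  finally have y: "z + t *\<^sub>R v \<in> ball z e" using e(1) t by (simp add: dist_norm)
  then have yU: "z + t *\<^sub>R v \<in> U" using e(2) by blast
  obtain H where H: "H \<in> subdiff U h (z + t *\<^sub>R v)" using subdiff_nonempty[OF U h yU] by blast
  have "h (z + t *\<^sub>R v) + H \<bullet> (z - (z + t *\<^sub>R v)) \<le> h z" using H z by (rule subdiffD)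
  moreover have "g z + G \<bullet> (z + t *\<^sub>R v - z) \<le> g (z + t *\<^sub>R v)" using G yU by (rule subdiffD)
  moreover have "d (z + t *\<^sub>R v) \<le> d z - \<alpha> * t" using \<delta>(2) t by blast
  ultimately have "t * (G \<bullet> v + \<alpha>) \<le> t * (H \<bullet> v)" using d[OF z] d[OF yU] by (simp add: algebra_simps)
  then have "G \<bullet> v + \<alpha> \<le> H \<bullet> v" using t(1) by simp
  then show False using e(3)[OF y] H by (auto simp: inner_commute)
qed

text \<open>
  The slopes of \<open>g\<close> and \<open>h\<close> along \<open>v\<close> may vary a lot near a point, but they are bounded. So finitely many cells, of a
  width small compared with the rate of descent, suffice, and \<open>\<phi>\<close> is a continuous selection from the
  extensions found on the cells. The cells are arbitrary sets, and this is harmless because a selection need not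
  respect any structure of the sets on which it agrees with the given functions.
\<close>
lemma level_graph_dc:
  fixes d :: "'a::euclidean_space \<Rightarrow> real"
  assumes U: "open U" and g: "convex_on U g" and h: "convex_on U h"
    and d: "\<And>x. x \<in> U \<Longrightarrow> d x = g x - h x"
    and B: "open B" "B \<subseteq> U"
    and L: "\<And>z x. z \<in> B \<Longrightarrow> x \<in> subdiff U g z \<Longrightarrow> norm x \<le> L" "\<And>z x. z \<in> B \<Longrightarrow> x \<in> subdiff U h z \<Longrightarrow> norm x \<le> L"
    and v: "norm v = 1" and \<alpha>: "\<alpha> > 0"
    and descent: "\<And>z t. z \<in> B \<Longrightarrow> z + t *\<^sub>R v \<in> B \<Longrightarrow> 0 < t \<Longrightarrow> d (z + t *\<^sub>R v) \<le> d z - \<alpha> * t"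
    and D: "convex D" "D \<noteq> {}" and \<phi>_cont: "continuous_on D \<phi>"
    and graph: "\<And>u. u \<in> D \<Longrightarrow> u + \<phi> u *\<^sub>R v \<in> B" "\<And>u. u \<in> D \<Longrightarrow> d (u + \<phi> u *\<^sub>R v) = r"
  shows "dc_on D \<phi>"
proof -
  define \<Phi> where "\<Phi> u = u + \<phi> u *\<^sub>R v" for u
  have \<Phi>: "\<Phi> u \<in> B" "\<Phi> u \<in> U" "d (\<Phi> u) = r" if "u \<in> D" for u
    using graph that B(2) by (auto simp: \<Phi>_def)
  have "\<exists>G H. G \<in> subdiff U g (\<Phi> u) \<and> H \<in> subdiff U h (\<Phi> u) \<and> G \<bullet> v + \<alpha> \<le> H \<bullet> v" if u: "u \<in> D" for u
  proof -
    obtain G where G: "G \<in> subdiff U g (\<Phi> u)" using subdiff_nonempty[OF U g \<Phi>(2)[OF u]] by blast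
    obtain e where e: "e > 0" "ball (\<Phi> u) e \<subseteq> B" using openE[OF B(1) \<Phi>(1)[OF u]] by blast
    have "\<exists>H\<in>subdiff U h (\<Phi> u). G \<bullet> v + \<alpha> \<le> H \<bullet> v"
    proof (rule subdiff_pair_of_descent[OF U g h d \<Phi>(2)[OF u] G e(1)])
      fix t assume t: "0 < t" "t < e"
      then have "\<Phi> u + t *\<^sub>R v \<in> ball (\<Phi> u) e" using v by (simp add: dist_norm)
      then show "d (\<Phi> u + t *\<^sub>R v) \<le> d (\<Phi> u) - \<alpha> * t" using e(2) \<Phi>(1)[OF u] t by (intro descent) auto
    qed
    then show ?thesis using G by blast
  qed
  then obtain G H where GH: "\<And>u. u \<in> D \<Longrightarrow> G u \<in> subdiff U g (\<Phi> u)" "\<And>u. u \<in> D \<Longrightarrow> H u \<in> subdiff U h (\<Phi> u)"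
    "\<And>u. u \<in> D \<Longrightarrow> G u \<bullet> v + \<alpha> \<le> H u \<bullet> v" by metis
  have GH_L: "norm (G u) \<le> L" "norm (H u) \<le> L" if "u \<in> D" for u using L GH \<Phi>(1) that by blast+
  \<comment> \<open>With this width \<open>\<kappa> \<ge> \<alpha> - \<epsilon> = 3 * \<epsilon>\<close> on every cell.\<close>
  define \<epsilon> where "\<epsilon> = \<alpha> / 4"
  have \<epsilon>: "\<epsilon> > 0" using \<alpha> by (simp add: \<epsilon>_def)
  define key where "key u = (\<lfloor>(G u \<bullet> v) / \<epsilon>\<rfloor>, \<lfloor>(H u \<bullet> v) / \<epsilon>\<rfloor>)" for u
  have inner_le: "\<bar>X \<bullet> v\<bar> \<le> L" if "norm X \<le> L" for X
    using Cauchy_Schwarz_ineq2[of X v] v that by simp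
  have floor_in: "\<lfloor>x / \<epsilon>\<rfloor> \<in> {\<lfloor>- L / \<epsilon>\<rfloor>..\<lfloor>L / \<epsilon>\<rfloor>}" if "\<bar>x\<bar> \<le> L" for x
    using that \<epsilon> unfolding atLeastAtMost_iff by (intro conjI floor_mono divide_right_mono) auto
  have fin: "finite (key ` D)"
  proof (rule finite_subset)
    show "key ` D \<subseteq> {\<lfloor>- L / \<epsilon>\<rfloor>..\<lfloor>L / \<epsilon>\<rfloor>} \<times> {\<lfloor>- L / \<epsilon>\<rfloor>..\<lfloor>L / \<epsilon>\<rfloor>}"
      unfolding key_def using floor_in[OF inner_le[OF GH_L(1)]] floor_in[OF inner_le[OF GH_L(2)]] by blast
  qed simp
  have "\<exists>f. dc_on D f \<and> (\<forall>u\<in>D. key u = k \<longrightarrow> \<phi> u = f u)" if k: "k \<in> key ` D" for k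
  proof -
    obtain p q where pq: "k = (p, q)" by (cases k)
    define S where "S = {u \<in> D. key u = k}"
    have "S \<noteq> {}" using k by (auto simp: S_def)
    then obtain u1 where u1: "u1 \<in> S" by blast
    have floors: "of_int p * \<epsilon> \<le> G u \<bullet> v \<and> G u \<bullet> v \<le> of_int p * \<epsilon> + \<epsilon>"
      "of_int q * \<epsilon> \<le> H u \<bullet> v \<and> H u \<bullet> v \<le> of_int q * \<epsilon> + \<epsilon>" if "u \<in> S" for u
    proof -
      have "\<lfloor>(G u \<bullet> v) / \<epsilon>\<rfloor> = p" "\<lfloor>(H u \<bullet> v) / \<epsilon>\<rfloor> = q" using that by (auto simp: S_def key_def pq)
      then have "of_int p \<le> (G u \<bullet> v) / \<epsilon>" "(G u \<bullet> v) / \<epsilon> \<le> of_int p + 1"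
        "of_int q \<le> (H u \<bullet> v) / \<epsilon>" "(H u \<bullet> v) / \<epsilon> \<le> of_int q + 1" by linarith+
      then show "of_int p * \<epsilon> \<le> G u \<bullet> v \<and> G u \<bullet> v \<le> of_int p * \<epsilon> + \<epsilon>"
        "of_int q * \<epsilon> \<le> H u \<bullet> v \<and> H u \<bullet> v \<le> of_int q * \<epsilon> + \<epsilon>"
        using \<epsilon> by (auto simp: field_simps)
    qed
    define \<kappa> where "\<kappa> = of_int q * \<epsilon> - of_int p * \<epsilon>"
    have \<kappa>: "3 * \<epsilon> \<le> \<kappa>"
      using floors[OF u1] GH(3)[of u1] u1 unfolding \<kappa>_def S_def \<epsilon>_def by (simp add: field_simps)
    obtain f where f: "dc_on UNIV f" "\<And>u. u \<in> S \<Longrightarrow> \<phi> u = f u"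
    proof (rule dc_extension_on_narrow_cell[OF \<open>S \<noteq> {}\<close>, of "\<lambda>u. g (\<Phi> u)" G v \<phi> "\<lambda>u. h (\<Phi> u)" H r
          "of_int p * \<epsilon>" \<epsilon> \<kappa> L])
      fix u w assume uw: "u \<in> S" "w \<in> S"
      then have uwD: "u \<in> D" "w \<in> D" by (auto simp: S_def)
      have diff: "X \<bullet> (\<Phi> u - \<Phi> w) = X \<bullet> (u - w) + (X \<bullet> v) * (\<phi> u - \<phi> w)" for X
        by (simp add: \<Phi>_def inner_add_right inner_diff_right algebra_simps)
      show "g (\<Phi> w) + G w \<bullet> (u - w) + G w \<bullet> v * (\<phi> u - \<phi> w) \<le> g (\<Phi> u)"
        using subdiffD[OF GH(1)[OF uwD(2)] \<Phi>(2)[OF uwD(1)]] unfolding diff by simp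
      show "h (\<Phi> w) + H w \<bullet> (u - w) + H w \<bullet> v * (\<phi> u - \<phi> w) \<le> h (\<Phi> u)"
        using subdiffD[OF GH(2)[OF uwD(2)] \<Phi>(2)[OF uwD(1)]] unfolding diff by simp
    next
      fix u assume "u \<in> S"
      then have u: "u \<in> D" by (simp add: S_def)
      show "g (\<Phi> u) = h (\<Phi> u) + r" using d[OF \<Phi>(2)[OF u]] \<Phi>(3)[OF u] by simp
      show "norm (G u) \<le> L" "norm (H u) \<le> L" using GH_L[OF u] .
    next
      fix u assume u: "u \<in> S"
      show "of_int p * \<epsilon> \<le> G u \<bullet> v \<and> G u \<bullet> v \<le> of_int p * \<epsilon> + \<epsilon>" using floors(1)[OF u] .
      show "of_int p * \<epsilon> + \<kappa> \<le> H u \<bullet> v \<and> H u \<bullet> v \<le> of_int p * \<epsilon> + \<kappa> + \<epsilon>"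
        using floors(2)[OF u] by (simp add: \<kappa>_def)
    next
      fix f assume "dc_on UNIV f" "\<And>u. u \<in> S \<Longrightarrow> \<phi> u = f u"
      then show thesis by (rule that)
    qed (rule \<epsilon> \<kappa>)+
    have "dc_on D f"
      using f(1) D unfolding dc_on_def by (metis continuous_on_subset convex_on_subset subset_UNIV UNIV_I)
    then show ?thesis using f(2) by (auto simp: S_def)
  qed
  then obtain F where F: "\<And>k. k \<in> key ` D \<Longrightarrow> dc_on D (F k)"
    "\<And>k u. k \<in> key ` D \<Longrightarrow> u \<in> D \<Longrightarrow> key u = k \<Longrightarrow> \<phi> u = F k u" by metis
  show ?thesis
  proof (rule dc_on_continuous_selection[OF D fin \<phi>_cont F(1)])
    show "\<exists>j\<in>key ` D. \<phi> x = F j x" if "x \<in> D" for x using F(2)[of "key x" x] that by blast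
  qed
qed

text \<open>
  Along each line in direction \<open>v\<close> the function \<open>d\<close> decreases strictly. The base is taken so small that the increment
  of \<open>d\<close> along it stays below the decrease \<open>\<alpha> * \<sigma>\<close> along \<open>v\<close>; then the intermediate value theorem provides a
  unique height, and comparing the two rates gives the Lipschitz constant.
\<close>
lemma level_set_graph:
  fixes d :: "'a::euclidean_space \<Rightarrow> real"
  assumes v: "norm v = 1" and \<alpha>: "\<alpha> > 0" and \<rho>0: "\<rho>0 > 0" and K: "K \<ge> 0"
    and lip: "\<And>y z. y \<in> ball x \<rho>0 \<Longrightarrow> z \<in> ball x \<rho>0 \<Longrightarrow> \<bar>d y - d z\<bar> \<le> K * norm (y - z)"
    and descent: "\<And>z t. z \<in> ball x \<rho>0 \<Longrightarrow> z + t *\<^sub>R v \<in> ball x \<rho>0 \<Longrightarrow> 0 < t \<Longrightarrow> d (z + t *\<^sub>R v) \<le> d z - \<alpha> * t"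
  obtains D \<phi> W where "openin (top_of_set {u. v \<bullet> u = 0}) D" "convex D" "D \<noteq> {}"
    "open W" "x \<in> W" "W \<subseteq> ball x \<rho>0"
    "\<And>u. u \<in> D \<Longrightarrow> u + \<phi> u *\<^sub>R v \<in> ball x \<rho>0" "\<And>u. u \<in> D \<Longrightarrow> d (u + \<phi> u *\<^sub>R v) = d x"
    "\<And>u w. u \<in> D \<Longrightarrow> w \<in> D \<Longrightarrow> \<bar>\<phi> u - \<phi> w\<bar> \<le> K / \<alpha> * norm (u - w)"
    "{y \<in> W. d y = d x} = {u + \<phi> u *\<^sub>R v |u. u \<in> D}"
proof -
  have vv: "v \<bullet> v = 1" using v by (simp add: norm_eq_1)
  define s0 where "s0 = x \<bullet> v"
  define u0 where "u0 = x - s0 *\<^sub>R v"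
  define \<sigma> where "\<sigma> = \<rho>0 / 4"
  define \<rho> where "\<rho> = min (\<rho>0 / 4) (\<alpha> * \<sigma> / (K + 1))"
  have \<sigma>: "\<sigma> > 0" using \<rho>0 by (simp add: \<sigma>_def)
  have "\<rho> > 0" using \<rho>0 \<alpha> K \<sigma> by (simp add: \<rho>_def)
  moreover have "\<rho> \<le> \<rho>0 / 4" unfolding \<rho>_def by (rule min.cobounded1)
  ultimately have \<rho>: "\<rho> > 0" "\<rho> \<le> \<rho>0 / 4" .
  have "K * \<rho> \<le> K * (\<alpha> * \<sigma> / (K + 1))" using K by (intro mult_left_mono) (auto simp: \<rho>_def)
  also have "\<dots> < \<alpha> * \<sigma>" using \<alpha> \<sigma> K by (simp add: field_simps)
  finally have K\<rho>: "K * \<rho> < \<alpha> * \<sigma>" .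
  define D where "D = {u. v \<bullet> u = 0} \<inter> ball u0 \<rho>"
  have x_eq: "x = u0 + s0 *\<^sub>R v" by (simp add: u0_def)
  have u0_perp: "v \<bullet> u0 = 0" by (simp add: u0_def s0_def inner_diff_right vv inner_commute)
  have in_ball: "u + s *\<^sub>R v \<in> ball x \<rho>0" if "u \<in> ball u0 \<rho>" "\<bar>s - s0\<bar> \<le> \<sigma>" for u s
  proof -
    have "norm ((u0 - u) + (s0 - s) *\<^sub>R v) \<le> norm (u0 - u) + \<bar>s0 - s\<bar>"
      using norm_triangle_ineq[of "u0 - u" "(s0 - s) *\<^sub>R v"] v by simp
    also have "\<dots> < \<rho>0" using that \<rho>(2) \<sigma> unfolding mem_ball dist_norm \<sigma>_def by linarith
    finally show ?thesis by (simp add: x_eq dist_norm algebra_simps)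
  qed
  have decr: "d (u + s' *\<^sub>R v) \<le> d (u + s *\<^sub>R v) - \<alpha> * (s' - s)"
    if "u \<in> ball u0 \<rho>" "\<bar>s - s0\<bar> \<le> \<sigma>" "\<bar>s' - s0\<bar> \<le> \<sigma>" "s < s'" for u s s'
    using descent[of "u + s *\<^sub>R v" "s' - s"] in_ball[OF that(1,2)] in_ball[OF that(1,3)] that(4)
    by (simp add: algebra_simps)
  have near: "\<bar>d (u + s *\<^sub>R v) - d (u0 + s *\<^sub>R v)\<bar> < \<alpha> * \<sigma>" if "u \<in> ball u0 \<rho>" "\<bar>s - s0\<bar> \<le> \<sigma>" for u s
  proof -
    have "u0 \<in> ball u0 \<rho>" using \<rho> by simp
    then have "\<bar>d (u + s *\<^sub>R v) - d (u0 + s *\<^sub>R v)\<bar> \<le> K * norm ((u + s *\<^sub>R v) - (u0 + s *\<^sub>R v))"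
      using in_ball that by (intro lip) auto
    also have "\<dots> \<le> K * \<rho>" using that K by (intro mult_left_mono) (auto simp: dist_norm norm_minus_commute)
    finally show ?thesis using K\<rho> by simp
  qed
  have "\<exists>s. \<bar>s - s0\<bar> < \<sigma> \<and> d (u + s *\<^sub>R v) = d x" if u: "u \<in> D" for u
  proof -
    have ub: "u \<in> ball u0 \<rho>" using u by (simp add: D_def)
    have u0b: "u0 \<in> ball u0 \<rho>" using \<rho> by simp
    have lo: "d (u + (s0 - \<sigma>) *\<^sub>R v) > d x"
      using decr[OF u0b, of "s0 - \<sigma>" s0] near[OF ub, of "s0 - \<sigma>"] \<sigma> by (simp add: x_eq[symmetric] abs_less_iff)
    have hi: "d (u + (s0 + \<sigma>) *\<^sub>R v) < d x"
      using decr[OF u0b, of s0 "s0 + \<sigma>"] near[OF ub, of "s0 + \<sigma>"] \<sigma> by (simp add: x_eq[symmetric] abs_less_iff)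
    have d_cont: "continuous_on (ball x \<rho>0) d"
    proof (rule lipschitz_on_continuous_on[where L = K])
      show "K-lipschitz_on (ball x \<rho>0) d"
        using lip K by (intro lipschitz_onI) (auto simp: dist_norm)
    qed
    have "continuous_on {s0 - \<sigma>..s0 + \<sigma>} (\<lambda>s. d (u + s *\<^sub>R v))"
      using in_ball[OF ub]
      by (intro continuous_on_compose2[OF d_cont] continuous_intros) (auto simp: abs_le_iff)
    then obtain s where s: "s0 - \<sigma> \<le> s" "s \<le> s0 + \<sigma>" "d (u + s *\<^sub>R v) = d x"
      using IVT2'[of "\<lambda>s. d (u + s *\<^sub>R v)" "s0 + \<sigma>" "d x" "s0 - \<sigma>"] lo hi \<sigma> by auto
    moreover have "s \<noteq> s0 - \<sigma>" "s \<noteq> s0 + \<sigma>" using s lo hi by auto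
    ultimately have "\<bar>s - s0\<bar> < \<sigma>" by linarith
    then show ?thesis using s(3) by blast
  qed
  then obtain \<phi> where \<phi>: "\<And>u. u \<in> D \<Longrightarrow> \<bar>\<phi> u - s0\<bar> < \<sigma>" "\<And>u. u \<in> D \<Longrightarrow> d (u + \<phi> u *\<^sub>R v) = d x"
    by metis
  have uniq: "s = s'" if "u \<in> ball u0 \<rho>" "\<bar>s - s0\<bar> < \<sigma>" "\<bar>s' - s0\<bar> < \<sigma>" "d (u + s *\<^sub>R v) = d (u + s' *\<^sub>R v)" for u s s'
  proof (rule ccontr)
    assume "s \<noteq> s'"
    then consider "s < s'" | "s' < s" by linarith
    then show False
    proof cases
      case 1
      have "\<alpha> * (s' - s) > 0" using \<alpha> 1 by simp
      then show False using decr[OF that(1) _ _ 1] that by simp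
    next
      case 2
      have "\<alpha> * (s - s') > 0" using \<alpha> 2 by simp
      then show False using decr[OF that(1) _ _ 2] that by simp
    qed
  qed
  define W where "W = {y. norm (u0 - (y - (y \<bullet> v) *\<^sub>R v)) < \<rho> \<and> \<bar>y \<bullet> v - s0\<bar> < \<sigma>}"
  have W_decomp: "y - (y \<bullet> v) *\<^sub>R v \<in> D" "\<bar>y \<bullet> v - s0\<bar> < \<sigma>" if "y \<in> W" for y
    using that by (auto simp: W_def D_def dist_norm inner_diff_right vv inner_commute)
  show thesis
  proof
    show "openin (top_of_set {u. v \<bullet> u = 0}) D" unfolding D_def by (rule openin_open_Int) simp
    show "convex D" unfolding D_def by (intro convex_Int convex_hyperplane convex_ball)
    show "D \<noteq> {}" using u0_perp \<rho> by (auto simp: D_def)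
    show "open W" unfolding W_def by (intro open_Collect_conj open_Collect_less continuous_intros)
    have "x \<bullet> v = s0" by (simp add: s0_def)
    then show "x \<in> W" using \<rho> \<sigma> by (simp add: W_def u0_def)
    show "W \<subseteq> ball x \<rho>0"
    proof
      fix y assume y: "y \<in> W"
      then have "(y - (y \<bullet> v) *\<^sub>R v) + (y \<bullet> v) *\<^sub>R v \<in> ball x \<rho>0"
        using W_decomp[OF y] by (intro in_ball) (auto simp: D_def)
      then show "y \<in> ball x \<rho>0" by simp
    qed
    show gb: "u + \<phi> u *\<^sub>R v \<in> ball x \<rho>0" if "u \<in> D" for u
      using in_ball \<phi>(1)[OF that] that by (auto simp: D_def)
    show "d (u + \<phi> u *\<^sub>R v) = d x" if "u \<in> D" for u using \<phi>(2)[OF that] .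
    have one: "\<alpha> * (\<phi> u - \<phi> w) \<le> K * norm (u - w)" if u: "u \<in> D" and w: "w \<in> D" and lt: "\<phi> w < \<phi> u" for u w
    proof -
      have wb: "w \<in> ball u0 \<rho>" using w by (simp add: D_def)
      have le: "\<bar>\<phi> u - s0\<bar> \<le> \<sigma>" "\<bar>\<phi> w - s0\<bar> \<le> \<sigma>" using \<phi>(1)[OF u] \<phi>(1)[OF w] by simp_all
      have "d (w + \<phi> u *\<^sub>R v) \<le> d (w + \<phi> w *\<^sub>R v) - \<alpha> * (\<phi> u - \<phi> w)"
        using decr[OF wb le(2) le(1) lt] .
      moreover have "\<bar>d (w + \<phi> u *\<^sub>R v) - d (u + \<phi> u *\<^sub>R v)\<bar> \<le> K * norm ((w + \<phi> u *\<^sub>R v) - (u + \<phi> u *\<^sub>R v))"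
        using in_ball[OF wb le(1)] gb[OF u] by (rule lip)
      ultimately show ?thesis using \<phi>(2)[OF u] \<phi>(2)[OF w] by (simp add: norm_minus_commute abs_le_iff)
    qed
    show "\<bar>\<phi> u - \<phi> w\<bar> \<le> K / \<alpha> * norm (u - w)" if u: "u \<in> D" and w: "w \<in> D" for u w
    proof -
      have "\<alpha> * \<bar>\<phi> u - \<phi> w\<bar> \<le> K * norm (u - w)"
      proof (cases "\<phi> u" "\<phi> w" rule: linorder_cases)
        case less
        then show ?thesis using one[OF w u] by (simp add: norm_minus_commute)
      next
        case equal
        then show ?thesis using K by simp
      next
        case greater
        then show ?thesis using one[OF u w] by simp
      qed
      then show ?thesis using \<alpha> by (simp add: field_simps)
    qed
    show "{y \<in> W. d y = d x} = {u + \<phi> u *\<^sub>R v |u. u \<in> D}"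
    proof (intro equalityI subsetI)
      fix y assume "y \<in> {y \<in> W. d y = d x}"
      then have y: "y \<in> W" "d y = d x" by auto
      define u where "u = y - (y \<bullet> v) *\<^sub>R v"
      have u: "u \<in> D" using W_decomp(1)[OF y(1)] by (simp add: u_def)
      have "\<phi> u = y \<bullet> v"
      proof (rule uniq)
        show "u \<in> ball u0 \<rho>" using u by (simp add: D_def)
        have "u + (y \<bullet> v) *\<^sub>R v = y" by (simp add: u_def)
        then show "d (u + \<phi> u *\<^sub>R v) = d (u + (y \<bullet> v) *\<^sub>R v)" using \<phi>(2)[OF u] y(2) by simp
      qed (rule \<phi>(1)[OF u] W_decomp(2)[OF y(1)])+
      then have "y = u + \<phi> u *\<^sub>R v" by (simp add: u_def)
      then show "y \<in> {u + \<phi> u *\<^sub>R v |u. u \<in> D}" using u by blast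
    next
      fix y assume "y \<in> {u + \<phi> u *\<^sub>R v |u. u \<in> D}"
      then obtain u where u: "u \<in> D" "y = u + \<phi> u *\<^sub>R v" by blast
      have "u \<bullet> v = 0" using u(1) by (simp add: D_def inner_commute)
      then have "y \<bullet> v = \<phi> u" by (simp add: u(2) inner_add_left vv)
      then have "y \<in> W" using u \<phi>(1)[OF u(1)] by (simp add: W_def D_def dist_norm)
      then show "y \<in> {y \<in> W. d y = d x}" using \<phi>(2)[OF u(1)] u(2) by simp
    qed
  qed
qed

section \<open>Semiconcave functions\<close>
lemma norm_convex_combination_power2:
  fixes a b :: "'a::real_inner"
  shows "(norm ((1 - t) *\<^sub>R a + t *\<^sub>R b))\<^sup>2 = (1 - t) * (norm a)\<^sup>2 + t * (norm b)\<^sup>2 - t * (1 - t) * (norm (a - b))\<^sup>2"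
  unfolding power2_norm_eq_inner
  by (simp add: inner_add_left inner_add_right inner_diff_left inner_diff_right inner_commute algebra_simps)

lemma semiconcave_lower_bound:
  fixes d :: "'a::real_inner \<Rightarrow> real"
  assumes conc: "concave_on B (\<lambda>y. d y - c / 2 * (norm y)\<^sup>2)"
    and ab: "a \<in> B" "b \<in> B" and t: "0 \<le> t" "t \<le> 1"
  shows "d ((1 - t) *\<^sub>R a + t *\<^sub>R b) \<ge> (1 - t) * d a + t * d b - \<bar>c\<bar> / 2 * (t * (1 - t) * (norm (a - b))\<^sup>2)"
proof -
  define k where "k = c / 2"
  have "(1 - t) * (d a - c / 2 * (norm a)\<^sup>2) + t * (d b - c / 2 * (norm b)\<^sup>2)
      \<le> d ((1 - t) *\<^sub>R a + t *\<^sub>R b) - c / 2 * (norm ((1 - t) *\<^sub>R a + t *\<^sub>R b))\<^sup>2"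
    using concave_onD[OF conc t ab] .
  then have "(1 - t) * d a + t * d b - c / 2 * (t * (1 - t) * (norm (a - b))\<^sup>2) \<le> d ((1 - t) *\<^sub>R a + t *\<^sub>R b)"
    unfolding norm_convex_combination_power2 k_def[symmetric] by (simp add: algebra_simps)
  moreover have "c / 2 * (t * (1 - t) * (norm (a - b))\<^sup>2) \<le> \<bar>c\<bar> / 2 * (t * (1 - t) * (norm (a - b))\<^sup>2)"
    using t by (intro mult_right_mono) auto
  ultimately show ?thesis by linarith
qed

text \<open>
  A point of a chord lying above the graph by \<open>gap\<close> has \<open>d \<le> r - \<alpha> * gap\<close>, while semiconcavity of \<open>d\<close> gives
  a lower bound for \<open>d\<close> there that differs from \<open>r\<close> by a multiple of the squared length of the chord.
\<close>
lemma level_graph_semiconcave: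
  fixes d :: "'a::euclidean_space \<Rightarrow> real"
  assumes conc: "concave_on B (\<lambda>y. d y - c / 2 * (norm y)\<^sup>2)"
    and v: "norm v = 1" and \<alpha>: "\<alpha> > 0"
    and descent: "\<And>z t. z \<in> B \<Longrightarrow> z + t *\<^sub>R v \<in> B \<Longrightarrow> 0 < t \<Longrightarrow> d (z + t *\<^sub>R v) \<le> d z - \<alpha> * t"
    and D: "convex D" and M: "M \<ge> 0"
    and lip: "\<And>u w. u \<in> D \<Longrightarrow> w \<in> D \<Longrightarrow> \<bar>\<phi> u - \<phi> w\<bar> \<le> M * norm (u - w)"
    and graph: "\<And>u. u \<in> D \<Longrightarrow> u + \<phi> u *\<^sub>R v \<in> B" "\<And>u. u \<in> D \<Longrightarrow> d (u + \<phi> u *\<^sub>R v) = r"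
  shows "semiconcave_on D \<phi>"
proof -
  define C where "C = \<bar>c\<bar> * (1 + M)\<^sup>2 / \<alpha>"
  have C: "C \<ge> 0" using \<alpha> by (simp add: C_def)
  have key: "(1 - t) * \<phi> u + t * \<phi> w - C / 2 * (t * (1 - t) * (norm (u - w))\<^sup>2) \<le> \<phi> ((1 - t) *\<^sub>R u + t *\<^sub>R w)"
    if u: "u \<in> D" and w: "w \<in> D" and t: "0 \<le> t" "t \<le> 1" for t u w
  proof -
    define p where "p = (1 - t) *\<^sub>R u + t *\<^sub>R w"
    define gap where "gap = (1 - t) * \<phi> u + t * \<phi> w - \<phi> p"
    define a b where "a = u + \<phi> u *\<^sub>R v" and "b = w + \<phi> w *\<^sub>R v"
    have ab: "a \<in> B" "b \<in> B" "d a = r" "d b = r" using graph u w by (auto simp: a_def b_def)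
    have p: "p \<in> D" using D u w t by (auto simp: p_def convex_alt)
    have z: "(1 - t) *\<^sub>R a + t *\<^sub>R b = (p + \<phi> p *\<^sub>R v) + gap *\<^sub>R v"
      by (simp add: a_def b_def p_def gap_def algebra_simps)
    have zB: "(1 - t) *\<^sub>R a + t *\<^sub>R b \<in> B"
      using concave_on_imp_convex[OF conc] ab t by (auto simp: convex_alt)
    have nonneg: "0 \<le> t * (1 - t) * (norm (u - w))\<^sup>2" using t by simp
    have "gap \<le> C / 2 * (t * (1 - t) * (norm (u - w))\<^sup>2)"
    proof (cases "gap > 0")
      case False
      moreover have "0 \<le> C / 2 * (t * (1 - t) * (norm (u - w))\<^sup>2)" by (rule mult_nonneg_nonneg[OF _ nonneg]) (use C in simp)
      ultimately show ?thesis by linarith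
    next
      case True
      have "a - b = (u - w) + (\<phi> u - \<phi> w) *\<^sub>R v" by (simp add: a_def b_def algebra_simps)
      then have "norm (a - b) \<le> norm (u - w) + \<bar>\<phi> u - \<phi> w\<bar>"
        using norm_triangle_ineq[of "u - w" "(\<phi> u - \<phi> w) *\<^sub>R v"] v by simp
      also have "\<dots> \<le> (1 + M) * norm (u - w)" using lip[OF u w] by (simp add: algebra_simps)
      finally have "(norm (a - b))\<^sup>2 \<le> ((1 + M) * norm (u - w))\<^sup>2" by (intro power_mono) auto
      then have "t * (1 - t) * (norm (a - b))\<^sup>2 \<le> t * (1 - t) * ((1 + M) * norm (u - w))\<^sup>2"
        using t by (intro mult_left_mono) auto
      then have "\<bar>c\<bar> / 2 * (t * (1 - t) * (norm (a - b))\<^sup>2) \<le> \<bar>c\<bar> / 2 * (t * (1 - t) * ((1 + M) * norm (u - w))\<^sup>2)"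
        by (rule mult_left_mono) simp
      also have "\<dots> = \<alpha> * (C / 2 * (t * (1 - t) * (norm (u - w))\<^sup>2))"
        using \<alpha> by (simp add: C_def power_mult_distrib)
      finally have le: "\<bar>c\<bar> / 2 * (t * (1 - t) * (norm (a - b))\<^sup>2) \<le> \<alpha> * (C / 2 * (t * (1 - t) * (norm (u - w))\<^sup>2))" .
      have "(1 - t) * r + t * r - \<bar>c\<bar> / 2 * (t * (1 - t) * (norm (a - b))\<^sup>2) \<le> d ((1 - t) *\<^sub>R a + t *\<^sub>R b)"
        using semiconcave_lower_bound[OF conc ab(1,2) t] ab(3,4) by simp
      also have "\<dots> \<le> d (p + \<phi> p *\<^sub>R v) - \<alpha> * gap"
        using descent[of "p + \<phi> p *\<^sub>R v" gap] graph(1)[OF p] zB True unfolding z by blast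
      also have "d (p + \<phi> p *\<^sub>R v) = r" using graph(2)[OF p] .
      finally have "\<alpha> * gap \<le> \<bar>c\<bar> / 2 * (t * (1 - t) * (norm (a - b))\<^sup>2)" by (simp add: algebra_simps)
      with le have "\<alpha> * gap \<le> \<alpha> * (C / 2 * (t * (1 - t) * (norm (u - w))\<^sup>2))" by linarith
      then show ?thesis using \<alpha> by simp
    qed
    then show ?thesis unfolding gap_def p_def[symmetric] by linarith
  qed
  have "concave_on D (\<lambda>u. \<phi> u - C / 2 * (norm u)\<^sup>2)"
    unfolding concave_on_def
  proof (rule convex_onI[OF _ D])
    fix t :: real and u w assume "0 < t" "t < 1" and uw: "u \<in> D" "w \<in> D"
    then have t: "0 \<le> t" "t \<le> 1" by simp_all
    define k where "k = C / 2"
    show "- (\<phi> ((1 - t) *\<^sub>R u + t *\<^sub>R w) - C / 2 * (norm ((1 - t) *\<^sub>R u + t *\<^sub>R w))\<^sup>2)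
      \<le> (1 - t) * - (\<phi> u - C / 2 * (norm u)\<^sup>2) + t * - (\<phi> w - C / 2 * (norm w)\<^sup>2)"
      using key[OF uw t] unfolding norm_convex_combination_power2 k_def[symmetric] by (simp add: algebra_simps)
  qed
  then show ?thesis unfolding semiconcave_on_def by blast
qed

lemma reach_pos_interior:
  fixes A :: "'a::metric_space set"
  assumes "\<epsilon> > 0" "ball p \<epsilon> \<subseteq> A"
  shows "reach A p > 0"
proof -
  have "\<exists>!a. a \<in> A \<and> (\<forall>b\<in>A. dist q a \<le> dist q b)" if "dist p q < \<epsilon>" for q
  proof (rule ex1I[of _ q])
    show "q \<in> A \<and> (\<forall>b\<in>A. dist q q \<le> dist q b)" using assms(2) that by auto
    then show "a = q" if "a \<in> A \<and> (\<forall>b\<in>A. dist q a \<le> dist q b)" for a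
      using that by (metis dist_self dist_le_zero_iff)
  qed
  then have "ennreal \<epsilon> \<le> reach A p" unfolding reach_def using assms(1) by (intro Sup_upper) blast
  then show ?thesis using assms(1) by (metis ennreal_less_zero_iff order_less_le_trans)
qed

text \<open>
  Suppose \<open>q\<close> has two nearest points \<open>a\<close> and \<open>b\<close> at distance \<open>R\<close>, and let \<open>\<delta>\<close> be the square of \<open>norm (a - b)\<close>. At the midpoint
  \<open>m\<close>, the value of \<open>d\<close> is at least \<open>r - \<bar>c\<bar> * \<delta> / 8\<close>, so \<open>m - t v\<close> belongs to the set for a \<open>t\<close> proportional to \<open>\<delta> / \<alpha>\<close>.
  On the other hand \<open>m\<close> is closer to \<open>q\<close> than \<open>R\<close> by at least \<open>\<delta> / (8 * R)\<close>, which exceeds \<open>t\<close> when \<open>R\<close> is small.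
\<close>
lemma reach_pos_superlevel:
  fixes d :: "'a::euclidean_space \<Rightarrow> real"
  assumes v: "norm v = 1" and \<alpha>: "\<alpha> > 0" and \<rho>: "\<rho> > 0" "ball x \<rho> \<subseteq> G"
    and cont: "continuous_on (ball x \<rho>) d"
    and conc: "concave_on (ball x \<rho>) (\<lambda>y. d y - c / 2 * (norm y)\<^sup>2)"
    and descent: "\<And>z t. z \<in> ball x \<rho> \<Longrightarrow> z + t *\<^sub>R v \<in> ball x \<rho> \<Longrightarrow> 0 < t \<Longrightarrow> d (z + t *\<^sub>R v) \<le> d z - \<alpha> * t"
    and x: "d x \<ge> r"
  shows "reach {y \<in> G. d y \<ge> r} x > 0"
proof -
  define A where "A = {y \<in> G. d y \<ge> r}"
  \<comment> \<open>Adding \<open>1\<close> keeps the constant, and hence the shift \<open>t\<close>, positive also for \<open>c = 0\<close>.\<close>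
  define k where "k = \<bar>c\<bar> + 1"
  have k: "k > 0" by (simp add: k_def)
  define \<epsilon> where "\<epsilon> = min (\<rho> / 4) (\<alpha> / k)"
  have \<epsilon>: "\<epsilon> > 0" "\<epsilon> \<le> \<rho> / 4" "k * \<epsilon> \<le> \<alpha>"
    using \<rho> \<alpha> k by (auto simp: \<epsilon>_def min_def field_simps)
  have xA: "x \<in> A" using x \<rho> by (auto simp: A_def)
  have ex1: "\<exists>!a. a \<in> A \<and> (\<forall>b\<in>A. dist q a \<le> dist q b)" if q: "dist x q < \<epsilon>" for q
  proof -
    define A' where "A' = {y \<in> cball x (2 * \<epsilon>). r \<le> d y}"
    have sub: "cball x (2 * \<epsilon>) \<subseteq> ball x \<rho>" using \<epsilon> by auto
    have "closed A'"
      unfolding A'_def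
      using continuous_on_closed_Collect_le[OF continuous_on_const continuous_on_subset[OF cont sub] closed_cball] .
    moreover have "bounded A'" by (rule bounded_subset[OF bounded_cball]) (auto simp: A'_def)
    ultimately have "compact A'" by (simp add: compact_eq_bounded_closed)
    moreover have xA': "x \<in> A'" using x \<epsilon> by (simp add: A'_def)
    ultimately obtain a where a: "a \<in> A'" "\<And>b. b \<in> A' \<Longrightarrow> dist q a \<le> dist q b"
      using distance_attains_inf[of A' q] \<open>closed A'\<close> by blast
    have aA: "a \<in> A" using a(1) sub \<rho>(2) by (auto simp: A_def A'_def)
    have nearest: "dist q a \<le> dist q b" if "b \<in> A" for b
    proof (cases "b \<in> cball x (2 * \<epsilon>)")
      case True
      then show ?thesis using a(2) that by (simp add: A_def A'_def)
    next
      case False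
      then have "2 * \<epsilon> < dist x b" by simp
      also have "\<dots> \<le> dist x q + dist q b" by (rule dist_triangle)
      finally have "dist x q < dist q b" using q by linarith
      then show ?thesis using a(2)[OF xA'] by (simp add: dist_commute)
    qed
    have unique: "a = b" if b: "b \<in> A" "\<forall>b'\<in>A. dist q b \<le> dist q b'" for b
    proof (rule ccontr)
      assume "a \<noteq> b"
      define R where "R = dist q a"
      have Rb: "dist q b = R" using nearest[OF b(1)] b(2) aA by (auto simp: R_def intro: antisym)
      have R\<epsilon>: "R < \<epsilon>" using nearest[OF xA] q by (simp add: R_def dist_commute)
      have "a \<in> ball x (2 * \<epsilon>)" "b \<in> ball x (2 * \<epsilon>)"
        using dist_triangle[of x a q] dist_triangle[of x b q] R\<epsilon> q Rb by (auto simp: R_def)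
      then have ab: "a \<in> ball x (2 * \<epsilon>)" "b \<in> ball x (2 * \<epsilon>)" by auto
      define m where "m = (1 - 1/2) *\<^sub>R a + (1/2) *\<^sub>R b"
      have m: "m \<in> ball x (2 * \<epsilon>)"
        unfolding m_def by (rule convexD_alt[OF convex_ball ab]) simp_all
      define \<delta> where "\<delta> = (norm (a - b))\<^sup>2"
      have \<delta>: "\<delta> > 0" using \<open>a \<noteq> b\<close> by (simp add: \<delta>_def)
      have R: "R > 0"
      proof (rule ccontr)
        assume "\<not> R > 0"
        then have "dist q a = 0" "dist q b = 0" using Rb by (auto simp: R_def)
        then show False using \<open>a \<noteq> b\<close> by simp
      qed
      have "norm (a - b) \<le> 2 * R"
        using dist_triangle[of a b q] Rb by (simp add: R_def dist_norm norm_minus_commute)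
      then have "\<delta> \<le> (2 * R)\<^sup>2" unfolding \<delta>_def by (intro power_mono) auto
      then have \<delta>R: "\<delta> \<le> 4 * R\<^sup>2" by (simp add: power_mult_distrib)
      define t where "t = k * \<delta> / (8 * \<alpha>)"
      have t: "t > 0" using k \<delta> \<alpha> by (simp add: t_def)
      have kR: "k * R < \<alpha>" using R\<epsilon> k \<epsilon>(3) by (meson less_le_trans mult_strict_left_mono)
      have "8 * \<alpha> * t = k * \<delta>" using \<alpha> by (simp add: t_def)
      also have "\<dots> \<le> k * (4 * R\<^sup>2)" using \<delta>R k by (intro mult_left_mono) auto
      also have "\<dots> = 4 * R * (k * R)" by (simp add: power2_eq_square)
      also have "\<dots> \<le> 4 * R * \<alpha>" using kR R by (intro mult_left_mono) auto
      finally have "\<alpha> * (8 * t) \<le> \<alpha> * (4 * R)" by (simp add: mult_ac)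
      then have tR: "2 * t \<le> R" using \<alpha> by simp
      have m_ball: "m \<in> ball x \<rho>" using m \<epsilon> by auto
      have "dist x (m - t *\<^sub>R v) \<le> dist x m + t"
        using dist_triangle[of x "m - t *\<^sub>R v" m] v t by (simp add: dist_norm)
      also have "\<dots> < \<rho>" using m tR R\<epsilon> \<epsilon> t by auto
      finally have mt_ball: "m - t *\<^sub>R v \<in> ball x \<rho>" by simp
      have a\<rho>: "a \<in> ball x \<rho>" "b \<in> ball x \<rho>" using ab \<epsilon> by auto
      have "(1 - 1/2) * d a + (1/2) * d b - \<bar>c\<bar> / 2 * ((1/2) * (1 - 1/2) * (norm (a - b))\<^sup>2) \<le> d m"
        unfolding m_def by (rule semiconcave_lower_bound[OF conc a\<rho>]) auto
      moreover have "r \<le> d a" "r \<le> d b" using aA b(1) by (auto simp: A_def)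
      ultimately have "r - \<bar>c\<bar> / 8 * \<delta> \<le> d m" by (simp add: \<delta>_def)
      moreover have "d m \<le> d (m - t *\<^sub>R v) - \<alpha> * t"
        using descent[of "m - t *\<^sub>R v" t] mt_ball m_ball t by simp
      moreover have "\<alpha> * t = k / 8 * \<delta>" using \<alpha> by (simp add: t_def)
      moreover have "\<bar>c\<bar> / 8 * \<delta> \<le> k / 8 * \<delta>" using \<delta> by (intro mult_right_mono) (auto simp: k_def)
      ultimately have "r \<le> d (m - t *\<^sub>R v)" by linarith
      then have "m - t *\<^sub>R v \<in> A" using mt_ball \<rho>(2) by (auto simp: A_def)
      then have "R \<le> dist q (m - t *\<^sub>R v)" using nearest by (simp add: R_def)
      also have "\<dots> \<le> norm (q - m) + t"
        using dist_triangle[of q "m - t *\<^sub>R v" m] v t by (simp add: dist_norm)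
      finally have "R - t \<le> norm (q - m)" by simp
      then have "(R - t)\<^sup>2 \<le> (norm (q - m))\<^sup>2" using tR t R by (intro power_mono) auto
      also have "q - m = (1 - 1/2) *\<^sub>R (q - a) + (1/2) *\<^sub>R (q - b)"
        by (simp add: m_def algebra_simps scaleR_left.add[symmetric])
      also have "(norm \<dots>)\<^sup>2 = R\<^sup>2 - \<delta> / 4"
        unfolding norm_convex_combination_power2 using Rb
        by (simp add: R_def \<delta>_def dist_norm norm_minus_commute field_simps)
      finally have "\<delta> / 4 \<le> 2 * R * t - t\<^sup>2" by (simp add: power2_eq_square algebra_simps)
      also have "\<dots> \<le> 2 * R * t" by simp
      finally have "\<alpha> * \<delta> \<le> 8 * R * (\<alpha> * t)" using \<alpha> by (simp add: field_simps)
      also have "\<dots> = (k * R) * \<delta>" using \<alpha> by (simp add: t_def)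
      also have "\<dots> < \<alpha> * \<delta>" using kR \<delta> by (rule mult_strict_right_mono)
      finally show False by simp
    qed
    show ?thesis using aA nearest unique by blast
  qed
  then have "ennreal \<epsilon> \<le> reach A x" unfolding reach_def using \<epsilon>(1) by (intro Sup_upper) blast
  then show ?thesis using \<epsilon>(1) unfolding A_def by (metis ennreal_less_zero_iff order_less_le_trans)
qed

section \<open>Level sets of noncritical values\<close>

text \<open>
  The bound \<open>\<eta>\<close> on the radius makes it possible to stay inside a ball on which \<open>d\<close> is semiconcave.
\<close>
lemma noncritical_local_data:
  fixes d :: "'a::euclidean_space \<Rightarrow> real"
  assumes dc: "locally_dc_on UNIV G d" and x: "x \<in> G" "x \<notin> Crit G d" and \<eta>: "\<eta> > 0"
  obtains U g h v \<alpha> \<rho> L where "open U" "U \<subseteq> G" "convex_on U g" "convex_on U h"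
    "\<And>y. y \<in> U \<Longrightarrow> d y = g y - h y" "\<rho> > 0" "\<rho> \<le> \<eta>" "ball x \<rho> \<subseteq> U" "\<alpha> > 0" "norm v = 1" "L > 0"
    "\<And>z w. z \<in> ball x \<rho> \<Longrightarrow> w \<in> subdiff U g z \<Longrightarrow> norm w \<le> L"
    "\<And>z w. z \<in> ball x \<rho> \<Longrightarrow> w \<in> subdiff U h z \<Longrightarrow> norm w \<le> L"
    "\<And>z t. z \<in> ball x \<rho> \<Longrightarrow> z + t *\<^sub>R v \<in> ball x \<rho> \<Longrightarrow> 0 < t \<Longrightarrow> d (z + t *\<^sub>R v) \<le> d z - \<alpha> * t"
proof -
  obtain U where "openin (top_of_set UNIV) U" and xU: "x \<in> U" and UG: "U \<subseteq> G" and dcU: "dc_on U d"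
    using dc x(1) unfolding locally_dc_on_def by blast
  then have U: "open U" by simp
  obtain g h where gh: "convex_on U g" "convex_on U h" "\<And>y. y \<in> U \<Longrightarrow> d y = g y - h y"
    using dcU unfolding dc_on_def by blast
  obtain \<rho>1 L1 where 1: "\<rho>1 > 0" "L1 > 0" "ball x \<rho>1 \<subseteq> U"
    "\<And>z w. z \<in> ball x \<rho>1 \<Longrightarrow> w \<in> subdiff U g z \<Longrightarrow> norm w \<le> L1"
    using subdiff_locally_bounded[OF U gh(1) xU] by blast
  obtain \<rho>2 L2 where 2: "\<rho>2 > 0" "L2 > 0" "ball x \<rho>2 \<subseteq> U"
    "\<And>z w. z \<in> ball x \<rho>2 \<Longrightarrow> w \<in> subdiff U h z \<Longrightarrow> norm w \<le> L2"
    using subdiff_locally_bounded[OF U gh(2) xU] by blast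
  obtain v where "descent_direction d x v" using x Crit_iff by blast
  then obtain \<alpha> \<delta> where \<alpha>: "\<alpha> > 0" and \<delta>: "\<delta> > 0"
    and desc: "\<And>z t. z \<in> ball x \<delta> \<Longrightarrow> 0 < t \<Longrightarrow> t < \<delta> \<Longrightarrow> d (z + t *\<^sub>R v) \<le> d z - \<alpha> * t"
    unfolding descent_direction_def by blast
  have v0: "v \<noteq> 0"
  proof
    assume "v = 0"
    then show False using desc[of x "\<delta> / 2"] \<alpha> \<delta> by (simp add: zero_le_mult_iff mult_le_0_iff)
  qed
  define n where "n = norm v"
  have n: "n > 0" using v0 by (simp add: n_def)
  define \<rho> where "\<rho> = min (min \<rho>1 \<rho>2) (min \<eta> (min \<delta> (\<delta> * n / 2)))"
  have "\<rho> > 0" using 1(1) 2(1) \<delta> n \<eta> unfolding \<rho>_def by simp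
  moreover have "\<rho> \<le> \<rho>1" "\<rho> \<le> \<rho>2" "\<rho> \<le> \<delta>" "\<rho> \<le> \<delta> * n / 2" "\<rho> \<le> \<eta>"
    unfolding \<rho>_def by linarith+
  ultimately have \<rho>: "\<rho> > 0" "\<rho> \<le> \<rho>1" "\<rho> \<le> \<rho>2" "\<rho> \<le> \<delta>" "\<rho> \<le> \<delta> * n / 2" "\<rho> \<le> \<eta>" .
  define v' where "v' = (1 / n) *\<^sub>R v"
  have v': "norm v' = 1" using n by (simp add: v'_def n_def)
  show thesis
  proof (rule that[OF U UG gh, of \<rho> "\<alpha> / n" v' "max L1 L2"])
    show "\<rho> > 0" "\<rho> \<le> \<eta>" using \<rho>(1,6) .
    show "ball x \<rho> \<subseteq> U" using 1(3) subset_ball[OF \<rho>(2)] by blast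
    show "\<alpha> / n > 0" using \<alpha> n by simp
    show "norm v' = 1" using v' .
    show "max L1 L2 > 0" using 1(2) by simp
    show "norm w \<le> max L1 L2" if "z \<in> ball x \<rho>" "w \<in> subdiff U g z" for z w
      using 1(4)[OF _ that(2)] subset_ball[OF \<rho>(2)] that(1) by (meson le_max_iff_disj subsetD)
    show "norm w \<le> max L1 L2" if "z \<in> ball x \<rho>" "w \<in> subdiff U h z" for z w
      using 2(4)[OF _ that(2)] subset_ball[OF \<rho>(3)] that(1) by (meson le_max_iff_disj subsetD)
    show "d (z + t *\<^sub>R v') \<le> d z - \<alpha> / n * t" if "z \<in> ball x \<rho>" "z + t *\<^sub>R v' \<in> ball x \<rho>" "0 < t" for z t
    proof -
      have "t = dist z (z + t *\<^sub>R v')" using that(3) v' by (simp add: dist_norm)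
      also have "\<dots> \<le> dist x z + dist x (z + t *\<^sub>R v')" by (rule dist_triangle3)
      also have "\<dots> < 2 * \<rho>" using that(1,2) by simp
      finally have "t < \<delta> * n" using \<rho>(5) by linarith
      then have "t / n < \<delta>" using n by (simp add: field_simps)
      moreover have "z \<in> ball x \<delta>" using that(1) subset_ball[OF \<rho>(4)] by blast
      moreover have "0 < t / n" using that(3) n by simp
      ultimately have "d (z + (t / n) *\<^sub>R v) \<le> d z - \<alpha> * (t / n)" by (intro desc)
      then show ?thesis by (simp add: v'_def)
    qed
  qed
qed

lemma noncritical_level_graph:
  fixes d :: "'a::euclidean_space \<Rightarrow> real"
  assumes dc: "locally_dc_on UNIV G d" and x: "x \<in> G" "x \<notin> Crit G d" and \<eta>: "\<eta> > 0"
  obtains v \<alpha> \<rho> M D \<phi> W where "norm v = 1" "\<alpha> > 0" "\<rho> > 0" "\<rho> \<le> \<eta>" "ball x \<rho> \<subseteq> G" "M \<ge> 0"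
    "continuous_on (ball x \<rho>) d"
    "\<And>z t. z \<in> ball x \<rho> \<Longrightarrow> z + t *\<^sub>R v \<in> ball x \<rho> \<Longrightarrow> 0 < t \<Longrightarrow> d (z + t *\<^sub>R v) \<le> d z - \<alpha> * t"
    "openin (top_of_set {u. v \<bullet> u = 0}) D" "convex D" "open W" "x \<in> W"
    "\<And>u. u \<in> D \<Longrightarrow> u + \<phi> u *\<^sub>R v \<in> ball x \<rho>" "\<And>u. u \<in> D \<Longrightarrow> d (u + \<phi> u *\<^sub>R v) = d x"
    "\<And>u w. u \<in> D \<Longrightarrow> w \<in> D \<Longrightarrow> \<bar>\<phi> u - \<phi> w\<bar> \<le> M * norm (u - w)"
    "{y \<in> G. d y = d x} \<inter> W = {u + \<phi> u *\<^sub>R v |u. u \<in> D}" "dc_on D \<phi>"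
proof -
  obtain U g h v \<alpha> \<rho> L where U: "open U" "U \<subseteq> G" and gh: "convex_on U g" "convex_on U h"
    "\<And>y. y \<in> U \<Longrightarrow> d y = g y - h y" and \<rho>: "\<rho> > 0" "\<rho> \<le> \<eta>" "ball x \<rho> \<subseteq> U"
    and \<alpha>: "\<alpha> > 0" and v: "norm v = 1" and L0: "L > 0"
    and L: "\<And>z w. z \<in> ball x \<rho> \<Longrightarrow> w \<in> subdiff U g z \<Longrightarrow> norm w \<le> L"
    "\<And>z w. z \<in> ball x \<rho> \<Longrightarrow> w \<in> subdiff U h z \<Longrightarrow> norm w \<le> L"
    and descent: "\<And>z t. z \<in> ball x \<rho> \<Longrightarrow> z + t *\<^sub>R v \<in> ball x \<rho> \<Longrightarrow> 0 < t \<Longrightarrow> d (z + t *\<^sub>R v) \<le> d z - \<alpha> * t"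
    by (rule noncritical_local_data[OF assms]) blast
  define K where "K = 2 * L"
  have K: "K \<ge> 0" using L0 by (simp add: K_def)
  have ne: "subdiff U g z \<noteq> {}" "subdiff U h z \<noteq> {}" if "z \<in> ball x \<rho>" for z
    using subdiff_nonempty[OF U(1) gh(1)] subdiff_nonempty[OF U(1) gh(2)] that \<rho>(3) by blast+
  have lip: "\<bar>d y - d z\<bar> \<le> K * norm (y - z)" if yz: "y \<in> ball x \<rho>" "z \<in> ball x \<rho>" for y z
  proof -
    have "\<bar>g y - g z\<bar> \<le> L * norm (y - z)"
      by (rule bounded_subdiff_imp_lipschitz[OF ne(1) \<rho>(3) L(1) yz])
    moreover have "\<bar>h y - h z\<bar> \<le> L * norm (y - z)"
      by (rule bounded_subdiff_imp_lipschitz[OF ne(2) \<rho>(3) L(2) yz])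
    moreover have "d y = g y - h y" "d z = g z - h z" using gh(3) yz \<rho>(3) by blast+
    ultimately show ?thesis by (simp add: K_def)
  qed
  obtain D \<phi> W where D: "openin (top_of_set {u. v \<bullet> u = 0}) D" "convex D" "D \<noteq> {}"
    and W: "open W" "x \<in> W" "W \<subseteq> ball x \<rho>"
    and graph: "\<And>u. u \<in> D \<Longrightarrow> u + \<phi> u *\<^sub>R v \<in> ball x \<rho>" "\<And>u. u \<in> D \<Longrightarrow> d (u + \<phi> u *\<^sub>R v) = d x"
    and \<phi>_lip: "\<And>u w. u \<in> D \<Longrightarrow> w \<in> D \<Longrightarrow> \<bar>\<phi> u - \<phi> w\<bar> \<le> K / \<alpha> * norm (u - w)"
    and level: "{y \<in> W. d y = d x} = {u + \<phi> u *\<^sub>R v |u. u \<in> D}"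
  proof (rule level_set_graph[OF v \<alpha> \<rho>(1) K lip descent])
    fix D \<phi> W
    assume "openin (top_of_set {u. v \<bullet> u = 0}) D" "convex D" "D \<noteq> {}" "open W" "x \<in> W" "W \<subseteq> ball x \<rho>"
      "\<And>u. u \<in> D \<Longrightarrow> u + \<phi> u *\<^sub>R v \<in> ball x \<rho>" "\<And>u. u \<in> D \<Longrightarrow> d (u + \<phi> u *\<^sub>R v) = d x"
      "\<And>u w. u \<in> D \<Longrightarrow> w \<in> D \<Longrightarrow> \<bar>\<phi> u - \<phi> w\<bar> \<le> K / \<alpha> * norm (u - w)"
      "{y \<in> W. d y = d x} = {u + \<phi> u *\<^sub>R v |u. u \<in> D}"
    then show thesis by (rule that)
  qed
  have K\<alpha>: "K / \<alpha> \<ge> 0" using K \<alpha> by simp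
  have \<phi>_cont: "continuous_on D \<phi>"
  proof (rule lipschitz_on_continuous_on)
    show "(K / \<alpha>)-lipschitz_on D \<phi>"
      by (rule lipschitz_onI) (simp_all only: dist_norm real_norm_def \<phi>_lip K\<alpha>)
  qed
  have d_cont: "continuous_on (ball x \<rho>) d"
  proof (rule lipschitz_on_continuous_on)
    show "K-lipschitz_on (ball x \<rho>) d"
      by (rule lipschitz_onI) (simp_all only: dist_norm real_norm_def lip K)
  qed
  have \<phi>_dc: "dc_on D \<phi>"
    by (rule level_graph_dc[OF U(1) gh open_ball \<rho>(3) L v \<alpha> descent D(2,3) \<phi>_cont graph])
  have BG: "ball x \<rho> \<subseteq> G" using \<rho>(3) U(2) by (rule subset_trans)
  have "{y \<in> G. d y = d x} \<inter> W = {y \<in> W. d y = d x}" using W(3) BG by blast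
  then have M: "{y \<in> G. d y = d x} \<inter> W = {u + \<phi> u *\<^sub>R v |u. u \<in> D}" using level by (rule trans)
  show thesis
    by (rule that[OF v \<alpha> \<rho>(1,2) BG K\<alpha> d_cont descent D(1,2) W(1,2) graph \<phi>_lip M \<phi>_dc])
qed


lemma dc_on_imp_continuous_on:
  assumes "dc_on C f"
  shows "continuous_on C f"
proof -
  obtain g h where "continuous_on C g" "continuous_on C h" and eq: "\<forall>x\<in>C. f x = g x - h x"
    using assms unfolding dc_on_def by blast
  then have "continuous_on C (\<lambda>x. g x - h x)" by (intro continuous_intros)
  then show ?thesis using eq by (simp cong: continuous_on_cong)
qed

lemma dc_on_mult_right:
  assumes "dc_on C f"
  shows "dc_on C (\<lambda>x. f x * k)"
proof -
  obtain g h where C: "C \<noteq> {}" "convex C"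
    and gh: "continuous_on C g" "convex_on C g" "continuous_on C h" "convex_on C h" "\<forall>x\<in>C. f x = g x - h x"
    using assms unfolding dc_on_def by blast
  show ?thesis
  proof (cases "0 \<le> k")
    case True
    have "\<forall>x\<in>C. f x * k = k * g x - k * h x" using gh(5) by (simp add: left_diff_distrib right_diff_distrib mult.commute)
    moreover have "continuous_on C (\<lambda>x. k * g x)" "continuous_on C (\<lambda>x. k * h x)"
      by (rule continuous_on_mult_left[OF gh(1)] continuous_on_mult_left[OF gh(3)])+
    moreover have "convex_on C (\<lambda>x. k * g x)" "convex_on C (\<lambda>x. k * h x)"
      by (rule convex_on_cmul[OF True gh(2)] convex_on_cmul[OF True gh(4)])+
    ultimately show ?thesis unfolding dc_on_def using C by blast
  next
    case False
    then have k: "0 \<le> - k" by simp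
    have "\<forall>x\<in>C. f x * k = (- k) * h x - (- k) * g x" using gh(5) by (simp add: left_diff_distrib right_diff_distrib mult.commute)
    moreover have "continuous_on C (\<lambda>x. (- k) * g x)" "continuous_on C (\<lambda>x. (- k) * h x)"
      by (rule continuous_on_mult_left[OF gh(1)] continuous_on_mult_left[OF gh(3)])+
    moreover have "convex_on C (\<lambda>x. (- k) * g x)" "convex_on C (\<lambda>x. (- k) * h x)"
      by (rule convex_on_cmul[OF k gh(2)] convex_on_cmul[OF k gh(4)])+
    ultimately show ?thesis unfolding dc_on_def using C by blast
  qed
qed

lemma level_set_dc_surface:
  fixes d :: "'a::euclidean_space \<Rightarrow> real"
  assumes n: "DIM('a) \<ge> 2" and dc: "locally_dc_on UNIV G d" and r: "r \<in> d ` G - cv G d"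
  shows "dc_surface (DIM('a) - 1) {x \<in> G. d x = r}"
  unfolding dc_surface_def
proof (intro conjI ballI)
  show "1 \<le> DIM('a) - 1" "DIM('a) - 1 < DIM('a)" using n by auto
  show "{x \<in> G. d x = r} \<noteq> {}" using r by blast
  fix x assume "x \<in> {x \<in> G. d x = r}"
  then have x: "x \<in> G" "d x = r" "x \<notin> Crit G d" using r by (auto simp: cv_def)
  obtain v D \<phi> W where v: "norm v = 1" and D: "openin (top_of_set {u. v \<bullet> u = 0}) D"
    and W: "open W" "x \<in> W" "{y \<in> G. d y = d x} \<inter> W = {u + \<phi> u *\<^sub>R v |u. u \<in> D}"
    and \<phi>: "convex D" "dc_on D \<phi>"
    by (rule noncritical_level_graph[OF dc x(1,3) zero_less_one]) blast
  define Q where "Q = {u. v \<bullet> u = 0}"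
  have v0: "v \<noteq> 0" using v by auto
  have v_perp: "c *\<^sub>R v \<in> orthogonal_comp Q" for c
    by (auto simp: orthogonal_comp_def orthogonal_def Q_def inner_commute)
  have DQ: "openin (top_of_set Q) D" using D by (simp add: Q_def)
  have map: "locally_dc_map_on Q D (orthogonal_comp Q) (\<lambda>u. \<phi> u *\<^sub>R v)"
    unfolding locally_dc_map_on_def
  proof (intro ballI exI[of _ D] conjI DQ \<phi>(1) subset_refl)
    show "dc_map_on D (orthogonal_comp Q) (\<lambda>u. \<phi> u *\<^sub>R v)"
      unfolding dc_map_on_def
    proof (intro conjI allI impI)
      show "(\<lambda>u. \<phi> u *\<^sub>R v) ` D \<subseteq> orthogonal_comp Q" using v_perp by blast
      fix l assume l: "linear_functional_on (orthogonal_comp Q) l"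
      have "l (\<phi> u *\<^sub>R v) = \<phi> u * l v" for u
        using l v_perp[of 1] unfolding linear_functional_on_def by simp
      then show "dc_on D (\<lambda>u. l (\<phi> u *\<^sub>R v))" using dc_on_mult_right[OF \<phi>(2)] by simp
    qed
  qed
  show "\<exists>Q W D h. subspace Q \<and> dim Q = DIM('a) - 1 \<and> open W \<and> x \<in> W \<and> openin (top_of_set Q) D \<and>
        locally_dc_map_on Q D (orthogonal_comp Q) h \<and> {x \<in> G. d x = r} \<inter> W = {u + h u |u. u \<in> D}"
    using subspace_hyperplane[of v] dim_hyperplane[OF v0] W DQ map unfolding Q_def[symmetric] x(2) by blast
qed

lemma noncritical_semiconcave_level_graph:
  fixes d :: "'a::euclidean_space \<Rightarrow> real"
  assumes dc: "locally_dc_on UNIV G d" and sc: "locally_semiconcave_on UNIV G d"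
    and x: "x \<in> G" "x \<notin> Crit G d"
  obtains v \<alpha> \<rho> c D \<phi> W where "norm v = 1" "\<alpha> > 0" "\<rho> > 0" "ball x \<rho> \<subseteq> G"
    "continuous_on (ball x \<rho>) d" "concave_on (ball x \<rho>) (\<lambda>y. d y - c / 2 * (norm y)\<^sup>2)"
    "\<And>z t. z \<in> ball x \<rho> \<Longrightarrow> z + t *\<^sub>R v \<in> ball x \<rho> \<Longrightarrow> 0 < t \<Longrightarrow> d (z + t *\<^sub>R v) \<le> d z - \<alpha> * t"
    "openin (top_of_set {u. v \<bullet> u = 0}) D" "open W" "x \<in> W"
    "{y \<in> G. d y = d x} \<inter> W = {u + \<phi> u *\<^sub>R v |u. u \<in> D}" "semiconcave_on D \<phi>"
proof -
  obtain \<eta> c where \<eta>: "\<eta> > 0" "concave_on (ball x \<eta>) (\<lambda>y. d y - c / 2 * (norm y)\<^sup>2)"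
    using sc x(1) unfolding locally_semiconcave_on_def semiconcave_on_def by force
  show thesis
  proof (rule noncritical_level_graph[OF dc x \<eta>(1)])
    fix v \<alpha> \<rho> M D \<phi> W
    assume *: "norm v = 1" "\<alpha> > 0" "\<rho> > 0" "\<rho> \<le> \<eta>" "ball x \<rho> \<subseteq> G" "M \<ge> 0" "continuous_on (ball x \<rho>) d"
      and descent: "\<And>z t. z \<in> ball x \<rho> \<Longrightarrow> z + t *\<^sub>R v \<in> ball x \<rho> \<Longrightarrow> 0 < t \<Longrightarrow> d (z + t *\<^sub>R v) \<le> d z - \<alpha> * t"
      and D: "openin (top_of_set {u. v \<bullet> u = 0}) D" "convex D" "open W" "x \<in> W"
      and graph: "\<And>u. u \<in> D \<Longrightarrow> u + \<phi> u *\<^sub>R v \<in> ball x \<rho>" "\<And>u. u \<in> D \<Longrightarrow> d (u + \<phi> u *\<^sub>R v) = d x"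
      and lip: "\<And>u w. u \<in> D \<Longrightarrow> w \<in> D \<Longrightarrow> \<bar>\<phi> u - \<phi> w\<bar> \<le> M * norm (u - w)"
      and level: "{y \<in> G. d y = d x} \<inter> W = {u + \<phi> u *\<^sub>R v |u. u \<in> D}"
    have conc: "concave_on (ball x \<rho>) (\<lambda>y. d y - c / 2 * (norm y)\<^sup>2)"
      using \<eta>(2) subset_ball[OF *(4)] convex_ball unfolding concave_on_def by (rule convex_on_subset)
    have sc_\<phi>: "semiconcave_on D \<phi>"
      by (rule level_graph_semiconcave[OF conc *(1,2) descent D(2) *(6) lip graph])
    show thesis by (rule that[OF *(1,2,3,5,7) conc descent D(1,3,4) level sc_\<phi>])
  qed
qed

lemma level_set_semiconcave_surface:
  fixes d :: "'a::euclidean_space \<Rightarrow> real"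
  assumes dc: "locally_dc_on UNIV G d" and sc: "locally_semiconcave_on UNIV G d" and r: "r \<in> d ` G - cv G d"
  shows "semiconcave_surface {x \<in> G. d x = r}" "locally_positive_reach {x \<in> G. d x \<ge> r}"
proof -
  have level_noncrit: "x \<notin> Crit G d" if "x \<in> G" "d x = r" for x using r that by (auto simp: cv_def)
  show "semiconcave_surface {x \<in> G. d x = r}"
    unfolding semiconcave_surface_def
  proof (intro conjI ballI)
    show "{x \<in> G. d x = r} \<noteq> {}" using r by blast
    fix x assume "x \<in> {x \<in> G. d x = r}"
    then have x: "x \<in> G" "d x = r" by auto
    obtain v D \<phi> W where v: "norm v = 1"
      and D: "openin (top_of_set {u. v \<bullet> u = 0}) D" and W: "open W" "x \<in> W"
      "{y \<in> G. d y = d x} \<inter> W = {u + \<phi> u *\<^sub>R v |u. u \<in> D}" and sc_\<phi>: "semiconcave_on D \<phi>"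
      by (rule noncritical_semiconcave_level_graph[OF dc sc x(1) level_noncrit[OF x]]) blast
    define Q where "Q = {u. v \<bullet> u = 0}"
    have v0: "v \<noteq> 0" using v by auto
    have v_perp: "v \<in> orthogonal_comp Q"
      by (auto simp: orthogonal_comp_def orthogonal_def Q_def inner_commute)
    have DQ: "openin (top_of_set Q) D" using D by (simp add: Q_def)
    have lsc: "locally_semiconcave_on Q D \<phi>"
      unfolding locally_semiconcave_on_def
    proof
      fix u assume "u \<in> D"
      then obtain e where e: "e > 0" "ball u e \<inter> Q \<subseteq> D"
        using DQ unfolding openin_contains_ball by blast
      have "convex (ball u e \<inter> Q)"
        unfolding Q_def by (intro convex_Int convex_ball convex_hyperplane)
      then have "semiconcave_on (ball u e \<inter> Q) \<phi>"
        using sc_\<phi> e(2) unfolding semiconcave_on_def concave_on_def by (meson convex_on_subset)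
      then show "\<exists>\<delta>>0. ball u \<delta> \<inter> Q \<subseteq> D \<and> semiconcave_on (ball u \<delta> \<inter> Q) \<phi>" using e by blast
    qed
    show "\<exists>Q W D v s. subspace Q \<and> dim Q = DIM('a) - 1 \<and> open W \<and> x \<in> W \<and> openin (top_of_set Q) D \<and>
        v \<noteq> 0 \<and> v \<in> orthogonal_comp Q \<and> locally_semiconcave_on Q D s \<and>
        {x \<in> G. d x = r} \<inter> W = {u + s u *\<^sub>R v |u. u \<in> D}"
      using subspace_hyperplane[of v] dim_hyperplane[OF v0] v0 W DQ lsc v_perp
      unfolding Q_def[symmetric] x(2) by blast
  qed
  show "locally_positive_reach {x \<in> G. d x \<ge> r}"
    unfolding locally_positive_reach_def
  proof (intro conjI ballI)
    show "{x \<in> G. d x \<ge> r} \<noteq> {}" using r by blast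
    fix x assume "x \<in> {x \<in> G. d x \<ge> r}"
    then have x: "x \<in> G" "d x \<ge> r" by auto
    show "reach {x \<in> G. d x \<ge> r} x > 0"
    proof (cases "d x = r")
      case True
      show ?thesis
      proof (rule noncritical_semiconcave_level_graph[OF dc sc x(1) level_noncrit[OF x(1) True]])
        fix v \<alpha> \<rho> c
        assume *: "norm v = 1" "\<alpha> > 0" "\<rho> > 0" "ball x \<rho> \<subseteq> G" "continuous_on (ball x \<rho>) d"
          "concave_on (ball x \<rho>) (\<lambda>y. d y - c / 2 * (norm y)\<^sup>2)"
          "\<And>z t. z \<in> ball x \<rho> \<Longrightarrow> z + t *\<^sub>R v \<in> ball x \<rho> \<Longrightarrow> 0 < t \<Longrightarrow> d (z + t *\<^sub>R v) \<le> d z - \<alpha> * t"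
        show ?thesis by (rule reach_pos_superlevel[OF * x(2)])
      qed
    next
      case False
      then have gt: "d x > r" using x(2) by simp
      obtain U where U: "open U" "x \<in> U" "U \<subseteq> G" "dc_on U d"
        using dc x(1) unfolding locally_dc_on_def by force
      have "continuous_on U d" by (rule dc_on_imp_continuous_on[OF U(4)])
      then have "open {y \<in> U. d y \<in> {r<..}}"
        using U(1) by (simp add: continuous_open_preimage Collect_conj_eq vimage_def[symmetric] del: greaterThan_iff)
      moreover have "x \<in> {y \<in> U. d y \<in> {r<..}}" using U(2) gt by simp
      ultimately obtain e where "e > 0" "ball x e \<subseteq> {y \<in> U. d y \<in> {r<..}}" by (rule openE)
      then show ?thesis using U(3) by (intro reach_pos_interior[of e]) (auto simp: subset_iff less_imp_le)
    qed
  qed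
qed

theorem theorem3p4:
  fixes G :: "(real ^ 'n) set" and d :: "real ^ 'n \<Rightarrow> real"
  assumes "CARD('n) \<in> {2, 3}"
    and "open G"
    and "locally_dc_on UNIV G d"
    and "\<not> (\<exists>x\<in>G. stationary_point d x)"
  shows "\<exists>N C.
    hausdorff_measure ((real CARD('n) - 1) / 2) N = 0 \<and>
    (\<forall>r \<in> d ` G - N. dc_surface (CARD('n) - 1) {x \<in> G. d x = r}) \<and>
    (locally_semiconcave_on UNIV G d \<longrightarrow>
      (\<forall>r \<in> d ` G - N. semiconcave_surface {x \<in> G. d x = r} \<and>
                       locally_positive_reach {x \<in> G. d x \<ge> r})) \<and>
    closedin (top_of_set G) C \<and> N = d ` C \<and>
    C = Crit G d \<and> N = cv G d"
proof (intro exI conjI ballI impI)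
  have n: "CARD('n) \<ge> 2" using assms(1) by auto
  show "hausdorff_measure ((real CARD('n) - 1) / 2) (cv G d) = 0"
    using assms(4) by (intro critical_values_null[OF n assms(3)]) blast
  show "dc_surface (CARD('n) - 1) {x \<in> G. d x = r}" if "r \<in> d ` G - cv G d" for r
    using level_set_dc_surface[OF _ assms(3) that] n by simp
  show "semiconcave_surface {x \<in> G. d x = r}" "locally_positive_reach {x \<in> G. d x \<ge> r}"
    if "locally_semiconcave_on UNIV G d" "r \<in> d ` G - cv G d" for r
    using level_set_semiconcave_surface[OF assms(3) that] .
  show "closedin (top_of_set G) (Crit G d)" using assms(2) by (rule closedin_Crit)
  show "cv G d = d ` Crit G d" by (simp add: cv_def)
qed simp_all

end
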